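(* Let $T=\sum_{i=1}^m a_i\otimes K_i\in A\otimes B\otimes C=\mathbb C^m\otimes\mathbb C^m\otimes\mathbb C^m$ be a concise tensor which is 111-abundant and not $1_A$-generic, where $\{a_i\}$ is a basis of $A$ and $K_i\in B\otimes C=\mathrm{Hom}(B^*,C)$. Suppose that $K_1:B^*\to C$ has rank $m-1$. Choose decompositions $B^*={B^*}'\oplus\ker(K_1)={B^*}'\oplus\langle\beta_m\rangle$ and $C=\mathrm{Im}(K_1)\oplus\langle c_m\rangle=:C'\oplus\langle c_m\rangle$ and use $K_1$ to identify ${B^*}'$ with $C'$. Then there exist bases of $A,B,C$ such that, in block form with respect to these decompositions, $$K_1=\begin{pmatrix}\mathrm{Id}_{C'}&0\\0&0\end{pmatrix},\qquad K_s=\begin{pmatrix}\mathbf x_s&0\\0&0\end{pmatrix}\quad(2\le s\le m-1),\qquad K_m=\begin{pmatrix}\mathbf x_m&w_m\\ u_m&0\end{pmatrix}\qquad(\ast)$$ for some $\mathbf x_2,\dots,\mathbf x_m\in\mathrm{End}(C')$, $0\ne u_m\in{C'}^*$ and $0\ne w_m\in C'$ such that, setting $\mathbf x_1:=\mathrm{Id}_{C'}$: (1) $u_m\mathbf x^jw_m=0$ for every $j\ge0$ and every $\mathbf x\in\langle\mathbf x_1,\dots,\mathbf x_m\rangle$; in particular $u_mw_m=0$. (2) The space $\langle\mathbf x_1,\mathbf x_2,\dots,\mathbf x_{m-1}\rangle\subseteq\mathrm{End}(C')$ is $(m-1)$-dimensional, abelian, and End-closed. (3) The space $\langle\mathbf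 x_2,\dots,\mathbf x_{m-1}\rangle$ contains the rank one matrix $w_mu_m$. (4) For all $2\le s\le m-1$, $u_m\mathbf x_s=0$ and $\mathbf x_sw_m=0$. (5) For every $2\le s\le m-1$ there exist vectors $u_s\in{C'}^*$ and $w_s\in C'$ such that $$\mathbf x_s\mathbf x_m+w_su_m=\mathbf x_m\mathbf x_s+w_mu_s\in\langle\mathbf x_2,\dots,\mathbf x_{m-1}\rangle;$$ the vector $[u_s, w_s^{\mathbf t}]\in\mathbb C^{2(m-1)*}$ is unique up to adding multiples of $[u_m, w_m^{\mathbf t}]$. (6) For every $j\ge1$ and $2\le s\le m-1$, $\mathbf x_s\mathbf x_m^jw_m=0$ and $u_m\mathbf x_m^j\mathbf x_s=0$. Moreover, the tensor $T$ is 111-sharp. Conversely, any tensor of the form $(\ast)$ (with $u_m\neq 0$, $w_m\neq 0$) satisfying (1)--(5) is 111-sharp, concise and not $1_A$-generic, hence satisfies (6) as well. Additionally, for any vectors $u^*\in C'$ and $w^*\in(C')^*$ with $u_mu^*=1=w^*w_m$, we may normalize $\mathbf x_m$ such that for every $2\le s\le m-1$ $$\mathbf x_mu^*=0,\qquad w^*\mathbf x_m=0,\qquad u_s=w^*\mathbf x_s\mathbf x_m,\qquad w_s=\mathbf x_m\mathbf x_su^*.$$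
   Context: $A,B,C$ are complex vector spaces of dimension $m$. For $T\in A\otimes B\otimes C$, $T(A^* )\subseteq B\otimes C$, $T(B^* )\subseteq A\otimes C$, $T(C^* )\subseteq A\otimes B$ denote the images of the induced maps from $A^*,B^*,C^*$. $T$ is concise if these three maps are injective, and $1_A$-generic if $T(A^* )$ contains an element of rank $m$. The triple intersection is $(T(A^* )\otimes A)\cap(T(B^* )\otimes B)\cap(T(C^* )\otimes C)\subseteq A\otimes B\otimes C$ (factors placed in the correct positions); $T$ is 111-abundant if its dimension is $\ge m$ and 111-sharp if its dimension equals $m$. Elements of $C'$ are columns, elements of ${C'}^*$ are rows, so that $u_mw_m$ is a scalar and $w_mu_m\in\mathrm{End}(C')$; $\mathbf t$ denotes transpose. A space of endomorphisms is abelian if its elements pairwise commute, and End-closed if it is closed under composition. Matrices of elements of $\mathrm{Hom}(B^*,C)$ have columns indexed by the basis of $B^*$ and rows by the basis of $C$; here $u_m$ is the component ${B^*}'\to\langle c_m\rangle$ and $w_m$ the component $\langle\beta_m\rangle\to C'$ of $K_m$. *)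

theory Defs
  imports "HOL-Analysis.Analysis"
begin

text \<open>
  A tensor in \<open>\<complex>\<^sup>a \<otimes> \<complex>\<^sup>b \<otimes> \<complex>\<^sup>c\<close> is its coordinate array \<open>T $ i $ j $ k\<close>.  The spaces \<open>A, B, C\<close>
  are coordinate spaces, and each dual is identified with the same coordinate space by the dual
  standard basis.  Matrices follow the library convention \<open>M $ row $ column\<close>, so an element of
  \<open>Hom(B\<^sup>*, C)\<close> has type \<open>complex^'b^'c\<close> and acts on \<open>B\<^sup>*\<close> by \<open>*v\<close>.
\<close>

definition matrix_scale :: "complex \<Rightarrow> complex^'n^'m \<Rightarrow> complex^'n^'m" where
  "matrix_scale z M = (\<chi> i j. z * M $ i $ j)"

definition tensor_scale :: "complex \<Rightarrow> complex^'c^'b^'a \<Rightarrow> complex^'c^'b^'a" where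
  "tensor_scale z T = (\<chi> i j k. z * T $ i $ j $ k)"

interpretation mspace: vector_space "matrix_scale :: complex \<Rightarrow> complex^'n^'m \<Rightarrow> complex^'n^'m"
  by unfold_locales (auto simp: matrix_scale_def vec_eq_iff algebra_simps)

interpretation tspace: vector_space "tensor_scale :: complex \<Rightarrow> complex^'c^'b^'a \<Rightarrow> complex^'c^'b^'a"
  by unfold_locales (auto simp: tensor_scale_def vec_eq_iff algebra_simps)

primrec matrix_power :: "complex^'n^'n \<Rightarrow> nat \<Rightarrow> complex^'n^'n" where
  "matrix_power X 0 = mat 1"
| "matrix_power X (Suc j) = X ** matrix_power X j"


definition contract_A :: "complex^'c^'b^'a \<Rightarrow> complex^'a \<Rightarrow> complex^'b^'c" where
  "contract_A T \<alpha> = (\<chi> k j. \<Sum>i\<in>UNIV. \<alpha> $ i * T $ i $ j $ k)"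

definition contract_B :: "complex^'c^'b^'a \<Rightarrow> complex^'b \<Rightarrow> complex^'c^'a" where
  "contract_B T \<beta> = (\<chi> i k. \<Sum>j\<in>UNIV. \<beta> $ j * T $ i $ j $ k)"

definition contract_C :: "complex^'c^'b^'a \<Rightarrow> complex^'c \<Rightarrow> complex^'b^'a" where
  "contract_C T \<gamma> = (\<chi> i j. \<Sum>k\<in>UNIV. \<gamma> $ k * T $ i $ j $ k)"

definition concise :: "complex^'c^'b^'a \<Rightarrow> bool" where
  "concise T \<longleftrightarrow> inj (contract_A T) \<and> inj (contract_B T) \<and> inj (contract_C T)"

definition one_A_generic :: "complex^'m^'m^'m \<Rightarrow> bool" where
  "one_A_generic T \<longleftrightarrow> (\<exists>M \<in> range (contract_A T). rank M = CARD('m))"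

text \<open>
  Products of a vector in one factor with an element of the tensor product of the other two,
  put in the correct positions.
\<close>

definition tensor_A :: "complex^'a \<Rightarrow> complex^'b^'c \<Rightarrow> complex^'c^'b^'a" where
  "tensor_A a M = (\<chi> i j k. a $ i * M $ k $ j)"

definition tensor_B :: "complex^'b \<Rightarrow> complex^'c^'a \<Rightarrow> complex^'c^'b^'a" where
  "tensor_B b M = (\<chi> i j k. b $ j * M $ i $ k)"

definition tensor_C :: "complex^'c \<Rightarrow> complex^'b^'a \<Rightarrow> complex^'c^'b^'a" where
  "tensor_C c M = (\<chi> i j k. c $ k * M $ i $ j)"

definition triple_intersection :: "complex^'c^'b^'a \<Rightarrow> (complex^'c^'b^'a) set" where
  "triple_intersection T =
     tspace.span {tensor_A a M | a M. M \<in> range (contract_A T)} \<inter>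
     tspace.span {tensor_B b M | b M. M \<in> range (contract_B T)} \<inter>
     tspace.span {tensor_C c M | c M. M \<in> range (contract_C T)}"

definition abundant_111 :: "complex^'m^'m^'m \<Rightarrow> bool" where
  "abundant_111 T \<longleftrightarrow> tspace.dim (triple_intersection T) \<ge> CARD('m)"

definition sharp_111 :: "complex^'m^'m^'m \<Rightarrow> bool" where
  "sharp_111 T \<longleftrightarrow> tspace.dim (triple_intersection T) = CARD('m)"


definition basis_family :: "'i set \<Rightarrow> ('i \<Rightarrow> complex^'m) \<Rightarrow> bool" where
  "basis_family I b \<longleftrightarrow> inj_on b I \<and> vec.independent (b ` I) \<and> vec.span (b ` I) = UNIV"

definition direct_decomposition :: "(complex^'m) set \<Rightarrow> (complex^'m) set \<Rightarrow> bool" where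
  "direct_decomposition U V \<longleftrightarrow>
     vec.subspace U \<and> vec.subspace V \<and> U \<inter> V = {0} \<and> {x + y | x y. x \<in> U \<and> y \<in> V} = UNIV"

definition matrix_wrt ::
  "('j::finite \<Rightarrow> complex^'b) \<Rightarrow> ('k::finite \<Rightarrow> complex^'c) \<Rightarrow> complex^'b^'c \<Rightarrow> complex^'j^'k \<Rightarrow> bool"
where
  "matrix_wrt \<beta> c L M \<longleftrightarrow> (\<forall>j. L *v \<beta> j = (\<Sum>k\<in>UNIV. (M $ k $ j) *s c k))"

text \<open>
  The block matrix with rows \<open>(X, w)\<close> and \<open>(u, z)\<close>.  The index type \<open>'n\<close> labels a basis of \<open>C'\<close>
  (of dimension \<open>m - 1\<close>), and \<open>None\<close> is the last, \<open>m\<close>-th, index.  Rows (elements of the dual of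
  \<open>C'\<close>) and columns (elements of \<open>C'\<close>) are matrices with a single row, respectively column, so
  that all products below are matrix products.
\<close>

definition block ::
  "complex^'n^'n \<Rightarrow> complex^1^'n \<Rightarrow> complex^'n^1 \<Rightarrow> complex \<Rightarrow> complex^('n option)^('n option)"
where
  "block X w u z = (\<chi> r s.
     (case r of
        Some i \<Rightarrow> (case s of Some j \<Rightarrow> X $ i $ j | None \<Rightarrow> w $ i $ 1)
      | None \<Rightarrow> (case s of Some j \<Rightarrow> u $ 1 $ j | None \<Rightarrow> z)))"

text \<open>
  The displayed normal form \<open>(\<ast>)\<close>, for \<open>T = \<Sum> a\<^sub>s \<otimes> K\<^sub>s\<close>, with respect to the basis
  \<open>a\<close> of \<open>A\<close>, the basis \<open>\<beta>\<close> of \<open>B\<^sup>*\<close> (equivalently, the dual basis of \<open>B\<close>) and the basis \<open>c\<close> of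
  \<open>C\<close>.  Families numbered \<open>1, \<dots>, m\<close> are functions on \<open>nat\<close>, with \<open>m = CARD('n option)\<close>.  As
  types are nonempty, \<open>m \<ge> 2\<close>; nothing is lost, since for \<open>m = 1\<close> every concise tensor is
  \<open>1\<^sub>A\<close>-generic, and \<open>C' = 0\<close> leaves no room for \<open>u\<^sub>m \<noteq> 0\<close>.
\<close>

definition normal_form ::
  "nat \<Rightarrow> complex^('n option)^('n option)^('n option) \<Rightarrow>
   (nat \<Rightarrow> complex^('n option)) \<Rightarrow> (nat \<Rightarrow> complex^('n option)^('n option)) \<Rightarrow>
   ('n option \<Rightarrow> complex^('n option)) \<Rightarrow> ('n option \<Rightarrow> complex^('n option)) \<Rightarrow>
   (nat \<Rightarrow> complex^'n^'n) \<Rightarrow> complex^'n^1 \<Rightarrow> complex^1^'n \<Rightarrow> bool"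
where
  "normal_form m T a K \<beta> c x u w \<longleftrightarrow>
     basis_family {1..m} a \<and> basis_family UNIV \<beta> \<and> basis_family UNIV c \<and>
     T = (\<Sum>s = 1..m. tensor_A (a s) (K s)) \<and>
     x 1 = mat 1 \<and> u \<noteq> 0 \<and> w \<noteq> 0 \<and>
     matrix_wrt \<beta> c (K 1) (block (mat 1) 0 0 0) \<and>
     (\<forall>s\<in>{2..m-1}. matrix_wrt \<beta> c (K s) (block (x s) 0 0 0)) \<and>
     matrix_wrt \<beta> c (K m) (block (x m) w u 0)"

definition cond1 :: "nat \<Rightarrow> (nat \<Rightarrow> complex^'n^'n) \<Rightarrow> complex^'n^1 \<Rightarrow> complex^1^'n \<Rightarrow> bool" where
  "cond1 m x u w \<longleftrightarrow>
     (\<forall>X \<in> mspace.span (x ` {1..m}). \<forall>j. u ** matrix_power X j ** w = 0) \<and> u ** w = 0"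

definition cond2 :: "nat \<Rightarrow> (nat \<Rightarrow> complex^'n^'n) \<Rightarrow> bool" where
  "cond2 m x \<longleftrightarrow>
     mspace.dim (mspace.span (x ` {1..m-1})) = m - 1 \<and>
     (\<forall>X \<in> mspace.span (x ` {1..m-1}). \<forall>Y \<in> mspace.span (x ` {1..m-1}). X ** Y = Y ** X) \<and>
     (\<forall>X \<in> mspace.span (x ` {1..m-1}). \<forall>Y \<in> mspace.span (x ` {1..m-1}).
        X ** Y \<in> mspace.span (x ` {1..m-1}))"

definition cond3 :: "nat \<Rightarrow> (nat \<Rightarrow> complex^'n^'n) \<Rightarrow> complex^'n^1 \<Rightarrow> complex^1^'n \<Rightarrow> bool" where
  "cond3 m x u w \<longleftrightarrow> w ** u \<in> mspace.span (x ` {2..m-1})"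

definition cond4 :: "nat \<Rightarrow> (nat \<Rightarrow> complex^'n^'n) \<Rightarrow> complex^'n^1 \<Rightarrow> complex^1^'n \<Rightarrow> bool" where
  "cond4 m x u w \<longleftrightarrow> (\<forall>s\<in>{2..m-1}. u ** x s = 0 \<and> x s ** w = 0)"

definition cond5_eq ::
  "nat \<Rightarrow> (nat \<Rightarrow> complex^'n^'n) \<Rightarrow> complex^'n^1 \<Rightarrow> complex^1^'n \<Rightarrow>
   nat \<Rightarrow> complex^'n^1 \<Rightarrow> complex^1^'n \<Rightarrow> bool"
where
  "cond5_eq m x u w s us ws \<longleftrightarrow>
     x s ** x m + ws ** u = x m ** x s + w ** us \<and>
     x m ** x s + w ** us \<in> mspace.span (x ` {2..m-1})"

text \<open>
  The solutions \<open>(u\<^sub>s, w\<^sub>s)\<close> form exactly one coset of the line spanned by \<open>(u\<^sub>m, w\<^sub>m)\<close>; the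
  right-to-left half of the inner equivalence, which says that multiples may indeed be added, is
  automatic once \<open>cond3\<close> holds.
\<close>

definition cond5 :: "nat \<Rightarrow> (nat \<Rightarrow> complex^'n^'n) \<Rightarrow> complex^'n^1 \<Rightarrow> complex^1^'n \<Rightarrow> bool" where
  "cond5 m x u w \<longleftrightarrow>
     (\<forall>s\<in>{2..m-1}. \<exists>us ws. cond5_eq m x u w s us ws \<and>
        (\<forall>us' ws'. cond5_eq m x u w s us' ws' \<longleftrightarrow>
           (\<exists>z. us' = us + matrix_scale z u \<and> ws' = ws + matrix_scale z w)))"

definition cond6 :: "nat \<Rightarrow> (nat \<Rightarrow> complex^'n^'n) \<Rightarrow> complex^'n^1 \<Rightarrow> complex^1^'n \<Rightarrow> bool" where
  "cond6 m x u w \<longleftrightarrow>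
     (\<forall>j\<ge>1. \<forall>s\<in>{2..m-1}.
        x s ** matrix_power (x m) j ** w = 0 \<and> u ** matrix_power (x m) j ** x s = 0)"

end

theory Submission
  imports Defs
begin

text \<open>
  Everything is read off from the space of matrices \<open>T(A\<^sup>*)\<close>.  A tensor lies in the triple
  intersection exactly when it arises from \<open>T\<close> by a pair \<open>(Y, Z)\<close> of endomorphisms of \<open>B\<^sup>*\<close> and \<open>C\<close>
  with \<open>Z K = K Y \<in> T(A\<^sup>*)\<close> for all \<open>K \<in> T(A\<^sup>*)\<close> (\<open>triple_intersection_slices\<close>).

  Take bases in which \<open>K\<^sub>1 = diag(Id, 0)\<close> and write \<open>K\<close> in blocks with rows \<open>(X, w)\<close> and \<open>(u, z)\<close>.  That
  all matrices \<open>K - s K\<^sub>1\<close> are singular means \<open>z = 0\<close> and \<open>u X\<^sup>j w = 0\<close> for all \<open>j\<close>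
  (\<open>singular_pencil_power_products\<close>, with converse \<open>block_singular\<close>); this is condition (1).
  Comparing \<open>Z K\<^sub>1\<close> with \<open>K\<^sub>1 Y\<close> shows that \<open>Y\<close> and \<open>Z\<close> share their upper left block \<open>z\<close>, that
  \<open>Y\<close> has rows \<open>(z, 0)\<close>, \<open>(u', l)\<close> and \<open>Z\<close> has rows \<open>(z, w')\<close>, \<open>(0, r)\<close>, and that \<open>z\<close> belongs to
  \<open>D = {x. diag(x, 0) \<in> T(A\<^sup>*)}\<close> (\<open>lift_cases\<close>).  Conciseness gives a \<open>K\<close> with \<open>u\<close> and \<open>w\<close> both
  nonzero, so \<open>dim D \<le> m - 1\<close>; and if \<open>z = 0\<close> then \<open>w' u = w u'\<close>, which leaves only one
  parameter.  By rank-nullity for the map sending \<open>(Y, Z)\<close> to \<open>z\<close>, the triple intersection has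
  dimension at most \<open>m\<close>.  Hence abundance means sharpness, and it forces both estimates to be
  equalities (\<open>abundant_dims\<close>).

  The conditions (2)-(5) are these equalities spelled out.  Every \<open>z \<in> D\<close> occurs in some pair
  \<open>(Y, Z)\<close>; testing that pair on \<open>diag(x, 0)\<close> shows that \<open>D\<close> is abelian and End-closed, and testing it
  on \<open>K\<^sub>m\<close> gives the relation in (5) once \<open>z\<close> is shifted by its eigenvalue on \<open>w\<^sub>m\<close>.  The nonzero pair
  with \<open>z = 0\<close> says that all \<open>(u, w)\<close> are multiples of one \<open>(u\<^sub>m, w\<^sub>m)\<close> and that \<open>w\<^sub>m u\<^sub>m \<in> D\<close>.
  Condition (6) is a statement about the cyclic space spanned by the \<open>x\<^sub>m\<^sup>j w\<^sub>m\<close>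
  (\<open>commutator_kills_cyclic_space\<close>).  The case \<open>j = 1\<close> also shows that the element of \<open>D\<close> in
  (5) annihilates \<open>w\<^sub>m\<close>, that is, lies in the span of \<open>x\<^sub>2, \<dots>, x\<^sub>m\<^sub>-\<^sub>1\<close>.

  Conversely, (2)-(5) exhibit enough pairs \<open>(Y, Z)\<close> to reach dimension \<open>m\<close>
  (\<open>sharp_if_conditions\<close>).  The normalization is the change of bases that replaces \<open>x\<^sub>m\<close> by
  \<open>x\<^sub>m + q u\<^sub>m + w\<^sub>m p\<close> for a suitable column \<open>q\<close> and row \<open>p\<close> and fixes all other blocks.
\<close>

section \<open>Finite-dimensionality and rank-nullity\<close>

context finite_dimensional_vector_space_pair
begin

text \<open>
  The subspace \<open>S\<close> is the direct sum of the kernel and of the image of \<open>f ` S\<close> under a linear section.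
\<close>

lemma rank_nullity:
  assumes f: "Vector_Spaces.linear s1 s2 f" and S: "vs1.subspace S"
  shows "vs1.dim S = vs2.dim (f ` S) + vs1.dim {x \<in> S. f x = 0}"
proof -
  interpret f: Vector_Spaces.linear s1 s2 f by fact
  obtain g where gS: "g ` UNIV \<subseteq> S" and g: "Vector_Spaces.linear s2 s1 g"
    and fg: "\<forall>v \<in> f ` S. f (g v) = v"
    using linear_exists_right_inverse_on[OF f S] by auto
  interpret g: Vector_Spaces.linear s2 s1 g by fact
  define R where "R = g ` f ` S"
  define N where "N = {x \<in> S. f x = 0}"
  have fS: "vs2.subspace (f ` S)" using f.subspace_image[OF S] .
  have R: "vs1.subspace R" unfolding R_def using g.subspace_image[OF fS] .
  have N: "vs1.subspace N"
    using S unfolding N_def vs1.subspace_def by (auto simp: f.add f.scale)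
  have "inj_on g (f ` S)" using fg by (metis inj_onI)
  then have dimR: "vs1.dim R = vs2.dim (f ` S)"
  proof -
    interpret gp: finite_dimensional_vector_space_pair s2 B2 s1 B1 by unfold_locales
    have "inj_on g (vs2.span (f ` S))" 
      using \<open>inj_on g (f ` S)\<close> by (simp only: vs2.span_eq_iff[THEN iffD2, OF fS])
    then show ?thesis unfolding R_def using gp.dim_image_eq[OF g] by simp
  qed
  have "R \<inter> N = {0}"
  proof -
    have "x = 0" if "x \<in> R" "x \<in> N" for x
    proof -
      from that(1) obtain v where v: "v \<in> f ` S" "x = g v" unfolding R_def by auto
      then have "v = 0" using fg that(2) unfolding N_def by auto
      then show ?thesis using v by simp
    qed
    then show ?thesis using vs1.subspace_0[OF R] vs1.subspace_0[OF N] by auto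
  qed
  moreover have "{x + y |x y. x \<in> R \<and> y \<in> N} = S"
  proof
    show "{x + y |x y. x \<in> R \<and> y \<in> N} \<subseteq> S"
      using gS S unfolding R_def N_def by (auto intro!: vs1.subspace_add)
    show "S \<subseteq> {x + y |x y. x \<in> R \<and> y \<in> N}"
    proof
      fix x assume x: "x \<in> S"
      have "g (f x) \<in> R" unfolding R_def using x by auto
      moreover have "x - g (f x) \<in> N" unfolding N_def
        using x gS fg S by (auto simp: f.diff intro!: vs1.subspace_diff)
      ultimately show "x \<in> {x + y |x y. x \<in> R \<and> y \<in> N}"
        by (intro CollectI exI[of _ "g (f x)"] exI[of _ "x - g (f x)"]) auto
    qed
  qed
  ultimately have "vs1.dim S = vs1.dim R + vs1.dim N"
    using vs1.dim_sums_Int[OF R N] by simp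
  then show ?thesis using dimR N_def by simp
qed

end

lemma matrix_scale_nth [simp]: "matrix_scale z M $ i $ j = z * M $ i $ j"
  by (simp add: matrix_scale_def)

lemma tensor_scale_nth [simp]: "tensor_scale z T $ i $ j $ k = z * T $ i $ j $ k"
  by (simp add: tensor_scale_def)

lemma mspace_finite_spanning:
  "\<exists>B :: (complex^'n^'m) set. finite B \<and> mspace.span B = UNIV"
proof -
  define E :: "'m \<times> 'n \<Rightarrow> complex^'n^'m"
    where "E = (\<lambda>p. \<chi> i j. if (i, j) = p then 1 else 0)"
  have "M \<in> mspace.span (range E)" for M
  proof -
    have "M = (\<Sum>p\<in>UNIV. matrix_scale (M $ fst p $ snd p) (E p))"
      unfolding vec_eq_iff
    proof (intro allI)
      fix i j
      have "(\<Sum>p\<in>UNIV. matrix_scale (M $ fst p $ snd p) (E p)) $ i $ j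
          = (\<Sum>p\<in>UNIV. if (i, j) = p then M $ i $ j else 0)"
        unfolding sum_component by (rule sum.cong) (auto simp: E_def)
      then show "M $ i $ j = (\<Sum>p\<in>UNIV. matrix_scale (M $ fst p $ snd p) (E p)) $ i $ j"
        by simp
    qed
    also have "\<dots> \<in> mspace.span (range E)"
      by (intro mspace.span_sum mspace.span_scale mspace.span_base) auto
    finally show ?thesis .
  qed
  then show ?thesis by (intro exI[of _ "range E"]) auto
qed

lemma tspace_finite_spanning:
  "\<exists>B :: (complex^'c^'b^'a) set. finite B \<and> tspace.span B = UNIV"
proof -
  define E :: "'a \<times> 'b \<times> 'c \<Rightarrow> complex^'c^'b^'a"
    where "E = (\<lambda>p. \<chi> i j k. if (i, j, k) = p then 1 else 0)"
  have "M \<in> tspace.span (range E)" for M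
  proof -
    have "M = (\<Sum>p\<in>UNIV. tensor_scale (M $ fst p $ fst (snd p) $ snd (snd p)) (E p))"
      unfolding vec_eq_iff
    proof (intro allI)
      fix i j k
      have "(\<Sum>p\<in>UNIV. tensor_scale (M $ fst p $ fst (snd p) $ snd (snd p)) (E p)) $ i $ j $ k
          = (\<Sum>p\<in>UNIV. if (i, j, k) = p then M $ i $ j $ k else 0)"
        unfolding sum_component by (rule sum.cong) (auto simp: E_def)
      then show "M $ i $ j $ k
          = (\<Sum>p\<in>UNIV. tensor_scale (M $ fst p $ fst (snd p) $ snd (snd p)) (E p)) $ i $ j $ k"
        by simp
    qed
    also have "\<dots> \<in> tspace.span (range E)"
      by (intro tspace.span_sum tspace.span_scale tspace.span_base) auto
    finally show ?thesis .
  qed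
  then show ?thesis by (intro exI[of _ "range E"]) auto
qed

text \<open>
  Only the existence of a finite basis matters, because it makes the dimension theory of
  finite-dimensional spaces available for matrices and tensors.
\<close>

definition mbasis :: "(complex^'n^'m) set" where
  "mbasis = (SOME B. finite B \<and> mspace.independent B \<and> mspace.span B = UNIV)"

definition tbasis :: "(complex^'c^'b^'a) set" where
  "tbasis = (SOME B. finite B \<and> tspace.independent B \<and> tspace.span B = UNIV)"

lemma mbasis: "finite (mbasis :: (complex^'n^'m) set) \<and>
    mspace.independent (mbasis :: (complex^'n^'m) set) \<and>
    mspace.span (mbasis :: (complex^'n^'m) set) = UNIV"
proof -
  obtain B :: "(complex^'n^'m) set" where B: "finite B" "mspace.span B = UNIV"
    using mspace_finite_spanning by blast
  obtain C where "C \<subseteq> B" "mspace.independent C" "B \<subseteq> mspace.span C"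
    using mspace.maximal_independent_subset[of B] by blast
  then have "finite C \<and> mspace.independent C \<and> mspace.span C = UNIV"
    using B finite_subset by (metis mspace.span_minimal mspace.subspace_span top.extremum_uniqueI)
  then show ?thesis unfolding mbasis_def by (rule someI)
qed

lemma tbasis: "finite (tbasis :: (complex^'c^'b^'a) set) \<and>
    tspace.independent (tbasis :: (complex^'c^'b^'a) set) \<and>
    tspace.span (tbasis :: (complex^'c^'b^'a) set) = UNIV"
proof -
  obtain B :: "(complex^'c^'b^'a) set" where B: "finite B" "tspace.span B = UNIV"
    using tspace_finite_spanning by blast
  obtain C where "C \<subseteq> B" "tspace.independent C" "B \<subseteq> tspace.span C"
    using tspace.maximal_independent_subset[of B] by blast
  then have "finite C \<and> tspace.independent C \<and> tspace.span C = UNIV"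
    using B finite_subset by (metis tspace.span_minimal tspace.subspace_span top.extremum_uniqueI)
  then show ?thesis unfolding tbasis_def by (rule someI)
qed

interpretation mfin: finite_dimensional_vector_space matrix_scale mbasis
  using mbasis by unfold_locales auto

interpretation tfin: finite_dimensional_vector_space tensor_scale tbasis
  using tbasis by unfold_locales auto

interpretation tm: finite_dimensional_vector_space_pair tensor_scale tbasis matrix_scale mbasis
  by unfold_locales

interpretation vm: finite_dimensional_vector_space_pair "(*s)" cart_basis matrix_scale mbasis
  by unfold_locales

lemma mspace_span_image_finite:
  assumes "finite S"
  shows "y \<in> mspace.span (x ` S) \<longleftrightarrow> (\<exists>d. y = (\<Sum>s\<in>S. matrix_scale (d s) (x s)))"
proof
  assume "y \<in> mspace.span (x ` S)"
  then show "\<exists>d. y = (\<Sum>s\<in>S. matrix_scale (d s) (x s))"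
  proof (induction rule: mspace.span_induct_alt)
    case base
    show ?case by (intro exI[of _ "\<lambda>_. 0"]) simp
  next
    case (step c v y)
    then obtain r d where r: "r \<in> S" "v = x r" and y: "y = (\<Sum>s\<in>S. matrix_scale (d s) (x s))" by auto
    have "matrix_scale c v + y
        = (\<Sum>s\<in>S. (if s = r then matrix_scale c (x s) else 0) + matrix_scale (d s) (x s))"
      using r assms by (simp add: sum.distrib y)
    also have "\<dots> = (\<Sum>s\<in>S. matrix_scale ((if s = r then c else 0) + d s) (x s))"
      by (rule sum.cong) (auto simp: mspace.scale_left_distrib)
    finally show ?case by (intro exI[of _ "\<lambda>s. (if s = r then c else 0) + d s"])
  qed
next
  assume "\<exists>d. y = (\<Sum>s\<in>S. matrix_scale (d s) (x s))"
  then show "y \<in> mspace.span (x ` S)"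
    by (elim exE, simp only:) (intro mspace.span_sum mspace.span_scale mspace.span_base imageI)
qed

section \<open>Contractions and the triple intersection\<close>

lemma contract_A_nth: "contract_A T \<alpha> $ k $ j = (\<Sum>i\<in>UNIV. \<alpha> $ i * T $ i $ j $ k)"
  by (simp add: contract_A_def)

lemma contract_A_add: "contract_A T (\<alpha> + \<alpha>') = contract_A T \<alpha> + contract_A T \<alpha>'"
  by (simp add: vec_eq_iff contract_A_nth sum.distrib distrib_right)

lemma contract_A_scale: "contract_A T (z *s \<alpha>) = matrix_scale z (contract_A T \<alpha>)"
  by (simp add: vec_eq_iff contract_A_nth sum_distrib_left mult.assoc)

lemma contract_A_tensor_add: "contract_A (T + T') \<alpha> = contract_A T \<alpha> + contract_A T' \<alpha>"
  by (simp add: vec_eq_iff contract_A_nth sum.distrib distrib_left)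

lemma contract_A_tensor_scale: "contract_A (tensor_scale z T) \<alpha> = matrix_scale z (contract_A T \<alpha>)"
  by (simp add: vec_eq_iff contract_A_nth sum_distrib_left mult.left_commute)

lemma linear_contract_A: "Vector_Spaces.linear (*s) matrix_scale (contract_A T)"
  by (simp add: Vector_Spaces.linear_iff vec.vector_space_axioms mspace.vector_space_axioms
      contract_A_add contract_A_scale)

lemma subspace_range_contract_A: "mspace.subspace (range (contract_A T))"
proof -
  interpret c: Vector_Spaces.linear "(*s)" matrix_scale "contract_A T" by (rule linear_contract_A)
  show ?thesis using c.subspace_image[OF vec.subspace_UNIV] .
qed

lemma contract_A_axis: "contract_A T (axis i 1) $ k $ j = T $ i $ j $ k"
proof -
  have "contract_A T (axis i 1) $ k $ j = (\<Sum>l\<in>UNIV. if l = i then T $ i $ j $ k else 0)"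
    unfolding contract_A_nth by (rule sum.cong) (auto simp: axis_def)
  then show ?thesis by simp
qed

lemma tensor_eqI: "(\<And>\<alpha>. contract_A T \<alpha> = contract_A T' \<alpha>) \<Longrightarrow> T = T'"
  unfolding vec_eq_iff by (metis contract_A_axis)

lemma contract_A_tensor_A:
  "contract_A (tensor_A a M) \<alpha> = matrix_scale (\<Sum>i\<in>UNIV. \<alpha> $ i * a $ i) M"
  by (simp add: vec_eq_iff contract_A_nth tensor_A_def sum_distrib_right mult.assoc)

lemma contract_A_0: "contract_A 0 \<alpha> = 0"
  by (simp add: vec_eq_iff contract_A_nth)

lemma contract_A_sum: "contract_A (\<Sum>s\<in>S. t s) \<alpha> = (\<Sum>s\<in>S. contract_A (t s) \<alpha>)"
  by (induction S rule: infinite_finite_induct) (auto simp: contract_A_0 contract_A_tensor_add)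

lemma contract_B_column: "contract_B T (column j Y) $ i $ k = (contract_A T (axis i 1) ** Y) $ k $ j"
  by (simp add: contract_B_def column_def matrix_matrix_mult_def contract_A_axis mult.commute)

lemma contract_C_row: "contract_C T (row k Z) $ i $ j = (Z ** contract_A T (axis i 1)) $ k $ j"
  by (simp add: contract_C_def row_def matrix_matrix_mult_def contract_A_axis mult.commute)

text \<open>
  The space \<open>T(A\<^sup>*) \<otimes> A\<close> consists of the tensors all of whose \<open>A\<close>-slices lie in \<open>T(A\<^sup>*)\<close>.  The other two
  spaces of the triple intersection are described through the \<open>A\<close>-slices as well: their elements are
  the images of \<open>T\<close> under endomorphisms of \<open>B\<^sup>*\<close> and of \<open>C\<close>, which act on slices by multiplication
  from the right and from the left.
\<close>

lemma span_tensor_A: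
  "tspace.span {tensor_A a M | a M. M \<in> range (contract_A T)}
     = {t. \<forall>\<alpha>. contract_A t \<alpha> \<in> range (contract_A T)}" (is "tspace.span ?G = ?R")
proof
  have "tspace.subspace ?R"
    unfolding tspace.subspace_def using subspace_range_contract_A[of T]
    by (auto simp: contract_A_0 contract_A_tensor_add contract_A_tensor_scale
        simp del: rangeI image_iff intro: mspace.subspace_0 mspace.subspace_add mspace.subspace_scale)
  moreover have "?G \<subseteq> ?R"
    using subspace_range_contract_A[of T]
    by (auto simp: contract_A_tensor_A simp del: rangeI image_iff intro!: mspace.subspace_scale)
  ultimately show "tspace.span ?G \<subseteq> ?R" by (rule tspace.span_minimal[rotated])
  show "?R \<subseteq> tspace.span ?G"
  proof
    fix t assume t: "t \<in> ?R"
    have "t = (\<Sum>i\<in>UNIV. tensor_A (axis i 1) (contract_A t (axis i 1)))"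
      unfolding vec_eq_iff
    proof (intro allI)
      fix i j k
      have "(\<Sum>l\<in>UNIV. tensor_A (axis l 1) (contract_A t (axis l 1))) $ i $ j $ k
          = (\<Sum>l\<in>UNIV. if l = i then t $ i $ j $ k else 0)"
        unfolding sum_component
        by (rule sum.cong) (auto simp: tensor_A_def contract_A_axis, simp_all add: axis_def)
      then show "t $ i $ j $ k
          = (\<Sum>l\<in>UNIV. tensor_A (axis l 1) (contract_A t (axis l 1))) $ i $ j $ k" by simp
    qed
    also have "\<dots> \<in> tspace.span ?G"
      using t by (intro tspace.span_sum tspace.span_base) blast
    finally show "t \<in> tspace.span ?G" .
  qed
qed

lemma span_tensor_B:
  "tspace.span {tensor_B b M | b M. M \<in> range (contract_B T)}
     = {t. \<exists>Y. \<forall>\<alpha>. contract_A t \<alpha> = contract_A T \<alpha> ** Y}" (is "tspace.span ?G = ?R")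
proof
  have "t \<in> ?R" if "t \<in> tspace.span ?G" for t
    using that
  proof (induction rule: tspace.span_induct_alt)
    case base
    show ?case by (auto simp: contract_A_0 intro!: exI[of _ 0])
  next
    case (step c x y)
    then obtain b \<beta> where x: "x = tensor_B b (contract_B T \<beta>)" by auto
    obtain Y where Y: "\<forall>\<alpha>. contract_A y \<alpha> = contract_A T \<alpha> ** Y" using step by auto
    have "contract_A x \<alpha> = contract_A T \<alpha> ** (\<chi> l j. \<beta> $ l * b $ j)" for \<alpha>
      unfolding vec_eq_iff
    proof (intro allI)
      fix k j
      have "contract_A x \<alpha> $ k $ j
          = (\<Sum>i\<in>UNIV. \<Sum>l\<in>UNIV. \<alpha> $ i * (b $ j * (\<beta> $ l * T $ i $ l $ k)))"
        by (simp add: x contract_A_nth tensor_B_def contract_B_def sum_distrib_left)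
      also have "\<dots> = (\<Sum>l\<in>UNIV. \<Sum>i\<in>UNIV. \<alpha> $ i * (b $ j * (\<beta> $ l * T $ i $ l $ k)))"
        by (rule sum.swap)
      also have "\<dots> = (contract_A T \<alpha> ** (\<chi> l j. \<beta> $ l * b $ j)) $ k $ j"
        by (simp add: matrix_matrix_mult_def contract_A_nth sum_distrib_left sum_distrib_right
            mult_ac)
      finally show "contract_A x \<alpha> $ k $ j
          = (contract_A T \<alpha> ** (\<chi> l j. \<beta> $ l * b $ j)) $ k $ j" .
    qed
    then have "contract_A (tensor_scale c x + y) \<alpha>
        = contract_A T \<alpha> ** (matrix_scale c (\<chi> l j. \<beta> $ l * b $ j) + Y)" for \<alpha>
      using Y
      by (simp add: contract_A_tensor_add contract_A_tensor_scale vec_eq_iff matrix_matrix_mult_def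
          sum.distrib distrib_left sum_distrib_left mult_ac)
    then show ?case by auto
  qed
  then show "tspace.span ?G \<subseteq> ?R" by blast
  show "?R \<subseteq> tspace.span ?G"
  proof
    fix t assume "t \<in> ?R"
    then obtain Y where Y: "\<And>\<alpha>. contract_A t \<alpha> = contract_A T \<alpha> ** Y" by auto
    have "t = (\<Sum>j\<in>UNIV. tensor_B (axis j 1) (contract_B T (column j Y)))"
      unfolding vec_eq_iff
    proof (intro allI)
      fix i j k
      have "(\<Sum>l\<in>UNIV. tensor_B (axis l 1) (contract_B T (column l Y))) $ i $ j $ k
          = (\<Sum>l\<in>UNIV. if l = j then contract_B T (column j Y) $ i $ k else 0)"
        unfolding sum_component
        by (rule sum.cong) (auto simp: tensor_B_def, simp_all add: axis_def)
      also have "\<dots> = (contract_A T (axis i 1) ** Y) $ k $ j"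
        by (simp add: contract_B_column)
      also have "\<dots> = t $ i $ j $ k" by (simp add: Y[symmetric] contract_A_axis)
      finally show "t $ i $ j $ k
          = (\<Sum>l\<in>UNIV. tensor_B (axis l 1) (contract_B T (column l Y))) $ i $ j $ k" by simp
    qed
    also have "\<dots> \<in> tspace.span ?G"
      by (intro tspace.span_sum tspace.span_base) blast
    finally show "t \<in> tspace.span ?G" .
  qed
qed

lemma span_tensor_C:
  "tspace.span {tensor_C c M | c M. M \<in> range (contract_C T)}
     = {t. \<exists>Z. \<forall>\<alpha>. contract_A t \<alpha> = Z ** contract_A T \<alpha>}" (is "tspace.span ?G = ?R")
proof
  have "t \<in> ?R" if "t \<in> tspace.span ?G" for t
    using that
  proof (induction rule: tspace.span_induct_alt)
    case base
    show ?case by (auto simp: contract_A_0 intro!: exI[of _ 0])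
  next
    case (step e x y)
    then obtain c \<gamma> where x: "x = tensor_C c (contract_C T \<gamma>)" by auto
    obtain Z where Z: "\<forall>\<alpha>. contract_A y \<alpha> = Z ** contract_A T \<alpha>" using step by auto
    have "contract_A x \<alpha> = (\<chi> k l. c $ k * \<gamma> $ l) ** contract_A T \<alpha>" for \<alpha>
      unfolding vec_eq_iff
    proof (intro allI)
      fix k j
      have "contract_A x \<alpha> $ k $ j
          = (\<Sum>i\<in>UNIV. \<Sum>l\<in>UNIV. \<alpha> $ i * (c $ k * (\<gamma> $ l * T $ i $ j $ l)))"
        by (simp add: x contract_A_nth tensor_C_def contract_C_def sum_distrib_left)
      also have "\<dots> = (\<Sum>l\<in>UNIV. \<Sum>i\<in>UNIV. \<alpha> $ i * (c $ k * (\<gamma> $ l * T $ i $ j $ l)))"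
        by (rule sum.swap)
      also have "\<dots> = ((\<chi> k l. c $ k * \<gamma> $ l) ** contract_A T \<alpha>) $ k $ j"
        by (simp add: matrix_matrix_mult_def contract_A_nth sum_distrib_left sum_distrib_right
            mult_ac)
      finally show "contract_A x \<alpha> $ k $ j
          = ((\<chi> k l. c $ k * \<gamma> $ l) ** contract_A T \<alpha>) $ k $ j" .
    qed
    then have "contract_A (tensor_scale e x + y) \<alpha>
        = (matrix_scale e (\<chi> k l. c $ k * \<gamma> $ l) + Z) ** contract_A T \<alpha>" for \<alpha>
      using Z
      by (simp add: contract_A_tensor_add contract_A_tensor_scale vec_eq_iff matrix_matrix_mult_def
          sum.distrib distrib_left distrib_right sum_distrib_left mult_ac)
    then show ?case by auto
  qed
  then show "tspace.span ?G \<subseteq> ?R" by blast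
  show "?R \<subseteq> tspace.span ?G"
  proof
    fix t assume "t \<in> ?R"
    then obtain Z where Z: "\<And>\<alpha>. contract_A t \<alpha> = Z ** contract_A T \<alpha>" by auto
    have "t = (\<Sum>k\<in>UNIV. tensor_C (axis k 1) (contract_C T (row k Z)))"
      unfolding vec_eq_iff
    proof (intro allI)
      fix i j k
      have "(\<Sum>l\<in>UNIV. tensor_C (axis l 1) (contract_C T (row l Z))) $ i $ j $ k
          = (\<Sum>l\<in>UNIV. if l = k then contract_C T (row k Z) $ i $ j else 0)"
        unfolding sum_component
        by (rule sum.cong) (auto simp: tensor_C_def, simp_all add: axis_def)
      also have "\<dots> = (Z ** contract_A T (axis i 1)) $ k $ j"
        by (simp add: contract_C_row)
      also have "\<dots> = t $ i $ j $ k" by (simp add: Z[symmetric] contract_A_axis)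
      finally show "t $ i $ j $ k
          = (\<Sum>l\<in>UNIV. tensor_C (axis l 1) (contract_C T (row l Z))) $ i $ j $ k" by simp
    qed
    also have "\<dots> \<in> tspace.span ?G"
      by (intro tspace.span_sum tspace.span_base) blast
    finally show "t \<in> tspace.span ?G" .
  qed
qed

lemma triple_intersection_iff:
  "t \<in> triple_intersection T \<longleftrightarrow>
     (\<forall>\<alpha>. contract_A t \<alpha> \<in> range (contract_A T)) \<and>
     (\<exists>Y. \<forall>\<alpha>. contract_A t \<alpha> = contract_A T \<alpha> ** Y) \<and>
     (\<exists>Z. \<forall>\<alpha>. contract_A t \<alpha> = Z ** contract_A T \<alpha>)"
  unfolding triple_intersection_def span_tensor_A span_tensor_B span_tensor_C by auto

lemma subspace_triple_intersection: "tspace.subspace (triple_intersection T)"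
  unfolding triple_intersection_def by (intro tspace.subspace_inter tspace.subspace_span)

section \<open>Matrix algebra\<close>

lemma matrix_scale_mult_left: "matrix_scale z M ** N = matrix_scale z (M ** N)"
  by (simp add: vec_eq_iff matrix_matrix_mult_def sum_distrib_left mult.assoc)

lemma matrix_scale_mult_right: "M ** matrix_scale z N = matrix_scale z (M ** N)"
  for M :: "complex^'n^'m"
  by (simp add: vec_eq_iff matrix_matrix_mult_def sum_distrib_left mult.left_commute)

lemma matrix_mult_sum_right: "M ** (\<Sum>s\<in>S. N s) = (\<Sum>s\<in>S. M ** N s)"
  for M :: "complex^'n^'m"
  by (induction S rule: infinite_finite_induct) (auto simp: matrix_add_ldistrib)

lemma matrix_mult_add_left: "(M + M') ** N = M ** N + M' ** N" for M :: "complex^'n^'m"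
  by (simp add: vec_eq_iff matrix_matrix_mult_def sum.distrib distrib_right)

lemma matrix_mult_sum_left: "(\<Sum>s\<in>S. N s) ** M = (\<Sum>s\<in>S. N s ** M)"
  for M :: "complex^'n^'m"
  by (induction S rule: infinite_finite_induct) (auto simp: matrix_mult_add_left)

lemma matrix_mult_minus_left: "(- M) ** N = - (M ** N)" for M :: "complex^'n^'m"
  by (simp add: vec_eq_iff matrix_matrix_mult_def sum_negf)

lemma matrix_mult_minus_right: "M ** (- N) = - (M ** N)" for M :: "complex^'n^'m"
  by (simp add: vec_eq_iff matrix_matrix_mult_def sum_negf)

lemma matrix_mult_diff_left: "(M - M') ** N = M ** N - M' ** N" for M :: "complex^'n^'m"
  by (simp add: vec_eq_iff matrix_matrix_mult_def sum_subtractf left_diff_distrib)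

lemma matrix_mult_diff_right: "M ** (N - N') = M ** N - M ** N'" for M :: "complex^'n^'m"
  by (simp add: vec_eq_iff matrix_matrix_mult_def sum_subtractf right_diff_distrib)

lemmas matrix_algebra = matrix_scale_mult_left matrix_scale_mult_right matrix_add_ldistrib
  matrix_mult_add_left matrix_mult_minus_left matrix_mult_minus_right matrix_mult_diff_left
  matrix_mult_diff_right matrix_mul_assoc

lemma matrix_scale_of_real: "matrix_scale (complex_of_real r) M = r *\<^sub>R M"
  by (simp add: vec_eq_iff scaleR_conv_of_real[where x = "_ :: complex"])

lemma mult_one_by_one: "w ** M = matrix_scale (M $ 1 $ 1) w" for w :: "complex^1^'n"
  by (simp add: vec_eq_iff matrix_matrix_mult_def)

lemma one_by_one_mult: "M ** u = matrix_scale (M $ 1 $ 1) u" for u :: "complex^'n^1"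
  by (simp add: vec_eq_iff matrix_matrix_mult_def forall_1)

lemma one_by_one_eq_0: "M = 0 \<longleftrightarrow> M $ 1 $ 1 = 0" for M :: "complex^1^1"
  by (simp add: vec_eq_iff forall_1)

lemma column_mult_row_nth: "(w ** u) $ i $ j = w $ i $ 1 * u $ 1 $ j"
  for w :: "complex^1^'n" and u :: "complex^'m^1"
  by (simp add: matrix_matrix_mult_def)

lemma column_mult_row_eq_0: "w ** u = 0 \<longleftrightarrow> w = 0 \<or> u = 0"
  for w :: "complex^1^'n" and u :: "complex^'m^1"
  by (auto simp: vec_eq_iff column_mult_row_nth forall_1)

lemma linear_mult_left: "Vector_Spaces.linear matrix_scale matrix_scale (\<lambda>V. M ** V)"
  for M :: "complex^'n^'m"
  by (simp add: Vector_Spaces.linear_iff mspace.vector_space_axioms matrix_algebra)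

lemma real_linear_mult_left: "linear (\<lambda>V::complex^'k^'n. M ** V)" for M :: "complex^'n^'m"
  by (auto intro!: linearI simp: matrix_algebra)
     (simp add: vec_eq_iff matrix_matrix_mult_def scaleR_sum_right)

lemma matrix_power_commute: "matrix_power X j ** X = X ** matrix_power X j"
  by (induction j) (auto simp: matrix_mul_assoc[symmetric])

lemma matrix_power_transpose: "matrix_power (transpose X) j = transpose (matrix_power X j)"
  by (induction j) (simp_all add: matrix_power_commute flip: matrix_transpose_mul)

lemma matrix_transpose_add: "transpose (M + N) = transpose M + transpose N"
  by (simp add: vec_eq_iff transpose_def)

lemma matrix_transpose_0: "transpose 0 = 0"
  by (simp add: vec_eq_iff transpose_def)

text \<open>
  A column in which \<open>u\<close> does not vanish shows that \<open>w'\<close> is a multiple of \<open>w\<close>, and then \<open>w\<close> can be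
  cancelled.  This one-parameter freedom is what bounds the kernel in the dimension
  count and what makes the solutions in condition (5) unique up to multiples.
\<close>

lemma outer_products_proportional:
  fixes w w' :: "complex^1^'n" and u u' :: "complex^'m^1"
  assumes eq: "w' ** u = w ** u'" and "u \<noteq> 0" "w \<noteq> 0"
  obtains c where "w' = matrix_scale c w" "u' = matrix_scale c u"
proof -
  obtain j where j: "u $ 1 $ j \<noteq> 0" using \<open>u \<noteq> 0\<close> by (auto simp: vec_eq_iff forall_1)
  define c where "c = u' $ 1 $ j / u $ 1 $ j"
  have e: "w' $ i $ 1 * u $ 1 $ k = w $ i $ 1 * u' $ 1 $ k" for i k
    using eq by (metis column_mult_row_nth)
  have w': "w' = matrix_scale c w"
    unfolding vec_eq_iff forall_1 using e[of _ j] j by (simp add: c_def field_simps)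
  then have "w ** (matrix_scale c u - u') = 0"
    using eq by (simp add: matrix_algebra)
  then have "u' = matrix_scale c u" using \<open>w \<noteq> 0\<close> by (simp add: column_mult_row_eq_0)
  then show ?thesis using w' that by blast
qed

lemma rank_neq_iff_kernel:
  fixes M :: "complex^'m^'m"
  shows "rank M \<noteq> CARD('m) \<longleftrightarrow> (\<exists>v. v \<noteq> 0 \<and> M *v v = 0)"
proof -
  have "rank M = CARD('m) \<longleftrightarrow> vec.span (rows M) = UNIV"
    unfolding row_rank_def_gen using vec.dim_eq_full[of "rows M"]
    by (simp add: card_cart_basis vec.dimension_def)
  also have "\<dots> \<longleftrightarrow> (\<exists>N. N ** M = mat 1)"
    by (simp add: matrix_left_invertible_span_rows_gen)
  also have "\<dots> \<longleftrightarrow> (\<forall>v. M *v v = 0 \<longrightarrow> v = 0)"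
    by (simp add: matrix_left_invertible_ker)
  finally show ?thesis by blast
qed

lemma rank_neq_iff_kernel_column:
  fixes M :: "complex^'m^'m"
  shows "rank M \<noteq> CARD('m) \<longleftrightarrow> (\<exists>V::complex^1^'m. V \<noteq> 0 \<and> M ** V = 0)"
  unfolding rank_neq_iff_kernel
proof
  assume "\<exists>v. v \<noteq> 0 \<and> M *v v = 0"
  then obtain v where v: "v \<noteq> 0" "M *v v = 0" by blast
  then have "(\<chi> i s. v $ i :: complex^1^'m) \<noteq> 0" "M ** (\<chi> i s. v $ i :: complex^1^'m) = 0"
    by (auto simp: vec_eq_iff matrix_matrix_mult_def matrix_vector_mult_def)
  then show "\<exists>V::complex^1^'m. V \<noteq> 0 \<and> M ** V = 0" by blast
next
  assume "\<exists>V::complex^1^'m. V \<noteq> 0 \<and> M ** V = 0"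
  then obtain V :: "complex^1^'m" where "V \<noteq> 0" "M ** V = 0" by blast
  then have "(\<chi> i. V $ i $ 1) \<noteq> 0" "M *v (\<chi> i. V $ i $ 1) = 0"
    by (auto simp: vec_eq_iff matrix_matrix_mult_def matrix_vector_mult_def forall_1)
  then show "\<exists>v. v \<noteq> 0 \<and> M *v v = 0" by blast
qed

section \<open>Block matrices\<close>

lemma sum_option: "(\<Sum>i\<in>(UNIV::'n::finite option set). f i) = f None + (\<Sum>i\<in>UNIV. f (Some i))"
  by (simp add: UNIV_option_conv sum.reindex)

lemma block_nth [simp]:
  "block X w u z $ Some i $ Some j = X $ i $ j"
  "block X w u z $ Some i $ None = w $ i $ 1"
  "block X w u z $ None $ Some j = u $ 1 $ j"
  "block X w u z $ None $ None = z"
  by (simp_all add: block_def)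

lemma block_ext:
  fixes M N :: "complex^('n::finite option)^('n option)"
  shows "M = N \<longleftrightarrow> (\<forall>i j. M $ Some i $ Some j = N $ Some i $ Some j) \<and>
     (\<forall>i. M $ Some i $ None = N $ Some i $ None) \<and> (\<forall>j. M $ None $ Some j = N $ None $ Some j) \<and>
     M $ None $ None = N $ None $ None"
  by (simp add: vec_eq_iff split_option_all) blast

lemma block_eq_iff:
  "block X w u z = block X' w' u' z' \<longleftrightarrow> X = X' \<and> w = w' \<and> u = u' \<and> z = z'"
  by (auto simp: block_ext vec_eq_iff forall_1)

lemma block_cases: obtains X w u z where "M = block X w u z"
proof
  show "M = block (\<chi> i j. M $ Some i $ Some j) (\<chi> i j. M $ Some i $ None)
      (\<chi> i j. M $ None $ Some j) (M $ None $ None)"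
    by (simp add: block_ext)
qed

lemma block_mult:
  "block X w u z ** block X' w' u' z' =
     block (X ** X' + w ** u') (X ** w' + matrix_scale z' w)
       (u ** X' + matrix_scale z u') ((u ** w') $ 1 $ 1 + z * z')"
  by (simp add: block_ext matrix_matrix_mult_def sum_option add.commute mult.commute)

lemma block_add: "block X w u z + block X' w' u' z' = block (X + X') (w + w') (u + u') (z + z')"
  by (simp add: block_ext)

lemma block_scale:
  "matrix_scale c (block X w u z) = block (matrix_scale c X) (matrix_scale c w) (matrix_scale c u) (c * z)"
  by (simp add: block_ext)

lemma block_0: "block 0 0 0 0 = 0"
  by (simp add: block_ext)

lemma block_sum:
  "(\<Sum>s\<in>S. block (X s) (w s) (u s) (z s))
     = block (\<Sum>s\<in>S. X s) (\<Sum>s\<in>S. w s) (\<Sum>s\<in>S. u s) (\<Sum>s\<in>S. z s)"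
  by (simp add: block_ext)

lemma block_mat_1: "block (mat 1) 0 0 1 = mat 1"
  by (simp add: block_ext mat_def)

definition cblock :: "complex^1^'n \<Rightarrow> complex \<Rightarrow> complex^1^('n option)" where
  "cblock v l = (\<chi> r s. case r of Some i \<Rightarrow> v $ i $ 1 | None \<Rightarrow> l)"

lemma cblock_nth [simp]: "cblock v l $ Some i $ 1 = v $ i $ 1" "cblock v l $ None $ 1 = l"
  by (simp_all add: cblock_def)

lemma column_ext:
  fixes V W :: "complex^1^('n::finite option)"
  shows "V = W \<longleftrightarrow> (\<forall>i. V $ Some i $ 1 = W $ Some i $ 1) \<and> V $ None $ 1 = W $ None $ 1"
  by (simp add: vec_eq_iff split_option_all forall_1) blast

lemma cblock_cases: obtains v l where "V = cblock v l"
proof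
  show "V = cblock (\<chi> i s. V $ Some i $ 1) (V $ None $ 1)" by (simp add: column_ext)
qed

lemma cblock_eq_0_iff: "cblock v l = 0 \<longleftrightarrow> v = 0 \<and> l = 0"
  by (auto simp: column_ext vec_eq_iff forall_1)

lemma block_mult_cblock:
  "block X w u z ** cblock v l = cblock (X ** v + matrix_scale l w) ((u ** v) $ 1 $ 1 + z * l)"
  by (simp add: column_ext matrix_matrix_mult_def sum_option add.commute mult.commute)

section \<open>Matrices of bounded rank\<close>

text \<open>
  A kernel vector of the pencil at \<open>s = 1/e\<close>, suitably scaled, has an upper part \<open>v\<close> with
  \<open>v = e X v + w\<close> and \<open>e u v + z = 0\<close>.  As \<open>e\<close> tends to \<open>0\<close>, \<open>v\<close> tends to \<open>w\<close>, so \<open>z = 0\<close> and thus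
  \<open>u v = 0\<close>.  If \<open>u X\<^sup>j v = 0\<close> for all \<open>e\<close>, then in the limit \<open>u X\<^sup>j w = 0\<close>, and
  substituting \<open>v = e X v + w\<close> gives \<open>u X\<^sup>j\<^sup>+\<^sup>1 v = 0\<close>.
\<close>

lemma singular_pencil_power_products:
  fixes X :: "complex^'n^'n" and w :: "complex^1^'n" and u :: "complex^'n^1"
  assumes sing: "\<And>s. \<exists>V::complex^1^('n option). V \<noteq> 0 \<and> block (X - matrix_scale s (mat 1)) w u z ** V = 0"
  shows "z = 0" and "u ** matrix_power X j ** w = 0"
proof -
  obtain B where B: "B > 0" "\<And>v::complex^1^'n. norm (X ** v) \<le> B * norm v"
    using linear_bounded_pos[OF real_linear_mult_left] by metis
  (* With this scale e X is a contraction with factor 1/2, which bounds v uniformly, see step. *)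
  define e where "e n = 1 / (2 * B * (real n + 1))" for n :: nat
  have e: "e n > 0" "e n * B \<le> 1/2" for n
  proof -
    have "B * (real n + 1) > 0" using B(1) by simp
    then show "e n > 0" by (simp add: e_def mult.assoc)
    have "e n * B = 1 / (2 * (real n + 1))" using B(1) by (simp add: e_def)
    also have "\<dots> \<le> 1 / 2" by (simp add: field_simps)
    finally show "e n * B \<le> 1/2" .
  qed
  have elim: "e \<longlonglongrightarrow> 0"
  proof -
    have "(\<lambda>n. (1 / (2 * B)) * inverse (real (Suc n))) \<longlonglongrightarrow> (1 / (2 * B)) * 0"
      by (intro tendsto_intros LIMSEQ_inverse_real_of_nat)
    then show ?thesis by (simp add: e_def[abs_def] field_simps)
  qed
  have step: "norm v \<le> 2 * norm w'" if "v = matrix_scale (e n) (X ** v) + w'" for n v and w' :: "complex^1^'n"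
  proof -
    have sc: "norm (matrix_scale (complex_of_real r) M) = \<bar>r\<bar> * norm M" for r and M :: "complex^1^'n"
      by (simp add: matrix_scale_of_real)
    have "norm v \<le> norm (matrix_scale (e n) (X ** v)) + norm w'"
      using norm_triangle_ineq that by metis
    also have "norm (matrix_scale (e n) (X ** v)) = e n * norm (X ** v)"
      using e(1)[of n] by (simp add: sc)
    also have "e n * norm (X ** v) \<le> e n * (B * norm v)"
      using e(1)[of n] B(2) by (intro mult_left_mono) auto
    also have "\<dots> \<le> 1/2 * norm v"
      using mult_right_mono[OF e(2)[of n], of "norm v"] by (simp add: mult.assoc)
    finally show ?thesis by simp
  qed
  have "\<exists>v. v = matrix_scale (e n) (X ** v) + w \<and> e n * (u ** v) $ 1 $ 1 + z = 0" for n
  proof -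
    have en: "complex_of_real (e n) \<noteq> 0" using e(1)[of n] by simp
    obtain V :: "complex^1^('n option)" where V: "V \<noteq> 0"
      "block (X - matrix_scale (1 / e n) (mat 1)) w u z ** V = 0" using sing by blast
    obtain v l where vl: "V = cblock v l" by (rule cblock_cases)
    have "(X - matrix_scale (1 / e n) (mat 1)) ** v + matrix_scale l w = 0"
      and uv: "(u ** v) $ 1 $ 1 + z * l = 0"
      using V(2) by (simp_all add: vl block_mult_cblock cblock_eq_0_iff)
    then have "matrix_scale (e n) (X ** v - matrix_scale (1 / e n) v + matrix_scale l w) = 0"
      by (simp add: matrix_algebra)
    then have v: "v = matrix_scale (e n) (X ** v) + matrix_scale (e n * l) w"
      using en by (simp add: mspace.scale_right_distrib mspace.scale_right_diff_distrib algebra_simps)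
    have l: "l \<noteq> 0"
    proof
      assume "l = 0"
      then have "v = 0" using step[of v n 0] v by simp
      then show False using V(1) vl \<open>l = 0\<close> by (simp add: cblock_eq_0_iff)
    qed
    define v' where "v' = matrix_scale (1 / (e n * l)) v"
    have "v' = matrix_scale (e n) (X ** v') + w"
    proof -
      have "v' = matrix_scale (1 / (e n * l))
          (matrix_scale (e n) (X ** v) + matrix_scale (e n * l) w)"
        by (subst v[symmetric]) (rule v'_def)
      then have "v' = matrix_scale (1 / l) (X ** v) + w"
        using en l by (simp add: mspace.scale_right_distrib mult.commute)
      moreover have "matrix_scale (e n) (X ** v') = matrix_scale (1 / l) (X ** v)"
        using en l by (simp add: v'_def matrix_algebra)
      ultimately show ?thesis by simp
    qed
    moreover have "e n * (u ** v') $ 1 $ 1 + z = 0"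
      unfolding v'_def using uv en l
      by (simp add: matrix_algebra field_simps eq_neg_iff_add_eq_0)
    ultimately show ?thesis by blast
  qed
  then obtain v where v: "\<And>n. v n = matrix_scale (e n) (X ** v n) + w"
    and uvz: "\<And>n. e n * (u ** v n) $ 1 $ 1 + z = 0" by metis
  have vb: "norm (v n) \<le> 2 * norm w" for n using step[OF v] .
  have cont: "(\<lambda>n. M ** v n) \<longlonglongrightarrow> M ** w" if "v \<longlonglongrightarrow> w" for M :: "complex^'n^1"
    by (rule isCont_tendsto_compose[OF _ that])
       (simp add: linear_continuous_at linear_conv_bounded_linear[THEN iffD1, OF real_linear_mult_left])
  have vlim: "v \<longlonglongrightarrow> w"
  proof -
    have "norm (v n - w) \<le> e n * (B * (2 * norm w))" for n
    proof -
      have "v n - w = e n *\<^sub>R (X ** v n)" using v[of n] by (simp add: matrix_scale_of_real algebra_simps)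
      then have "norm (v n - w) = e n * norm (X ** v n)" using e(1)[of n] by simp
      also have "\<dots> \<le> e n * (B * (2 * norm w))"
        using e(1)[of n] B vb[of n] order_trans[OF B(2)[of "v n"]]
        by (intro mult_left_mono) auto
      finally show ?thesis .
    qed
    moreover have "(\<lambda>n. e n * (B * (2 * norm w))) \<longlonglongrightarrow> 0"
      using tendsto_mult_left_zero[OF elim] by simp
    ultimately have "(\<lambda>n. v n - w) \<longlonglongrightarrow> 0"
      by (intro Lim_null_comparison[of "\<lambda>n. v n - w"]) auto
    then show ?thesis by (simp add: LIM_zero_iff)
  qed
  show z: "z = 0"
  proof -
    have "(\<lambda>n. (u ** v n) $ 1 $ 1) \<longlonglongrightarrow> (u ** w) $ 1 $ 1"
      using cont[OF vlim, of u] by (intro tendsto_vec_nth)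
    then have "(\<lambda>n. complex_of_real (e n) * (u ** v n) $ 1 $ 1 + z) \<longlonglongrightarrow> complex_of_real 0 * (u ** w) $ 1 $ 1 + z"
      by (intro tendsto_add tendsto_mult tendsto_const tendsto_of_real elim)
    then show ?thesis using uvz LIMSEQ_unique[OF _ tendsto_const] by fastforce
  qed
  have "(\<forall>n. u ** matrix_power X j ** v n = 0) \<and> u ** matrix_power X j ** w = 0" for j
  proof (induction j)
    case 0
    have "u ** v n = 0" for n using uvz[of n] e(1)[of n] z by (simp add: one_by_one_eq_0)
    then show ?case using LIMSEQ_unique[OF cont[OF vlim, of u]] by simp
  next
    case (Suc j)
    have 1: "u ** matrix_power X (Suc j) ** v n = 0" for n
    proof -
      have "0 = u ** matrix_power X j ** (matrix_scale (e n) (X ** v n) + w)"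
        using Suc.IH v by metis
      also have "\<dots> = matrix_scale (e n) (u ** matrix_power X j ** X ** v n)"
        using Suc.IH by (simp add: matrix_algebra)
      also have "u ** matrix_power X j ** X = u ** matrix_power X (Suc j)"
        by (simp add: matrix_mul_assoc[symmetric] matrix_power_commute)
      finally show ?thesis using e(1)[of n] by simp
    qed
    then show ?case using LIMSEQ_unique[OF cont[OF vlim, of "u ** matrix_power X (Suc j)"]] by simp
  qed
  then show "u ** matrix_power X j ** w = 0" by blast
qed

text \<open>
  Let \<open>W\<close> be the cyclic space of \<open>w\<close> under \<open>X\<close>; it is annihilated by \<open>u\<close>.  If \<open>X\<close> is not injective on
  \<open>W\<close>, an element of its kernel extends by \<open>0\<close> to a kernel vector of the block matrix.  Otherwise
  \<open>X\<close> maps \<open>W\<close> onto itself, so \<open>w = X v\<close> for some \<open>v \<in> W\<close>, and \<open>(-v, 1)\<close> is a kernel vector.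
\<close>

lemma block_singular:
  fixes X :: "complex^'n^'n" and w :: "complex^1^'n" and u :: "complex^'n^1"
  assumes uXw: "\<And>j. u ** matrix_power X j ** w = 0"
  shows "\<exists>V::complex^1^('n option). V \<noteq> 0 \<and> block X w u 0 ** V = 0"
proof -
  define W where "W = mspace.span (range (\<lambda>j. matrix_power X j ** w))"
  interpret X: Vector_Spaces.linear matrix_scale matrix_scale "\<lambda>v::complex^1^'n. X ** v"
    by (rule linear_mult_left)
  interpret u: Vector_Spaces.linear matrix_scale matrix_scale "\<lambda>v::complex^1^'n. u ** v"
    by (rule linear_mult_left)
  interpret mm: finite_dimensional_vector_space_pair
    "matrix_scale :: complex \<Rightarrow> complex^1^'n \<Rightarrow> _" mbasis "matrix_scale :: complex \<Rightarrow> complex^1^'n \<Rightarrow> _" mbasis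
    by unfold_locales
  have W: "mspace.subspace W" by (simp add: W_def)
  have wW: "matrix_power X j ** w \<in> W" for j
    unfolding W_def by (intro mspace.span_base) auto
  have uW: "u ** v = 0" if "v \<in> W" for v
    by (rule u.eq_0_on_span[of "range (\<lambda>j. matrix_power X j ** w)" v])
      (use that uXw in \<open>auto simp: W_def matrix_mul_assoc\<close>)
  have XW: "(\<lambda>v. X ** v) ` W \<subseteq> W"
  proof -
    have "(\<lambda>v. X ** v) ` W = mspace.span ((\<lambda>v. X ** v) ` range (\<lambda>j. matrix_power X j ** w))"
      unfolding W_def by (rule X.span_image[symmetric])
    also have "\<dots> \<subseteq> W"
      using wW[of "Suc _"] by (intro mspace.span_minimal W) (auto simp: matrix_mul_assoc)
    finally show ?thesis .
  qed
  show ?thesis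
  proof (cases "\<exists>v\<in>W. v \<noteq> 0 \<and> X ** v = 0")
    case True
    then obtain v where "v \<in> W" "v \<noteq> 0" "X ** v = 0" by blast
    then have "cblock v 0 \<noteq> 0 \<and> block X w u 0 ** cblock v 0 = 0"
      using uW by (simp add: block_mult_cblock cblock_eq_0_iff)
    then show ?thesis by blast
  next
    case False
    then have "inj_on (\<lambda>v. X ** v) W"
      using X.inj_on_iff_eq_0[OF W] by blast
    then have "inj_on (\<lambda>v. X ** v) (mspace.span W)"
      by (simp only: mspace.span_eq_iff[THEN iffD2, OF W])
    then have "mspace.dim ((\<lambda>v. X ** v) ` W) = mspace.dim W"
      by (rule mm.dim_image_eq[OF linear_mult_left])
    then have "(\<lambda>v. X ** v) ` W = W"
      by (intro mfin.subspace_dim_equal XW X.subspace_image W) auto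
    then obtain v where v: "v \<in> W" "w = X ** v" using wW[of 0] by auto
    then have "cblock (- v) 1 \<noteq> 0 \<and> block X w u 0 ** cblock (- v) 1 = 0"
      using uW by (simp add: block_mult_cblock cblock_eq_0_iff matrix_algebra)
    then show ?thesis by blast
  qed
qed

section \<open>Vanishing of products along a cyclic subspace\<close>

text \<open>
  Otherwise the vectors \<open>f 0, f 1, \<dots>\<close> would be linearly independent.
\<close>

lemma cyclic_relation:
  fixes f :: "nat \<Rightarrow> complex^'n^'m"
  shows "\<exists>d. f d \<in> mspace.span (f ` {..<d})"
proof (rule ccontr)
  assume a: "\<not> ?thesis"
  have "mspace.independent (f ` {..<d}) \<and> card (f ` {..<d}) = d" for d
  proof (induction d)
    case (Suc d)
    have "f d \<notin> mspace.span (f ` {..<d})" using a by blast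
    moreover from this have "f d \<notin> f ` {..<d}" 
      using mspace.span_base[of "f d" "f ` {..<d}"] by blast
    ultimately show ?case
      using Suc mspace.independent_insertI by (auto simp: lessThan_Suc)
  qed (simp add: mspace.independent_empty)
  then have "d \<le> mspace.dim (UNIV :: (complex^'n^'m) set)" for d
    using mfin.independent_card_le_dim[of "f ` {..<d}" UNIV] by auto
  then show False using not_less_eq_eq by blast
qed

text \<open>
  Put \<open>f j = y\<^sup>j w\<close>, \<open>g j = us (f j)\<close> and \<open>F j = \<langle>f 0, \<dots>, f (j-1)\<rangle>\<close>.  Since \<open>u\<close> annihilates all \<open>f j\<close>, the
  relation gives \<open>x (f (j+1)) = y (x (f j)) + g j w\<close>, so it suffices that all \<open>g j\<close> vanish.
  Otherwise let \<open>k\<close> be least with \<open>g k \<noteq> 0\<close>.  Then \<open>x\<close> annihilates \<open>f 0, \<dots>, f k\<close> and lowers degrees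
  above \<open>k\<close> by exactly \<open>k + 1\<close>, in that \<open>x (f (k+1+j)) - g k f j \<in> F j\<close>.  Let \<open>d\<close> be least with
  \<open>f d \<in> F d\<close>.  If \<open>d \<le> k\<close>, then \<open>f k \<in> F d\<close> and \<open>us\<close> vanishes on \<open>F d\<close>, contradicting \<open>g k \<noteq> 0\<close>.
  If \<open>d = k + 1 + j\<close>, applying \<open>x\<close> yields \<open>f j \<in> F j\<close>, contradicting the choice of \<open>d\<close>.
\<close>

lemma commutator_kills_cyclic_space:
  fixes x y :: "complex^'n^'n" and w ws :: "complex^1^'n" and u us :: "complex^'n^1"
  assumes comm: "x ** y + ws ** u = y ** x + w ** us"
    and xw: "x ** w = 0" and uyw: "\<And>j. u ** matrix_power y j ** w = 0"
  shows "x ** matrix_power y j ** w = 0" "us ** matrix_power y j ** w = 0"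
proof -
  define f where "f j = matrix_power y j ** w" for j
  define g where "g j = (us ** f j) $ 1 $ 1" for j
  define F where "F j = mspace.span (f ` {..<j})" for j
  have F: "mspace.subspace (F j)" for j by (simp add: F_def)
  have fF: "f i \<in> F j" if "i < j" for i j
    unfolding F_def using that by (intro mspace.span_base) auto
  have F_mono: "F i \<subseteq> F j" if "i \<le> j" for i j
    unfolding F_def using that by (intro mspace.span_mono) auto
  have yf: "y ** f j = f (Suc j)" for j by (simp add: f_def matrix_mul_assoc)
  have xf: "x ** f (Suc j) = y ** (x ** f j) + matrix_scale (g j) w" for j
  proof -
    have "x ** f (Suc j) = (x ** y + ws ** u) ** f j - ws ** (u ** f j)"
      by (simp add: matrix_algebra flip: yf)
    also have "u ** f j = 0" using uyw[of j] by (simp add: f_def matrix_mul_assoc)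
    also have "(x ** y + ws ** u) ** f j = y ** (x ** f j) + w ** (us ** f j)"
      unfolding comm by (simp add: matrix_algebra)
    finally show ?thesis by (simp add: mult_one_by_one g_def)
  qed
  have w0: "w = f 0" by (simp add: f_def)
  have yF: "y ** v \<in> F (Suc j)" if "v \<in> F j" for v j
  proof -
    interpret y: Vector_Spaces.linear matrix_scale matrix_scale "\<lambda>v::complex^1^'n. y ** v"
      by (rule linear_mult_left)
    have "y ** v \<in> mspace.span ((\<lambda>v. y ** v) ` f ` {..<j})"
      using that y.span_image[of "f ` {..<j}"] by (auto simp: F_def)
    also have "\<dots> \<subseteq> F (Suc j)"
      by (intro mspace.span_minimal F) (auto simp: yf intro: fF)
    finally show ?thesis .
  qed
  have gz: "g i = 0" for i
  proof (rule ccontr)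
    assume "g i \<noteq> 0"
    define k where "k = (LEAST i. g i \<noteq> 0)"
    have gk: "g k \<noteq> 0" unfolding k_def using \<open>g i \<noteq> 0\<close> by (rule LeastI)
    have gl: "g i = 0" if "i < k" for i using not_less_Least that unfolding k_def by blast
    have low: "x ** f j = 0" if "j \<le> k" for j
      using that by (induction j) (use xw gl xf in \<open>auto simp: f_def\<close>)
    have top: "x ** f (Suc k + j) - matrix_scale (g k) (f j) \<in> F j" for j
    proof (induction j)
      case 0
      show ?case using xf[of k] low[of k] mspace.subspace_0[OF F] by (simp add: w0)
    next
      case (Suc j)
      have "x ** f (Suc k + Suc j) - matrix_scale (g k) (f (Suc j))
          = y ** (x ** f (Suc k + j) - matrix_scale (g k) (f j)) + matrix_scale (g (Suc k + j)) (f 0)"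
        using xf[of "Suc k + j"] by (simp add: w0 matrix_algebra yf)
      also have "\<dots> \<in> F (Suc j)"
        by (intro mspace.subspace_add mspace.subspace_scale F yF[OF Suc.IH] fF) simp
      finally show ?case .
    qed
    define d where "d = (LEAST d. f d \<in> F d)"
    have "\<exists>d. f d \<in> F d" using cyclic_relation[of f] by (simp add: F_def)
    then have fd: "f d \<in> F d" unfolding d_def by (rule LeastI_ex)
    have dl: "f i \<notin> F i" if "i < d" for i using not_less_Least that unfolding d_def by blast
    show False
    proof (cases "d \<le> k")
      case True
      interpret us: Vector_Spaces.linear matrix_scale matrix_scale "\<lambda>v::complex^1^'n. us ** v"
        by (rule linear_mult_left)
      have Fd: "f (d + i) \<in> F d" for i
      proof (induction i)
        case (Suc i)
        have "F (Suc d) \<subseteq> F d"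
          unfolding F_def[of "Suc d"]
          by (intro mspace.span_minimal F) (use fd fF in \<open>auto simp: less_Suc_eq\<close>)
        then show ?case using yF[OF Suc.IH] yf by auto
      qed (use fd in simp)
      have "us ** v = 0" if "v \<in> F d" for v
        by (rule us.eq_0_on_span[of "f ` {..<d}" v])
          (use that gl True in \<open>auto simp: F_def g_def one_by_one_eq_0\<close>)
      then have "g k = 0" using Fd[of "k - d"] True by (simp add: g_def)
      then show False using gk by simp
    next
      case False
      then obtain j where j: "d = Suc k + j" by (metis add_Suc_right le_Suc_ex not_less_eq_eq add_Suc)
      interpret x: Vector_Spaces.linear matrix_scale matrix_scale "\<lambda>v::complex^1^'n. x ** v"
        by (rule linear_mult_left)
      have "x ** f i \<in> F j" if "i < d" for i
      proof (cases "i \<le> k")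
        case True
        then show ?thesis using low mspace.subspace_0[OF F] by simp
      next
        case False
        then obtain l where l: "i = Suc k + l" by (metis add_Suc_right le_Suc_ex not_less_eq_eq add_Suc)
        then have "x ** f i = (x ** f i - matrix_scale (g k) (f l)) + matrix_scale (g k) (f l)"
          by simp
        also have "\<dots> \<in> F j"
          using top[of l] l j that F_mono[of l j]
          by (intro mspace.subspace_add mspace.subspace_scale F fF) auto
        finally show ?thesis .
      qed
      then have "mspace.span ((\<lambda>v. x ** v) ` f ` {..<d}) \<subseteq> F j"
        by (intro mspace.span_minimal F) auto
      then have xfd: "x ** f d \<in> F j"
        using fd x.span_image[of "f ` {..<d}"] unfolding F_def[of d] by blast
      have "x ** f d - (x ** f d - matrix_scale (g k) (f j)) \<in> F j"
        using mspace.subspace_diff[OF F xfd top[of j, folded j]] .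
      then have "matrix_scale (g k) (f j) \<in> F j" by simp
      then have "f j \<in> F j" using mspace.subspace_scale[OF F, of "matrix_scale (g k) (f j)" j "1 / g k"] gk by simp
      then show False using dl[of j] j by simp
    qed
  qed
  have "x ** f j = 0" by (induction j) (use xw gz xf in \<open>auto simp: f_def\<close>)
  then show "x ** matrix_power y j ** w = 0" by (simp add: f_def matrix_mul_assoc)
  show "us ** matrix_power y j ** w = 0"
    using gz[of j] by (simp add: g_def f_def matrix_mul_assoc one_by_one_eq_0)
qed

text \<open>
  Transposition exchanges \<open>x\<close> and \<open>y\<close> in the products and swaps \<open>u\<close> with \<open>w\<close> and \<open>us\<close> with \<open>ws\<close>, so the
  relation keeps its shape.
\<close>

lemma commutator_kills_cyclic_space_left:
  fixes x y :: "complex^'n^'n" and w ws :: "complex^1^'n" and u us :: "complex^'n^1"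
  assumes comm: "x ** y + ws ** u = y ** x + w ** us"
    and ux: "u ** x = 0" and uyw: "\<And>j. u ** matrix_power y j ** w = 0"
  shows "u ** matrix_power y j ** x = 0"
proof -
  have "transpose x ** transpose y + transpose us ** transpose w
      = transpose y ** transpose x + transpose u ** transpose ws"
    using arg_cong[OF comm, of transpose] by (simp add: matrix_transpose_mul matrix_transpose_add)
  moreover have "transpose x ** transpose u = 0"
    using arg_cong[OF ux, of transpose] by (simp add: matrix_transpose_mul matrix_transpose_0)
  moreover have "transpose w ** matrix_power (transpose y) j ** transpose u = 0" for j
    using arg_cong[OF uyw[of j], of transpose]
    by (simp add: matrix_transpose_mul matrix_power_transpose matrix_mul_assoc matrix_transpose_0)
  ultimately have "transpose x ** matrix_power (transpose y) j ** transpose u = 0"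
    by (rule commutator_kills_cyclic_space)
  then have "transpose (transpose x ** matrix_power (transpose y) j ** transpose u) = 0"
    by (simp add: matrix_transpose_0)
  then show ?thesis
    by (simp add: matrix_transpose_mul matrix_power_transpose matrix_mul_assoc)
qed

section \<open>Bases and coordinates\<close>

text \<open>
  The index set has as many elements as the dimension, so a spanning family indexed by it can have
  neither repetitions nor linear relations.
\<close>

lemma basis_family_if_spanning:
  fixes b :: "'i \<Rightarrow> complex^'m"
  assumes I: "finite I" "card I = CARD('m)" and span: "vec.span (b ` I) = UNIV"
  shows "basis_family I b"
proof -
  have "CARD('m) = vec.dim (UNIV :: (complex^'m) set)"
    by (simp add: card_cart_basis vec.dimension_def)
  also have "\<dots> \<le> card (b ` I)"
    using vec.dim_le_card[of UNIV "b ` I"] span I(1) by simp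
  finally have "CARD('m) \<le> card (b ` I)" .
  then have c: "card (b ` I) = card I" using I card_image_le[of I b] by simp
  then have "inj_on b I" using I by (simp add: eq_card_imp_inj_on)
  moreover have "vec.independent (b ` I)"
    using vec.card_le_dim_spanning[of "b ` I" UNIV] span I c
    by (simp add: card_cart_basis vec.dimension_def)
  ultimately show ?thesis using span by (simp add: basis_family_def)
qed

lemma dual_basis_expansion:
  fixes a \<alpha> :: "'i \<Rightarrow> complex^'m"
  assumes "\<And>i j. (\<Sum>s\<in>I. a s $ i * \<alpha> s $ j) = (if i = j then 1 else 0)"
  shows "v = (\<Sum>s\<in>I. (\<Sum>i\<in>UNIV. v $ i * a s $ i) *s \<alpha> s)"
  unfolding vec_eq_iff
proof
  fix j
  have "(\<Sum>s\<in>I. (\<Sum>i\<in>UNIV. v $ i * a s $ i) *s \<alpha> s) $ j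
      = (\<Sum>s\<in>I. \<Sum>i\<in>UNIV. v $ i * (a s $ i * \<alpha> s $ j))"
    by (simp add: sum_distrib_right mult.assoc)
  also have "\<dots> = (\<Sum>i\<in>UNIV. v $ i * (\<Sum>s\<in>I. a s $ i * \<alpha> s $ j))"
    by (subst sum.swap) (simp add: sum_distrib_left)
  also have "\<dots> = (\<Sum>i\<in>UNIV. if i = j then v $ j else 0)"
    unfolding assms by (rule sum.cong) auto
  finally show "v $ j = (\<Sum>s\<in>I. (\<Sum>i\<in>UNIV. v $ i * a s $ i) *s \<alpha> s) $ j" by simp
qed

text \<open>
  The vectors \<open>\<alpha> s\<close> are the rows of the inverse of the matrix with columns \<open>a s\<close>; the two displayed
  identities say that it is a left and a right inverse.
\<close>

lemma dual_basis:
  fixes a :: "'i \<Rightarrow> complex^'m"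
  assumes I: "finite I" "card I = CARD('m)" and a: "basis_family I a"
  shows "\<exists>\<alpha>. basis_family I \<alpha> \<and>
    (\<forall>r\<in>I. \<forall>s\<in>I. (\<Sum>i\<in>UNIV. \<alpha> r $ i * a s $ i) = (if r = s then 1 else 0)) \<and>
    (\<forall>i j. (\<Sum>s\<in>I. a s $ i * \<alpha> s $ j) = (if i = j then 1 else 0))"
proof -
  obtain h :: "'m \<Rightarrow> 'i" where h: "bij_betw h UNIV I"
    using finite_same_card_bij[of "UNIV :: 'm set" I] I by auto
  define g where "g = inv_into UNIV h"
  have gh: "g (h p) = p" for p unfolding g_def using h by (simp add: bij_betw_def)
  have hg: "h (g s) = s" if "s \<in> I" for s
    unfolding g_def using h that by (simp add: bij_betw_def f_inv_into_f)
  define A where "A = (\<chi> i p. a (h p) $ i)"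
  have "columns A = a ` I"
    using h by (auto simp: columns_def A_def column_def bij_betw_def image_iff)
  then have "vec.span (columns A) = UNIV" using a by (simp add: basis_family_def)
  then obtain B where AB: "A ** B = mat 1"
    by (auto simp: matrix_right_invertible_span_columns[symmetric])
  then have BA: "B ** A = mat 1" by (simp add: matrix_left_right_inverse)
  define \<alpha> where "\<alpha> s = row (g s) B" for s
  have 1: "(\<Sum>i\<in>UNIV. \<alpha> r $ i * a s $ i) = (if r = s then 1 else 0)" if "r \<in> I" "s \<in> I" for r s
  proof -
    have "(\<Sum>i\<in>UNIV. \<alpha> r $ i * a s $ i) = (B ** A) $ g r $ g s"
      using that by (simp add: matrix_matrix_mult_def \<alpha>_def row_def A_def hg)
    also have "\<dots> = (if r = s then 1 else 0)"
    proof -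
      have "g r = g s \<longleftrightarrow> r = s" using hg[OF that(1)] hg[OF that(2)] by metis
      then show ?thesis unfolding BA by (simp add: mat_def)
    qed
    finally show ?thesis .
  qed
  have 2: "(\<Sum>s\<in>I. a s $ i * \<alpha> s $ j) = (if i = j then 1 else 0)" for i j
  proof -
    have "(\<Sum>s\<in>I. a s $ i * \<alpha> s $ j) = (\<Sum>p\<in>UNIV. a (h p) $ i * \<alpha> (h p) $ j)"
      using sum.reindex_bij_betw[OF h, of "\<lambda>s. a s $ i * \<alpha> s $ j"] by simp
    also have "\<dots> = (A ** B) $ i $ j"
      by (simp add: matrix_matrix_mult_def \<alpha>_def row_def A_def gh)
    also have "\<dots> = (if i = j then 1 else 0)" by (simp add: AB mat_def)
    finally show ?thesis .
  qed
  have "v \<in> vec.span (\<alpha> ` I)" for v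
  proof -
    have "v = (\<Sum>s\<in>I. (\<Sum>i\<in>UNIV. v $ i * a s $ i) *s \<alpha> s)"
      by (rule dual_basis_expansion[OF 2])
    also have "\<dots> \<in> vec.span (\<alpha> ` I)"
      by (intro vec.span_sum vec.span_scale vec.span_base) auto
    finally show ?thesis .
  qed
  then have "basis_family I \<alpha>" by (intro basis_family_if_spanning I) auto
  then show ?thesis using 1 2 by blast
qed

lemma contract_A_sum_tensor_A:
  "contract_A (\<Sum>s\<in>I. tensor_A (a s) (K s)) \<gamma>
     = (\<Sum>s\<in>I. matrix_scale (\<Sum>i\<in>UNIV. \<gamma> $ i * a s $ i) (K s))"
  by (simp add: contract_A_sum contract_A_tensor_A)

text \<open>
  A basis \<open>\<alpha>\<close> of \<open>A\<^sup>*\<close> with dual basis \<open>a\<close> presents \<open>T\<close> through the matrices \<open>T(\<alpha> s)\<close>.  So normal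
  forms of \<open>T\<close> are obtained by choosing a basis of \<open>A\<^sup>*\<close>.
\<close>

lemma tensor_expansion:
  fixes a \<alpha> :: "'i \<Rightarrow> complex^'m"
  assumes "\<And>i j. (\<Sum>s\<in>I. a s $ i * \<alpha> s $ j) = (if i = j then 1 else 0)"
  shows "T = (\<Sum>s\<in>I. tensor_A (a s) (contract_A T (\<alpha> s)))"
proof (rule tensor_eqI)
  fix \<gamma>
  interpret c: Vector_Spaces.linear "(*s)" matrix_scale "contract_A T" by (rule linear_contract_A)
  have "contract_A T \<gamma> = contract_A T (\<Sum>s\<in>I. (\<Sum>i\<in>UNIV. \<gamma> $ i * a s $ i) *s \<alpha> s)"
    using dual_basis_expansion[OF assms, of \<gamma>] by simp
  also have "\<dots> = contract_A (\<Sum>s\<in>I. tensor_A (a s) (contract_A T (\<alpha> s))) \<gamma>"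
    by (simp add: contract_A_sum_tensor_A c.sum c.scale)
  finally show "contract_A T \<gamma> = contract_A (\<Sum>s\<in>I. tensor_A (a s) (contract_A T (\<alpha> s))) \<gamma>" .
qed

lemma basis_matrix:
  fixes b :: "'m \<Rightarrow> complex^'m"
  assumes "basis_family UNIV b"
  obtains P P' where "P = (\<chi> i j. b j $ i)" "P ** P' = mat 1" "P' ** P = mat 1"
proof -
  define P where "P = (\<chi> i j. b j $ i)"
  have "columns P = range b" by (auto simp: columns_def P_def column_def)
  then have "vec.span (columns P) = UNIV" using assms by (simp add: basis_family_def)
  then obtain P' where "P ** P' = mat 1"
    by (auto simp: matrix_right_invertible_span_columns[symmetric])
  then show ?thesis using that P_def by (simp add: matrix_left_right_inverse)
qed

lemma basis_family_columns:
  fixes P :: "complex^'m^'m"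
  assumes "P ** P' = mat 1"
  shows "basis_family UNIV (\<lambda>j. column j P)"
proof (rule basis_family_if_spanning)
  have "range (\<lambda>j. column j P) = columns P" by (auto simp: columns_def)
  then show "vec.span (range (\<lambda>j. column j P)) = UNIV"
    using assms matrix_right_invertible_span_columns[of P] by auto
qed auto

lemma matrix_wrt_iff:
  "matrix_wrt \<beta> c L M \<longleftrightarrow> L ** (\<chi> i j. \<beta> j $ i) = (\<chi> i k. c k $ i) ** M"
  by (auto simp: matrix_wrt_def vec_eq_iff matrix_matrix_mult_def matrix_vector_mult_def mult.commute)

section \<open>Tensors as spaces of matrices\<close>

lemma inj_contract_A_iff: "inj (contract_A T) \<longleftrightarrow> (\<forall>\<gamma>. contract_A T \<gamma> = 0 \<longrightarrow> \<gamma> = 0)"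
proof -
  interpret c: Vector_Spaces.linear "(*s)" matrix_scale "contract_A T" by (rule linear_contract_A)
  show ?thesis using c.inj_iff_eq_0 by blast
qed

text \<open>
  Injectivity of \<open>T : B\<^sup>* \<rightarrow> A \<otimes> C\<close> says that no nonzero vector is annihilated by all of \<open>T(A\<^sup>*)\<close>.
  Stating this for all columns of a square matrix at once keeps everything within block matrices.
\<close>

lemma inj_contract_B_iff:
  "inj (contract_B T) \<longleftrightarrow> (\<forall>Y::complex^'b^'b. (\<forall>\<gamma>. contract_A T \<gamma> ** Y = 0) \<longrightarrow> Y = 0)"
  for T :: "complex^'c^'b^'a"
proof
  have 0: "contract_B T 0 = 0" by (simp add: contract_B_def vec_eq_iff)
  assume inj: "inj (contract_B T)"
  show "\<forall>Y::complex^'b^'b. (\<forall>\<gamma>. contract_A T \<gamma> ** Y = 0) \<longrightarrow> Y = 0"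
  proof (intro allI impI)
    fix Y :: "complex^'b^'b" assume Y: "\<forall>\<gamma>. contract_A T \<gamma> ** Y = 0"
    have "contract_B T (column j Y) = contract_B T 0" for j
      unfolding 0 vec_eq_iff contract_B_column by (simp add: Y)
    then have "column j Y = 0" for j using inj by (simp add: inj_eq)
    then show "Y = 0" by (simp add: vec_eq_iff column_def)
  qed
next
  assume a: "\<forall>Y::complex^'b^'b. (\<forall>\<gamma>. contract_A T \<gamma> ** Y = 0) \<longrightarrow> Y = 0"
  show "inj (contract_B T)"
  proof (rule injI)
    fix \<beta> \<beta>' assume "contract_B T \<beta> = contract_B T \<beta>'"
    then have z: "(\<Sum>l\<in>UNIV. (\<beta> - \<beta>') $ l * T $ i $ l $ k) = 0" for i k
      by (simp add: contract_B_def vec_eq_iff left_diff_distrib sum_subtractf)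
    define Y :: "complex^'b^'b" where "Y = (\<chi> l j. (\<beta> - \<beta>') $ l)"
    have "(contract_A T \<gamma> ** Y) $ k $ j = 0" for \<gamma> k j
    proof -
      have "(contract_A T \<gamma> ** Y) $ k $ j
          = (\<Sum>l\<in>UNIV. \<Sum>i\<in>UNIV. \<gamma> $ i * ((\<beta> - \<beta>') $ l * T $ i $ l $ k))"
        by (simp add: matrix_matrix_mult_def contract_A_nth Y_def sum_distrib_left
            sum_distrib_right mult_ac right_diff_distrib left_diff_distrib)
      also have "\<dots> = (\<Sum>i\<in>UNIV. \<gamma> $ i * (\<Sum>l\<in>UNIV. (\<beta> - \<beta>') $ l * T $ i $ l $ k))"
        by (subst sum.swap) (simp add: sum_distrib_left)
      finally show ?thesis unfolding z by simp
    qed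
    then have "\<forall>\<gamma>. contract_A T \<gamma> ** Y = 0" by (simp add: vec_eq_iff)
    with a have "Y = 0" by blast
    then show "\<beta> = \<beta>'" by (simp add: Y_def vec_eq_iff)
  qed
qed

lemma inj_contract_C_iff:
  "inj (contract_C T) \<longleftrightarrow> (\<forall>Z::complex^'c^'c. (\<forall>\<gamma>. Z ** contract_A T \<gamma> = 0) \<longrightarrow> Z = 0)"
  for T :: "complex^'c^'b^'a"
proof
  have 0: "contract_C T 0 = 0" by (simp add: contract_C_def vec_eq_iff)
  assume inj: "inj (contract_C T)"
  show "\<forall>Z::complex^'c^'c. (\<forall>\<gamma>. Z ** contract_A T \<gamma> = 0) \<longrightarrow> Z = 0"
  proof (intro allI impI)
    fix Z :: "complex^'c^'c" assume Z: "\<forall>\<gamma>. Z ** contract_A T \<gamma> = 0"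
    have "contract_C T (row j Z) = contract_C T 0" for j
      unfolding 0 vec_eq_iff contract_C_row by (simp add: Z)
    then have "row j Z = 0" for j using inj by (simp add: inj_eq)
    then show "Z = 0" by (simp add: vec_eq_iff row_def)
  qed
next
  assume a: "\<forall>Z::complex^'c^'c. (\<forall>\<gamma>. Z ** contract_A T \<gamma> = 0) \<longrightarrow> Z = 0"
  show "inj (contract_C T)"
  proof (rule injI)
    fix \<beta> \<beta>' assume "contract_C T \<beta> = contract_C T \<beta>'"
    then have z: "(\<Sum>l\<in>UNIV. (\<beta> - \<beta>') $ l * T $ i $ j $ l) = 0" for i j
      by (simp add: contract_C_def vec_eq_iff left_diff_distrib sum_subtractf)
    define Z :: "complex^'c^'c" where "Z = (\<chi> k l. (\<beta> - \<beta>') $ l)"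
    have "(Z ** contract_A T \<gamma>) $ k $ j = 0" for \<gamma> k j
    proof -
      have "(Z ** contract_A T \<gamma>) $ k $ j
          = (\<Sum>l\<in>UNIV. \<Sum>i\<in>UNIV. \<gamma> $ i * ((\<beta> - \<beta>') $ l * T $ i $ j $ l))"
        by (simp add: matrix_matrix_mult_def contract_A_nth Z_def sum_distrib_left
            sum_distrib_right mult_ac right_diff_distrib left_diff_distrib)
      also have "\<dots> = (\<Sum>i\<in>UNIV. \<gamma> $ i * (\<Sum>l\<in>UNIV. (\<beta> - \<beta>') $ l * T $ i $ j $ l))"
        by (subst sum.swap) (simp add: sum_distrib_left)
      finally show ?thesis unfolding z by simp
    qed
    then have "\<forall>\<gamma>. Z ** contract_A T \<gamma> = 0" by (simp add: vec_eq_iff)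
    with a have "Z = 0" by blast
    then show "\<beta> = \<beta>'" by (simp add: Z_def vec_eq_iff)
  qed
qed

lemma left_multiple_tensor: "\<exists>t. \<forall>\<alpha>. contract_A t \<alpha> = Z ** contract_A T \<alpha>"
proof (intro exI allI)
  fix \<alpha>
  show "contract_A (\<chi> i j k. \<Sum>l\<in>UNIV. Z $ k $ l * T $ i $ j $ l) \<alpha> = Z ** contract_A T \<alpha>"
    unfolding vec_eq_iff
  proof (intro allI)
    fix k j
    have "contract_A (\<chi> i j k. \<Sum>l\<in>UNIV. Z $ k $ l * T $ i $ j $ l) \<alpha> $ k $ j
        = (\<Sum>i\<in>UNIV. \<Sum>l\<in>UNIV. \<alpha> $ i * (Z $ k $ l * T $ i $ j $ l))"
      by (simp add: contract_A_nth sum_distrib_left)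
    also have "\<dots> = (\<Sum>l\<in>UNIV. \<Sum>i\<in>UNIV. \<alpha> $ i * (Z $ k $ l * T $ i $ j $ l))" by (rule sum.swap)
    also have "\<dots> = (Z ** contract_A T \<alpha>) $ k $ j"
      by (simp add: matrix_matrix_mult_def contract_A_nth sum_distrib_left mult_ac)
    finally show "contract_A (\<chi> i j k. \<Sum>l\<in>UNIV. Z $ k $ l * T $ i $ j $ l) \<alpha> $ k $ j
        = (Z ** contract_A T \<alpha>) $ k $ j" .
  qed
qed

lemma left_factor_cancel:
  fixes Y :: "complex^'n^'m"
  assumes "B ** A = mat 1" and 0: "A ** Y = 0"
  shows "Y = 0"
proof -
  have "Y = B ** (A ** Y)" using assms(1) by (simp add: matrix_mul_assoc)
  then show ?thesis by (simp add: 0)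
qed

lemma right_factor_cancel:
  fixes Y :: "complex^'n^'m"
  assumes "A ** B = mat 1" and 0: "Y ** A = 0"
  shows "Y = 0"
proof -
  have "Y = (Y ** A) ** B" using assms(1) by (simp flip: matrix_mul_assoc)
  then show ?thesis by (simp add: 0)
qed

text \<open>
  Bases of \<open>B\<^sup>*\<close> and \<open>C\<close> are the columns of invertible matrices \<open>P\<close> and \<open>Q\<close>, with inverses \<open>P'\<close> and
  \<open>Q'\<close>.  A slice of a tensor is a contraction with an element of \<open>A\<^sup>*\<close>, written in these bases.
\<close>

locale frame =
  fixes T :: "complex^('n::finite option)^('n option)^('n option)"
    and P P' Q Q' :: "complex^('n option)^('n option)"
  assumes P: "P ** P' = mat 1" "P' ** P = mat 1" and Q: "Q ** Q' = mat 1" "Q' ** Q = mat 1"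
begin

definition slice :: "complex^('n option)^('n option)^('n option) \<Rightarrow> complex^('n option)
    \<Rightarrow> complex^('n option)^('n option)" where
  "slice t \<alpha> = Q' ** contract_A t \<alpha> ** P"

lemma contract_A_slice: "contract_A t \<alpha> = Q ** slice t \<alpha> ** P'"
proof -
  have "Q ** slice t \<alpha> ** P' = (Q ** Q') ** contract_A t \<alpha> ** (P ** P')"
    unfolding slice_def by (simp only: matrix_mul_assoc)
  then show ?thesis by (simp add: P Q)
qed

lemma slice_add: "slice t (\<alpha> + \<alpha>') = slice t \<alpha> + slice t \<alpha>'"
  by (simp add: slice_def contract_A_add matrix_algebra)

lemma slice_scale: "slice t (z *s \<alpha>) = matrix_scale z (slice t \<alpha>)"
  by (simp add: slice_def contract_A_scale matrix_algebra)

lemma slice_tensor_add: "slice (t + t') \<alpha> = slice t \<alpha> + slice t' \<alpha>"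
  by (simp add: slice_def contract_A_tensor_add matrix_algebra)

lemma slice_tensor_scale: "slice (tensor_scale z t) \<alpha> = matrix_scale z (slice t \<alpha>)"
  by (simp add: slice_def contract_A_tensor_scale matrix_algebra)

lemma slice_eqI: "(\<And>\<alpha>. slice t \<alpha> = slice t' \<alpha>) \<Longrightarrow> t = t'"
  by (rule tensor_eqI) (simp add: contract_A_slice)

lemma slice_eq_0_iff: "slice t \<alpha> = 0 \<longleftrightarrow> contract_A t \<alpha> = 0"
  using contract_A_slice[of t \<alpha>] by (auto simp: slice_def)

lemma slice_in_range_iff: "slice t \<alpha> \<in> range (slice T) \<longleftrightarrow> contract_A t \<alpha> \<in> range (contract_A T)"
proof -
  have "slice t \<alpha> = slice T \<gamma> \<longleftrightarrow> contract_A t \<alpha> = contract_A T \<gamma>" for \<gamma>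
    using contract_A_slice[of t \<alpha>] contract_A_slice[of T \<gamma>]
    by (auto simp: slice_def[of t \<alpha>] slice_def[of T \<gamma>])
  then show ?thesis by (simp add: image_iff)
qed

text \<open>
  The endomorphisms \<open>Y\<close> and \<open>Z\<close> are the ones from \<open>span_tensor_B\<close> and \<open>span_tensor_C\<close>, conjugated by the
  change of bases.
\<close>

lemma triple_intersection_slices:
  "t \<in> triple_intersection T \<longleftrightarrow>
     (\<exists>Y Z. \<forall>\<alpha>. slice t \<alpha> = Z ** slice T \<alpha> \<and> slice t \<alpha> = slice T \<alpha> ** Y \<and>
        slice t \<alpha> \<in> range (slice T))" (is "_ \<longleftrightarrow> ?R")
proof
  assume "t \<in> triple_intersection T"
  then obtain Y Z where t: "\<And>\<alpha>. contract_A t \<alpha> \<in> range (contract_A T)"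
    and Y: "\<And>\<alpha>. contract_A t \<alpha> = contract_A T \<alpha> ** Y"
    and Z: "\<And>\<alpha>. contract_A t \<alpha> = Z ** contract_A T \<alpha>"
    unfolding triple_intersection_iff by blast
  have "slice t \<alpha> = (Q' ** Z ** Q) ** slice T \<alpha>" for \<alpha>
  proof -
    have "(Q' ** Z ** Q) ** slice T \<alpha> = Q' ** Z ** (Q ** Q') ** contract_A T \<alpha> ** P"
      unfolding slice_def by (simp only: matrix_mul_assoc)
    then show ?thesis by (simp add: slice_def Z Q matrix_mul_assoc)
  qed
  moreover have "slice t \<alpha> = slice T \<alpha> ** (P' ** Y ** P)" for \<alpha>
  proof -
    have "slice T \<alpha> ** (P' ** Y ** P) = Q' ** contract_A T \<alpha> ** (P ** P') ** Y ** P"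
      unfolding slice_def by (simp only: matrix_mul_assoc)
    then show ?thesis by (simp add: slice_def Y P matrix_mul_assoc)
  qed
  ultimately show ?R using t slice_in_range_iff by blast
next
  assume ?R
  then obtain Y Z where t: "\<And>\<alpha>. slice t \<alpha> \<in> range (slice T)"
    and Y: "\<And>\<alpha>. slice t \<alpha> = slice T \<alpha> ** Y"
    and Z: "\<And>\<alpha>. slice t \<alpha> = Z ** slice T \<alpha>"
    by blast
  have "contract_A t \<alpha> = (Q ** Z ** Q') ** contract_A T \<alpha>" for \<alpha>
  proof -
    have "(Q ** Z ** Q') ** contract_A T \<alpha> = Q ** Z ** (Q' ** Q) ** slice T \<alpha> ** P'"
      unfolding contract_A_slice by (simp only: matrix_mul_assoc)
    then show ?thesis by (simp add: contract_A_slice[of t] Z Q matrix_mul_assoc)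
  qed
  moreover have "contract_A t \<alpha> = contract_A T \<alpha> ** (P ** Y ** P')" for \<alpha>
  proof -
    have "contract_A T \<alpha> ** (P ** Y ** P') = Q ** slice T \<alpha> ** (P' ** P) ** Y ** P'"
      unfolding contract_A_slice by (simp only: matrix_mul_assoc)
    then show ?thesis by (simp add: contract_A_slice[of t] Y P matrix_mul_assoc)
  qed
  ultimately show "t \<in> triple_intersection T"
    unfolding triple_intersection_iff using t slice_in_range_iff by blast
qed

lemma triple_intersection_lift:
  assumes "\<And>\<alpha>. Z ** slice T \<alpha> = slice T \<alpha> ** Y" and "\<And>\<alpha>. Z ** slice T \<alpha> \<in> range (slice T)"
  obtains t where "t \<in> triple_intersection T" "\<And>\<alpha>. slice t \<alpha> = Z ** slice T \<alpha>"
proof -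
  obtain t where t: "\<And>\<alpha>. contract_A t \<alpha> = (Q ** Z ** Q') ** contract_A T \<alpha>"
    using left_multiple_tensor by metis
  have "slice t \<alpha> = (Q' ** Q) ** Z ** slice T \<alpha>" for \<alpha>
    unfolding slice_def t by (simp only: matrix_mul_assoc)
  then have "slice t \<alpha> = Z ** slice T \<alpha>" for \<alpha> by (simp add: Q)
  moreover from this have "t \<in> triple_intersection T"
    unfolding triple_intersection_slices using assms by metis
  ultimately show ?thesis using that by blast
qed

lemma concise_slices:
  "concise T \<longleftrightarrow> (\<forall>\<gamma>. slice T \<gamma> = 0 \<longrightarrow> \<gamma> = 0) \<and>
     (\<forall>Y::complex^('n option)^('n option). (\<forall>\<gamma>. slice T \<gamma> ** Y = 0) \<longrightarrow> Y = 0) \<and>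
     (\<forall>Z::complex^('n option)^('n option). (\<forall>\<gamma>. Z ** slice T \<gamma> = 0) \<longrightarrow> Z = 0)"
proof -
  have right: "slice T \<gamma> ** Y = 0 \<longleftrightarrow> contract_A T \<gamma> ** (P ** Y) = 0"
    for \<gamma> and Y :: "complex^('n option)^('n option)"
  proof -
    have "slice T \<gamma> ** Y = Q' ** (contract_A T \<gamma> ** (P ** Y))"
      unfolding slice_def by (simp only: matrix_mul_assoc)
    then show ?thesis using left_factor_cancel[OF Q(1)] by auto
  qed
  have left: "Z ** slice T \<gamma> = 0 \<longleftrightarrow> (Z ** Q') ** contract_A T \<gamma> = 0"
    for \<gamma> and Z :: "complex^('n option)^('n option)"
  proof -
    have "Z ** slice T \<gamma> = ((Z ** Q') ** contract_A T \<gamma>) ** P"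
      unfolding slice_def by (simp only: matrix_mul_assoc)
    then show ?thesis using right_factor_cancel[OF P(1)] by auto
  qed
  have "(\<forall>Y::complex^('n option)^('n option). (\<forall>\<gamma>. contract_A T \<gamma> ** Y = 0) \<longrightarrow> Y = 0)
      \<longleftrightarrow> (\<forall>Y::complex^('n option)^('n option). (\<forall>\<gamma>. slice T \<gamma> ** Y = 0) \<longrightarrow> Y = 0)"
  proof (intro iffI allI impI)
    fix Y :: "complex^('n option)^('n option)"
    assume a: "\<forall>Y::complex^('n option)^('n option). (\<forall>\<gamma>. contract_A T \<gamma> ** Y = 0) \<longrightarrow> Y = 0"
      and Y: "\<forall>\<gamma>. slice T \<gamma> ** Y = 0"
    then have "P ** Y = 0" using right by blast
    then show "Y = 0" by (rule left_factor_cancel[OF P(2)])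
  next
    fix Y :: "complex^('n option)^('n option)"
    assume a: "\<forall>Y::complex^('n option)^('n option). (\<forall>\<gamma>. slice T \<gamma> ** Y = 0) \<longrightarrow> Y = 0"
      and Y: "\<forall>\<gamma>. contract_A T \<gamma> ** Y = 0"
    have "P ** (P' ** Y) = Y" by (simp add: matrix_mul_assoc P)
    then have "P' ** Y = 0" using a Y right[of _ "P' ** Y"] by simp
    then show "Y = 0" by (rule left_factor_cancel[OF P(1)])
  qed
  moreover have "(\<forall>Z::complex^('n option)^('n option). (\<forall>\<gamma>. Z ** contract_A T \<gamma> = 0) \<longrightarrow> Z = 0)
      \<longleftrightarrow> (\<forall>Z::complex^('n option)^('n option). (\<forall>\<gamma>. Z ** slice T \<gamma> = 0) \<longrightarrow> Z = 0)"
  proof (intro iffI allI impI)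
    fix Z :: "complex^('n option)^('n option)"
    assume a: "\<forall>Z::complex^('n option)^('n option). (\<forall>\<gamma>. Z ** contract_A T \<gamma> = 0) \<longrightarrow> Z = 0"
      and Z: "\<forall>\<gamma>. Z ** slice T \<gamma> = 0"
    then have "Z ** Q' = 0" using left by blast
    then show "Z = 0" by (rule right_factor_cancel[OF Q(2)])
  next
    fix Z :: "complex^('n option)^('n option)"
    assume a: "\<forall>Z::complex^('n option)^('n option). (\<forall>\<gamma>. Z ** slice T \<gamma> = 0) \<longrightarrow> Z = 0"
      and Z: "\<forall>\<gamma>. Z ** contract_A T \<gamma> = 0"
    have "Z ** Q ** Q' = Z" by (simp add: Q flip: matrix_mul_assoc)
    then have "Z ** Q = 0" using a Z left[of "Z ** Q"] by simp
    then show "Z = 0" by (rule right_factor_cancel[OF Q(1)])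
  qed
  ultimately show ?thesis
    unfolding concise_def inj_contract_A_iff inj_contract_B_iff inj_contract_C_iff slice_eq_0_iff
    by simp
qed

lemma one_A_generic_slices:
  "\<not> one_A_generic T \<longleftrightarrow> (\<forall>\<gamma>. \<exists>V::complex^1^('n option). V \<noteq> 0 \<and> slice T \<gamma> ** V = 0)"
proof -
  have "(\<exists>V::complex^1^('n option). V \<noteq> 0 \<and> contract_A T \<gamma> ** V = 0)
      \<longleftrightarrow> (\<exists>V::complex^1^('n option). V \<noteq> 0 \<and> slice T \<gamma> ** V = 0)" for \<gamma>
  proof
    assume "\<exists>V::complex^1^('n option). V \<noteq> 0 \<and> contract_A T \<gamma> ** V = 0"
    then obtain V :: "complex^1^('n option)" where V: "V \<noteq> 0" "contract_A T \<gamma> ** V = 0" by blast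
    have e: "P ** (P' ** V) = V" by (simp add: matrix_mul_assoc P)
    have "slice T \<gamma> ** (P' ** V) = Q' ** (contract_A T \<gamma> ** (P ** (P' ** V)))"
      unfolding slice_def by (simp only: matrix_mul_assoc)
    then have "slice T \<gamma> ** (P' ** V) = 0" by (simp add: e V)
    moreover have "P' ** V \<noteq> 0" using e V(1) by auto
    ultimately show "\<exists>V::complex^1^('n option). V \<noteq> 0 \<and> slice T \<gamma> ** V = 0" by blast
  next
    assume "\<exists>V::complex^1^('n option). V \<noteq> 0 \<and> slice T \<gamma> ** V = 0"
    then obtain V :: "complex^1^('n option)" where V: "V \<noteq> 0" "slice T \<gamma> ** V = 0" by blast
    have e: "P' ** (P ** V) = V" by (simp add: matrix_mul_assoc P)
    have "contract_A T \<gamma> ** (P ** V) = Q ** (slice T \<gamma> ** (P' ** (P ** V)))"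
      unfolding contract_A_slice by (simp only: matrix_mul_assoc)
    then have "contract_A T \<gamma> ** (P ** V) = 0" by (simp add: e V)
    moreover have "P ** V \<noteq> 0" using e V(1) by auto
    ultimately show "\<exists>V::complex^1^('n option). V \<noteq> 0 \<and> contract_A T \<gamma> ** V = 0" by blast
  qed
  moreover have "\<not> one_A_generic T \<longleftrightarrow> (\<forall>\<gamma>. rank (contract_A T \<gamma>) \<noteq> CARD('n option))"
    by (auto simp: one_A_generic_def simp del: card_option)
  ultimately show ?thesis
    unfolding rank_neq_iff_kernel_column by simp
qed

text \<open>
  The pencil through a slice and \<open>diag(Id, 0)\<close> consists of slices, all singular.
\<close>

lemma not_generic_imp_orthogonal:
  assumes ng: "\<not> one_A_generic T" and 1: "slice T \<gamma>1 = block (mat 1) 0 0 0"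
    and s: "slice T \<gamma> = block X w' u' z"
  shows "z = 0" "u' ** matrix_power X j ** w' = 0"
proof -
  have "\<exists>V::complex^1^('n option). V \<noteq> 0 \<and> block (X - matrix_scale s (mat 1)) w' u' z ** V = 0" for s
  proof -
    have "slice T (\<gamma> + (-s) *s \<gamma>1) = block (X - matrix_scale s (mat 1)) w' u' z"
      unfolding slice_add slice_scale s 1 by (simp add: block_scale block_add)
    then show ?thesis using ng unfolding one_A_generic_slices by metis
  qed
  from singular_pencil_power_products[OF this] show "z = 0" "u' ** matrix_power X j ** w' = 0" by auto
qed

end

section \<open>The triple intersection in block form\<close>

definition upper_left :: "complex^('n option)^('n option) \<Rightarrow> complex^'n^'n" where
  "upper_left M = (\<chi> i j. M $ Some i $ Some j)"

definition upper_right :: "complex^('n option)^('n option) \<Rightarrow> complex^1^'n" where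
  "upper_right M = (\<chi> i j. M $ Some i $ None)"

definition lower_left :: "complex^('n option)^('n option) \<Rightarrow> complex^'n^1" where
  "lower_left M = (\<chi> i j. M $ None $ Some j)"

lemma block_parts [simp]:
  "upper_left (block X w u z) = X" "upper_right (block X w u z) = w"
  "lower_left (block X w u z) = u"
  by (simp_all add: upper_left_def upper_right_def lower_left_def vec_eq_iff forall_1)

locale block_frame = frame +
  fixes \<alpha>1 :: "complex^('a option)"
  assumes slice_\<alpha>1: "slice T \<alpha>1 = block (mat 1) 0 0 0"
    and form: "\<exists>X w u. slice T \<alpha> = block X w u 0"
    and concise: "concise T"
begin

definition X where "X \<alpha> = upper_left (slice T \<alpha>)"
definition w where "w \<alpha> = upper_right (slice T \<alpha>)"
definition u where "u \<alpha> = lower_left (slice T \<alpha>)"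

lemma slice_block: "slice T \<alpha> = block (X \<alpha>) (w \<alpha>) (u \<alpha>) 0"
  using form[of \<alpha>] by (auto simp: X_def w_def u_def)

lemma parts_add: "X (\<alpha> + \<alpha>') = X \<alpha> + X \<alpha>'" "w (\<alpha> + \<alpha>') = w \<alpha> + w \<alpha>'" "u (\<alpha> + \<alpha>') = u \<alpha> + u \<alpha>'"
  using slice_add[of T \<alpha> \<alpha>'] by (simp_all add: slice_block block_add block_eq_iff)

lemma parts_scale: "X (z *s \<alpha>) = matrix_scale z (X \<alpha>)" "w (z *s \<alpha>) = matrix_scale z (w \<alpha>)"
    "u (z *s \<alpha>) = matrix_scale z (u \<alpha>)"
  using slice_scale[of T z \<alpha>] by (simp_all add: slice_block block_scale block_eq_iff)

lemma linear_X: "Vector_Spaces.linear (*s) matrix_scale X"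
  by (simp add: Vector_Spaces.linear_iff vec.vector_space_axioms mspace.vector_space_axioms
      parts_add parts_scale)

lemma linear_w: "Vector_Spaces.linear (*s) matrix_scale w"
  by (simp add: Vector_Spaces.linear_iff vec.vector_space_axioms mspace.vector_space_axioms
      parts_add parts_scale)

lemma linear_u: "Vector_Spaces.linear (*s) matrix_scale u"
  by (simp add: Vector_Spaces.linear_iff vec.vector_space_axioms mspace.vector_space_axioms
      parts_add parts_scale)

sublocale X: Vector_Spaces.linear "(*s)" matrix_scale X by (rule linear_X)
sublocale w: Vector_Spaces.linear "(*s)" matrix_scale w by (rule linear_w)
sublocale u: Vector_Spaces.linear "(*s)" matrix_scale u by (rule linear_u)

lemma parts_\<alpha>1 [simp]: "X \<alpha>1 = mat 1" "w \<alpha>1 = 0" "u \<alpha>1 = 0"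
  using slice_\<alpha>1 by (simp_all add: slice_block block_eq_iff)

lemma parts_inj: "X \<alpha> = 0 \<Longrightarrow> w \<alpha> = 0 \<Longrightarrow> u \<alpha> = 0 \<Longrightarrow> \<alpha> = 0"
  using concise unfolding concise_slices by (auto simp: slice_block block_0)

text \<open>
  The image \<open>D\<close> of \<open>V\<close> is the space of all \<open>x\<close> with \<open>diag(x, 0) \<in> T(A\<^sup>*)\<close>, see \<open>D_iff\<close> below.
\<close>

definition V where "V = {\<alpha>. w \<alpha> = 0 \<and> u \<alpha> = 0}"

definition D where "D = X ` V"

lemma subspace_V: "vec.subspace V"
  by (auto simp: V_def vec.subspace_def w.add w.scale u.add u.scale)

lemma subspace_D: "mspace.subspace D"
  unfolding D_def by (rule X.subspace_image[OF subspace_V])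

lemma \<alpha>1_V: "\<alpha>1 \<in> V"
  by (simp add: V_def)

lemma D_iff: "x \<in> D \<longleftrightarrow> block x 0 0 0 \<in> range (slice T)"
proof
  assume "x \<in> D"
  then obtain \<alpha> where "slice T \<alpha> = block x 0 0 0" by (auto simp: D_def V_def slice_block block_eq_iff)
  then show "block x 0 0 0 \<in> range (slice T)" by (metis rangeI)
next
  assume "block x 0 0 0 \<in> range (slice T)"
  then obtain \<alpha> where "block x 0 0 0 = slice T \<alpha>" by auto
  then show "x \<in> D" by (auto simp: D_def V_def slice_block block_eq_iff)
qed

lemma inj_on_X_V: "inj_on X V"
proof -
  have "\<forall>\<alpha>\<in>V. X \<alpha> = 0 \<longrightarrow> \<alpha> = 0" by (auto simp: V_def intro: parts_inj)
  then show ?thesis using X.inj_on_iff_eq_0[OF subspace_V] by blast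
qed

lemma dim_D: "mspace.dim D = vec.dim V"
proof -
  have "inj_on X (vec.span V)"
    using inj_on_X_V by (simp only: vec.span_eq_iff[THEN iffD2, OF subspace_V])
  then show ?thesis unfolding D_def by (rule vm.dim_image_eq[OF linear_X])
qed

text \<open>
  If all \<open>w \<alpha>\<close> vanished, the last vector of the basis of \<open>B\<^sup>*\<close> would be annihilated by all slices;
  likewise, if all \<open>u \<alpha>\<close> vanished, the last coordinate function on \<open>C\<close> would annihilate all of them.
  Of two elements with \<open>w \<alpha> \<noteq> 0\<close> and \<open>u \<alpha>' \<noteq> 0\<close>, either one of them or their sum has both parts nonzero.
\<close>

lemma exists_nonzero_corner: "\<exists>\<alpha>. w \<alpha> \<noteq> 0 \<and> u \<alpha> \<noteq> 0"
proof -
  have w: "\<exists>\<alpha>. w \<alpha> \<noteq> 0"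
  proof (rule ccontr)
    assume "\<not> ?thesis"
    then have "slice T \<gamma> ** block 0 0 0 1 = 0" for \<gamma>
      by (simp add: slice_block block_mult block_0)
    then have "block 0 0 0 1 = (0 :: complex^('a option)^('a option))"
      using concise unfolding concise_slices by blast
    then show False by (simp add: block_0[symmetric] block_eq_iff)
  qed
  have u: "\<exists>\<alpha>. u \<alpha> \<noteq> 0"
  proof (rule ccontr)
    assume "\<not> ?thesis"
    then have "block 0 0 0 1 ** slice T \<gamma> = 0" for \<gamma>
      by (simp add: slice_block block_mult block_0)
    then have "block 0 0 0 1 = (0 :: complex^('a option)^('a option))"
      using concise unfolding concise_slices by blast
    then show False by (simp add: block_0[symmetric] block_eq_iff)
  qed
  obtain \<alpha> \<alpha>' where a: "w \<alpha> \<noteq> 0" "u \<alpha>' \<noteq> 0" using w u by blast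
  have "(w (\<alpha> + \<alpha>') \<noteq> 0 \<and> u (\<alpha> + \<alpha>') \<noteq> 0) \<or> (w \<alpha> \<noteq> 0 \<and> u \<alpha> \<noteq> 0) \<or> (w \<alpha>' \<noteq> 0 \<and> u \<alpha>' \<noteq> 0)"
    using a by (auto simp: w.add u.add)
  then show ?thesis by blast
qed

lemma dim_D_le: "mspace.dim D \<le> CARD('a)"
proof -
  obtain \<alpha> where "w \<alpha> \<noteq> 0" using exists_nonzero_corner by blast
  then have "V \<subset> UNIV" by (auto simp: V_def)
  then have "vec.dim V < vec.dim (UNIV :: (complex^('a option)) set)"
    using vec.dim_psubset subspace_V vec.subspace_UNIV by (metis vec.span_eq_iff)
  then show ?thesis unfolding dim_D by (simp add: card_cart_basis vec.dimension_def)
qed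

text \<open>
  Comparing blocks in \<open>Z K = K Y\<close>, with \<open>K = diag(Id, 0)\<close> and with an arbitrary slice \<open>K\<close>.
\<close>

lemma lift_cases:
  assumes eq: "\<And>\<alpha>. Z ** slice T \<alpha> = slice T \<alpha> ** Y"
  obtains z w' u' l r where "Z = block z w' 0 r" "Y = block z 0 u' l"
    "\<And>\<alpha>. z ** X \<alpha> + w' ** u \<alpha> = X \<alpha> ** z + w \<alpha> ** u'"
    "\<And>\<alpha>. z ** w \<alpha> = matrix_scale l (w \<alpha>)" "\<And>\<alpha>. u \<alpha> ** z = matrix_scale r (u \<alpha>)"
    "\<And>\<alpha>. Z ** slice T \<alpha> = block (z ** X \<alpha> + w' ** u \<alpha>) (matrix_scale l (w \<alpha>)) (matrix_scale r (u \<alpha>)) 0"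
proof -
  obtain z w' u'' r where Z: "Z = block z w' u'' r" by (rule block_cases)
  obtain y w'' u' l where Y: "Y = block y w'' u' l" by (rule block_cases)
  have "z = y" "u'' = 0" "w'' = 0"
    using eq[of \<alpha>1] unfolding Z Y slice_\<alpha>1 by (simp_all add: block_mult block_eq_iff)
  note Z = Z[unfolded this] and Y = Y[unfolded this]
  have e: "z ** X \<alpha> + w' ** u \<alpha> = X \<alpha> ** z + w \<alpha> ** u' \<and> z ** w \<alpha> = matrix_scale l (w \<alpha>) \<and>
      u \<alpha> ** z = matrix_scale r (u \<alpha>)" for \<alpha>
    using eq[of \<alpha>] \<open>z = y\<close> unfolding Z Y slice_block by (simp add: block_mult block_eq_iff)
  have "Z ** slice T \<alpha> = block (z ** X \<alpha> + w' ** u \<alpha>) (matrix_scale l (w \<alpha>)) (matrix_scale r (u \<alpha>)) 0" for \<alpha>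
    using e[of \<alpha>] \<open>z = y\<close> unfolding Z slice_block by (simp add: block_mult block_eq_iff)
  then show ?thesis using that[of z w' r u' l] e Z Y \<open>z = y\<close> by simp
qed

text \<open>
  For an element of the triple intersection given by \<open>(Y, Z)\<close> this is the common upper left block of
  \<open>Y\<close> and \<open>Z\<close>.
\<close>

definition corner where "corner t = upper_left (slice t \<alpha>1)"

lemma linear_corner: "Vector_Spaces.linear tensor_scale matrix_scale corner"
  by (simp add: Vector_Spaces.linear_iff tspace.vector_space_axioms mspace.vector_space_axioms
      corner_def slice_tensor_add slice_tensor_scale upper_left_def vec_eq_iff)

sublocale corner: Vector_Spaces.linear tensor_scale matrix_scale corner by (rule linear_corner)

lemma dim_triple_intersection:
  "tspace.dim (triple_intersection T) = mspace.dim (corner ` triple_intersection T)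
     + tspace.dim {t \<in> triple_intersection T. corner t = 0}"
  by (rule tm.rank_nullity[OF linear_corner subspace_triple_intersection])

lemma triple_intersection_cases:
  assumes "t \<in> triple_intersection T"
  obtains w' u' l r where
    "\<And>\<alpha>. corner t ** X \<alpha> + w' ** u \<alpha> = X \<alpha> ** corner t + w \<alpha> ** u'"
    "\<And>\<alpha>. corner t ** w \<alpha> = matrix_scale l (w \<alpha>)" "\<And>\<alpha>. u \<alpha> ** corner t = matrix_scale r (u \<alpha>)"
    "\<And>\<alpha>. slice t \<alpha>
       = block (corner t ** X \<alpha> + w' ** u \<alpha>) (matrix_scale l (w \<alpha>)) (matrix_scale r (u \<alpha>)) 0"
    "\<And>\<alpha>. slice t \<alpha> \<in> range (slice T)"
proof -
  obtain Y Z where YZ: "\<And>\<alpha>. slice t \<alpha> = Z ** slice T \<alpha>" "\<And>\<alpha>. slice t \<alpha> = slice T \<alpha> ** Y"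
    "\<And>\<alpha>. slice t \<alpha> \<in> range (slice T)"
    using assms unfolding triple_intersection_slices by blast
  have eq: "Z ** slice T \<alpha> = slice T \<alpha> ** Y" for \<alpha> using YZ by metis
  obtain z w' u' l r where c: "\<And>\<alpha>. z ** X \<alpha> + w' ** u \<alpha> = X \<alpha> ** z + w \<alpha> ** u'"
    "\<And>\<alpha>. z ** w \<alpha> = matrix_scale l (w \<alpha>)" "\<And>\<alpha>. u \<alpha> ** z = matrix_scale r (u \<alpha>)"
    "\<And>\<alpha>. Z ** slice T \<alpha> = block (z ** X \<alpha> + w' ** u \<alpha>) (matrix_scale l (w \<alpha>)) (matrix_scale r (u \<alpha>)) 0"
    using lift_cases[OF eq] by metis
  have "corner t = z" by (simp add: corner_def YZ(1) c(4))
  then show ?thesis using that[of w' u' l r] c YZ by simp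
qed

lemma corner_in_D:
  assumes "t \<in> triple_intersection T"
  shows "corner t \<in> D"
proof -
  obtain w' u' l r where
    "\<And>\<alpha>. slice t \<alpha>
       = block (corner t ** X \<alpha> + w' ** u \<alpha>) (matrix_scale l (w \<alpha>)) (matrix_scale r (u \<alpha>)) 0"
    "\<And>\<alpha>. slice t \<alpha> \<in> range (slice T)"
    using triple_intersection_cases[OF assms] by metis
  from this[of \<alpha>1] show ?thesis unfolding D_iff by simp
qed

lemma subspace_corner_image: "mspace.subspace (corner ` triple_intersection T)"
  by (rule corner.subspace_image[OF subspace_triple_intersection])

text \<open>
  If \<open>z = 0\<close>, then the scalars \<open>l\<close> and \<open>r\<close> vanish because \<open>w \<alpha>m\<close> and \<open>u \<alpha>m\<close> do not, and \<open>w' u = w u'\<close> on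
  the slice of \<open>\<alpha>m\<close> makes \<open>(u', w')\<close> a multiple \<open>c\<close> of \<open>(u \<alpha>m, w \<alpha>m)\<close>.
\<close>

lemma kernel_slices:
  assumes t: "t \<in> triple_intersection T" "corner t = 0" and \<alpha>m: "w \<alpha>m \<noteq> 0" "u \<alpha>m \<noteq> 0"
  obtains c where "\<And>\<alpha>. slice t \<alpha> = block (matrix_scale c (w \<alpha>m ** u \<alpha>)) 0 0 0"
    "\<And>\<alpha>. matrix_scale c (w \<alpha>m ** u \<alpha>) = matrix_scale c (w \<alpha> ** u \<alpha>m)"
    "\<And>\<alpha>. matrix_scale c (w \<alpha>m ** u \<alpha>) \<in> D"
proof -
  obtain w' u' l r where e: "\<And>\<alpha>. corner t ** X \<alpha> + w' ** u \<alpha> = X \<alpha> ** corner t + w \<alpha> ** u'"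
    and l: "\<And>\<alpha>. corner t ** w \<alpha> = matrix_scale l (w \<alpha>)"
    and r: "\<And>\<alpha>. u \<alpha> ** corner t = matrix_scale r (u \<alpha>)"
    and s: "\<And>\<alpha>. slice t \<alpha>
       = block (corner t ** X \<alpha> + w' ** u \<alpha>) (matrix_scale l (w \<alpha>)) (matrix_scale r (u \<alpha>)) 0"
    and R: "\<And>\<alpha>. slice t \<alpha> \<in> range (slice T)"
    using triple_intersection_cases[OF t(1)] by metis
  have "l = 0" "r = 0" using l[of \<alpha>m] r[of \<alpha>m] \<alpha>m t(2) by auto
  have e: "w' ** u \<alpha> = w \<alpha> ** u'" for \<alpha> using e[of \<alpha>] t(2) by simp
  obtain c where c: "w' = matrix_scale c (w \<alpha>m)" "u' = matrix_scale c (u \<alpha>m)"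
    using outer_products_proportional[OF e \<alpha>m(2,1)] by blast
  have s: "slice t \<alpha> = block (matrix_scale c (w \<alpha>m ** u \<alpha>)) 0 0 0" for \<alpha>
    unfolding s \<open>l = 0\<close> \<open>r = 0\<close> t(2) c by (simp add: matrix_algebra)
  show ?thesis
  proof (rule that[of c, OF s])
    show "matrix_scale c (w \<alpha>m ** u \<alpha>) = matrix_scale c (w \<alpha> ** u \<alpha>m)" for \<alpha>
      using e[of \<alpha>] by (simp add: c matrix_algebra)
    show "matrix_scale c (w \<alpha>m ** u \<alpha>) \<in> D" for \<alpha>
      using R[of \<alpha>] unfolding s D_iff .
  qed
qed

text \<open>
  By \<open>kernel_slices\<close> every element of the kernel is a multiple of the tensor \<open>t0\<close> that \<open>T\<close> becomes under
  the endomorphism of \<open>C\<close> with rows \<open>(0, w \<alpha>m)\<close> and \<open>(0, 0)\<close>.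
\<close>

lemma dim_kernel_le: "tspace.dim {t \<in> triple_intersection T. corner t = 0} \<le> 1"
proof -
  obtain \<alpha>m where \<alpha>m: "w \<alpha>m \<noteq> 0" "u \<alpha>m \<noteq> 0" using exists_nonzero_corner by blast
  obtain t0 where t0: "\<And>\<alpha>. contract_A t0 \<alpha> = (Q ** block 0 (w \<alpha>m) 0 0 ** Q') ** contract_A T \<alpha>"
    using left_multiple_tensor by metis
  have t0: "slice t0 \<alpha> = block (w \<alpha>m ** u \<alpha>) 0 0 0" for \<alpha>
  proof -
    have "slice t0 \<alpha> = (Q' ** Q) ** block 0 (w \<alpha>m) 0 0 ** slice T \<alpha>"
      unfolding slice_def t0 by (simp only: matrix_mul_assoc)
    then show ?thesis by (simp add: Q slice_block block_mult)
  qed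
  have "{t \<in> triple_intersection T. corner t = 0} \<subseteq> tspace.span {t0}"
  proof
    fix t assume "t \<in> {t \<in> triple_intersection T. corner t = 0}"
    then have "t \<in> triple_intersection T" "corner t = 0" by auto
    then obtain c where "\<And>\<alpha>. slice t \<alpha> = block (matrix_scale c (w \<alpha>m ** u \<alpha>)) 0 0 0"
      using kernel_slices[OF _ _ \<alpha>m] by metis
    then have "slice t \<alpha> = slice (tensor_scale c t0) \<alpha>" for \<alpha>
      by (simp add: slice_tensor_scale t0 block_scale)
    then have "t = tensor_scale c t0" by (rule slice_eqI)
    then show "t \<in> tspace.span {t0}" by (simp add: tspace.span_base tspace.span_scale)
  qed
  then show ?thesis using tspace.dim_le_card[of _ "{t0}"] by fastforce
qed

lemma corner_image_subset: "corner ` triple_intersection T \<subseteq> D"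
  using corner_in_D by blast

lemma dim_triple_intersection_le: "tspace.dim (triple_intersection T) \<le> CARD('a option)"
  using dim_triple_intersection dim_kernel_le dim_D_le mfin.dim_subset[OF corner_image_subset] by simp

lemma abundant_imp_sharp: "abundant_111 T \<Longrightarrow> sharp_111 T"
  using dim_triple_intersection_le by (simp add: abundant_111_def sharp_111_def)

text \<open>
  The total \<open>dim (corner image) + dim (kernel)\<close> is at least \<open>m\<close>, while the summands are at most
  \<open>dim D \<le> m - 1\<close> and \<open>1\<close>.
\<close>

lemma abundant_dims:
  assumes "abundant_111 T"
  shows "corner ` triple_intersection T = D" "mspace.dim D = CARD('a)"
    "\<exists>t \<in> triple_intersection T. t \<noteq> 0 \<and> corner t = 0"
proof -
  have ge: "mspace.dim (corner ` triple_intersection T)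
     + tspace.dim {t \<in> triple_intersection T. corner t = 0} \<ge> CARD('a) + 1"
    using assms dim_triple_intersection by (simp add: abundant_111_def)
  have le: "mspace.dim (corner ` triple_intersection T) \<le> mspace.dim D"
    by (rule mfin.dim_subset[OF corner_image_subset])
  show "mspace.dim D = CARD('a)" using ge le dim_D_le dim_kernel_le by linarith
  then show "corner ` triple_intersection T = D"
    using ge dim_kernel_le
    by (intro mfin.subspace_dim_equal subspace_corner_image subspace_D corner_image_subset) linarith
  have "tspace.dim {t \<in> triple_intersection T. corner t = 0} \<noteq> 0"
    using ge le dim_D_le by linarith
  then show "\<exists>t \<in> triple_intersection T. t \<noteq> 0 \<and> corner t = 0"
    unfolding tfin.dim_eq_0 by auto
qed

lemma sharpI:
  assumes "mspace.dim (corner ` triple_intersection T) \<ge> CARD('a)"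
    and "\<exists>t \<in> triple_intersection T. t \<noteq> 0 \<and> corner t = 0"
  shows "sharp_111 T"
proof -
  have "tspace.dim {t \<in> triple_intersection T. corner t = 0} \<noteq> 0"
    unfolding tfin.dim_eq_0 using assms(2) by auto
  moreover have "CARD('a option) = CARD('a) + 1" by simp
  ultimately show ?thesis
    unfolding sharp_111_def
    using assms(1) dim_triple_intersection dim_triple_intersection_le by linarith
qed

end

section \<open>Consequences of abundance\<close>

locale abundant_frame = block_frame +
  fixes \<alpha>m
  assumes abundant: "abundant_111 T" and \<alpha>m: "w \<alpha>m \<noteq> 0" "u \<alpha>m \<noteq> 0"
    and orthogonal: "u \<alpha> ** matrix_power (X \<alpha>) j ** w \<alpha> = 0"
begin

text \<open>
  A nonzero element of the kernel of \<open>corner\<close> has \<open>c \<noteq> 0\<close> in \<open>kernel_slices\<close>,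
  since otherwise all its slices would vanish.  So \<open>c\<close> can be cancelled.
\<close>

lemma outer_products: "w \<alpha>m ** u \<alpha> = w \<alpha> ** u \<alpha>m" "w \<alpha>m ** u \<alpha>m \<in> D"
proof -
  obtain t where t: "t \<in> triple_intersection T" "t \<noteq> 0" "corner t = 0"
    using abundant_dims(3)[OF abundant] by blast
  obtain c where c: "\<And>\<alpha>. slice t \<alpha> = block (matrix_scale c (w \<alpha>m ** u \<alpha>)) 0 0 0"
    "\<And>\<alpha>. matrix_scale c (w \<alpha>m ** u \<alpha>) = matrix_scale c (w \<alpha> ** u \<alpha>m)"
    "\<And>\<alpha>. matrix_scale c (w \<alpha>m ** u \<alpha>) \<in> D"
    using kernel_slices[OF t(1,3) \<alpha>m] by metis
  have "c \<noteq> 0"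
  proof
    assume "c = 0"
    then have "slice t \<alpha> = slice (tensor_scale 0 T) \<alpha>" for \<alpha>
      unfolding c(1) slice_tensor_scale by (simp add: \<open>c = 0\<close> block_0)
    then have "t = tensor_scale 0 T" by (rule slice_eqI)
    then show False using t(2) by simp
  qed
  then show "w \<alpha>m ** u \<alpha> = w \<alpha> ** u \<alpha>m" using c(2)[of \<alpha>] by simp
  have "matrix_scale (1 / c) (matrix_scale c (w \<alpha>m ** u \<alpha>m)) \<in> D"
    by (intro mspace.subspace_scale subspace_D c(3))
  then show "w \<alpha>m ** u \<alpha>m \<in> D" using \<open>c \<noteq> 0\<close> by simp
qed

lemma corner_parts_proportional:
  obtains c where "w \<alpha> = matrix_scale c (w \<alpha>m)" "u \<alpha> = matrix_scale c (u \<alpha>m)"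
  using outer_products_proportional[OF outer_products(1)[symmetric] \<alpha>m(2,1)] .

text \<open>
  Since \<open>corner\<close> maps onto \<open>D\<close>, the element \<open>z\<close> is the common block of some \<open>(Y, Z)\<close>.  The two scalars
  \<open>l\<close> and \<open>r\<close> of this pair agree: \<open>Z K\<^sub>m\<close> is again a slice, and its corner parts \<open>l w\<^sub>m\<close> and \<open>r u\<^sub>m\<close> are
  proportional to \<open>w\<^sub>m\<close> and \<open>u\<^sub>m\<close> with one and the same factor.
\<close>

lemma D_lift:
  assumes "z \<in> D"
  obtains l w' u' where "z ** w \<alpha>m = matrix_scale l (w \<alpha>m)" "u \<alpha>m ** z = matrix_scale l (u \<alpha>m)"
    "z ** X \<alpha>m + w' ** u \<alpha>m = X \<alpha>m ** z + w \<alpha>m ** u'"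
    "l = 0 \<Longrightarrow> z ** X \<alpha>m + w' ** u \<alpha>m \<in> D"
    "\<And>x. x \<in> D \<Longrightarrow> z ** x = x ** z \<and> z ** x \<in> D"
proof -
  obtain t where t: "t \<in> triple_intersection T" "corner t = z"
    using assms unfolding abundant_dims(1)[OF abundant, symmetric] by blast
  obtain w' u' l r where e: "\<And>\<alpha>. z ** X \<alpha> + w' ** u \<alpha> = X \<alpha> ** z + w \<alpha> ** u'"
    and l: "\<And>\<alpha>. z ** w \<alpha> = matrix_scale l (w \<alpha>)"
    and r: "\<And>\<alpha>. u \<alpha> ** z = matrix_scale r (u \<alpha>)"
    and s: "\<And>\<alpha>. slice t \<alpha>
       = block (z ** X \<alpha> + w' ** u \<alpha>) (matrix_scale l (w \<alpha>)) (matrix_scale r (u \<alpha>)) 0"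
    and R: "\<And>\<alpha>. slice t \<alpha> \<in> range (slice T)"
    using triple_intersection_cases[OF t(1), unfolded t(2)] by metis
  obtain \<alpha> where "slice t \<alpha>m = slice T \<alpha>" using R[of \<alpha>m] by auto
  then have \<alpha>: "matrix_scale l (w \<alpha>m) = w \<alpha>" "matrix_scale r (u \<alpha>m) = u \<alpha>"
    unfolding s slice_block by (simp_all add: block_eq_iff)
  obtain c where "w \<alpha> = matrix_scale c (w \<alpha>m)" "u \<alpha> = matrix_scale c (u \<alpha>m)"
    by (rule corner_parts_proportional)
  then have "r = l" using \<alpha> \<alpha>m by simp
  show ?thesis
  proof (rule that[of l w' u', OF l r[unfolded \<open>r = l\<close>] e])
    show "z ** X \<alpha>m + w' ** u \<alpha>m \<in> D" if "l = 0"
      using R[of \<alpha>m] that unfolding s D_iff \<open>r = l\<close> by simp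
    show "z ** x = x ** z \<and> z ** x \<in> D" if "x \<in> D" for x
    proof -
      obtain \<alpha> where "x = X \<alpha>" "w \<alpha> = 0" "u \<alpha> = 0" using \<open>x \<in> D\<close> by (auto simp: D_def V_def)
      then show ?thesis using e[of \<alpha>] R[of \<alpha>] unfolding s D_iff by simp
    qed
  qed
qed

text \<open>
  Its image under \<open>X\<close> becomes the span of \<open>x\<^sub>2, \<dots>, x\<^sub>m\<^sub>-\<^sub>1\<close> in the normal form.
\<close>

definition V0 where "V0 = {\<alpha> \<in> V. X \<alpha> ** w \<alpha>m = 0}"

lemma subspace_V0: "vec.subspace V0"
  using subspace_V unfolding V0_def vec.subspace_def by (auto simp: X.add X.scale matrix_algebra)

text \<open>
  Subtracting from an element of \<open>V\<close> the multiple of \<open>\<alpha>1\<close> given by the eigenvalue of its block on \<open>w\<^sub>m\<close>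
  leads into \<open>V0\<close>, and by \<open>corner_parts_proportional\<close> subtracting a multiple of \<open>\<alpha>m\<close> leads from anywhere
  into \<open>V\<close>.  So a basis of \<open>V0\<close> together with \<open>\<alpha>1\<close> and \<open>\<alpha>m\<close> is a basis of \<open>A\<^sup>*\<close>.
\<close>

lemma adapted_basis:
  assumes m: "m = CARD('a option)"
  obtains \<alpha> where "basis_family {1..m} \<alpha>" "\<alpha> 1 = \<alpha>1" "\<alpha> m = \<alpha>m" "V = vec.span (\<alpha> ` {1..m-1})"
    "V0 = vec.span (\<alpha> ` {2..m-1})"
proof -
  obtain B where B: "B \<subseteq> V0" "vec.independent B" "V0 \<subseteq> vec.span B" "card B = vec.dim V0"
    using vec.basis_exists by blast
  have spanB: "vec.span B = V0" using vec.span_subspace[OF B(1,3) subspace_V0] .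
  have 1: "\<alpha>1 \<notin> V0" using \<alpha>m by (simp add: V0_def)
  have spanV: "vec.span (insert \<alpha>1 B) = V"
  proof
    show "vec.span (insert \<alpha>1 B) \<subseteq> V"
      using B(1) \<alpha>1_V by (intro vec.span_minimal subspace_V) (auto simp: V0_def)
    show "V \<subseteq> vec.span (insert \<alpha>1 B)"
    proof
      fix \<alpha> assume \<alpha>: "\<alpha> \<in> V"
      then have "X \<alpha> \<in> D" by (simp add: D_def)
      then obtain l where "X \<alpha> ** w \<alpha>m = matrix_scale l (w \<alpha>m)" using D_lift by metis
      then have "\<alpha> - l *s \<alpha>1 \<in> V0"
        using \<alpha> \<alpha>1_V subspace_V
        by (auto simp: V0_def X.diff X.scale matrix_algebra vec.subspace_diff vec.subspace_scale)
      then show "\<alpha> \<in> vec.span (insert \<alpha>1 B)"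
        unfolding spanB[symmetric] by (auto simp: vec.in_span_insert vec.span_breakdown_eq)
    qed
  qed
  have \<alpha>mV: "\<alpha>m \<notin> V" using \<alpha>m by (simp add: V_def)
  have spanU: "vec.span (insert \<alpha>m (insert \<alpha>1 B)) = UNIV"
  proof -
    have "\<alpha> \<in> vec.span (insert \<alpha>m (insert \<alpha>1 B))" for \<alpha>
    proof -
      obtain c where "w \<alpha> = matrix_scale c (w \<alpha>m)" "u \<alpha> = matrix_scale c (u \<alpha>m)"
        by (rule corner_parts_proportional)
      then have "\<alpha> - c *s \<alpha>m \<in> V" by (simp add: V_def w.diff w.scale u.diff u.scale)
      then show ?thesis unfolding spanV[symmetric] by (auto simp: vec.span_breakdown_eq[of _ \<alpha>m])
    qed
    then show ?thesis by blast
  qed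
  have ind: "vec.independent (insert \<alpha>m (insert \<alpha>1 B))"
    using 1 \<alpha>mV B(2) spanB spanV by (simp add: vec.independent_insertI)
  have fin: "finite B" using vec.finiteI_independent[OF B(2)] .
  have nin: "\<alpha>1 \<notin> B" "\<alpha>m \<notin> insert \<alpha>1 B"
    using 1 \<alpha>mV vec.span_superset[of B] vec.span_superset[of "insert \<alpha>1 B"] spanB spanV by auto
  have "card (insert \<alpha>m (insert \<alpha>1 B)) = vec.dim (UNIV :: (complex^('a option)) set)"
    using vec.dim_span_eq_card_independent[OF ind] spanU by simp
  also have "\<dots> = m" by (simp add: m card_cart_basis vec.dimension_def)
  finally have "card B + 2 = m" using fin nin by simp
  then have cB: "card B = card {2..m-1}" and m2: "m \<ge> 2" by auto
  obtain h where h: "bij_betw h {2..m-1} B"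
    using finite_same_card_bij[OF _ fin] cB by (metis finite_atLeastAtMost)
  define \<alpha> where "\<alpha> s = (if s = 1 then \<alpha>1 else if s = m then \<alpha>m else h s)" for s
  have \<alpha>2: "\<alpha> ` {2..m-1} = B"
  proof -
    have "\<alpha> ` {2..m-1} = h ` {2..m-1}" by (rule image_cong) (auto simp: \<alpha>_def)
    then show ?thesis using h by (simp add: bij_betw_def)
  qed
  have i1: "{1..m-1} = insert 1 {2..m-1}" and im: "{1..m} = insert m {1..m-1}" using m2 by auto
  have \<alpha>3: "\<alpha> ` {1..m-1} = insert \<alpha>1 B" unfolding i1 image_insert \<alpha>2 by (simp add: \<alpha>_def)
  have \<alpha>4: "\<alpha> ` {1..m} = insert \<alpha>m (insert \<alpha>1 B)"
    unfolding im image_insert \<alpha>3 using m2 by (simp add: \<alpha>_def)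
  have "basis_family {1..m} \<alpha>"
    by (rule basis_family_if_spanning) (simp, simp add: m, simp only: \<alpha>4 spanU)
  moreover have "\<alpha> 1 = \<alpha>1" "\<alpha> m = \<alpha>m" using m2 by (simp_all add: \<alpha>_def)
  ultimately show ?thesis using that[of \<alpha>] \<alpha>2 \<alpha>3 spanB spanV by simp
qed

end

section \<open>The structural conditions\<close>

text \<open>
  The difference of two solutions satisfies \<open>(ws' - ws) u = w (us' - us)\<close>.  Adding a multiple of
  \<open>(u, w)\<close> changes both sides by a multiple of \<open>w u\<close>, which lies in the required span by condition (3).
\<close>

lemma cond5_solutions:
  assumes u: "u \<noteq> 0" and w: "w \<noteq> 0" and c3: "cond3 m x u w" and e: "cond5_eq m x u w s us ws"
  shows "cond5_eq m x u w s us' ws' \<longleftrightarrow>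
    (\<exists>z. us' = us + matrix_scale z u \<and> ws' = ws + matrix_scale z w)"
proof
  assume "cond5_eq m x u w s us' ws'"
  then have "x s ** x m + ws' ** u - (x s ** x m + ws ** u)
      = x m ** x s + w ** us' - (x m ** x s + w ** us)"
    using e by (simp only: cond5_eq_def)
  then have "(ws' - ws) ** u = w ** (us' - us)" by (simp add: matrix_algebra)
  then obtain z where "ws' - ws = matrix_scale z w" "us' - us = matrix_scale z u"
    using outer_products_proportional u w by blast
  then show "\<exists>z. us' = us + matrix_scale z u \<and> ws' = ws + matrix_scale z w"
    by (intro exI[of _ z]) (simp add: algebra_simps)
next
  assume "\<exists>z. us' = us + matrix_scale z u \<and> ws' = ws + matrix_scale z w"
  then obtain z where z: "us' = us + matrix_scale z u" "ws' = ws + matrix_scale z w" by blast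
  have 1: "x m ** x s + w ** us' = (x m ** x s + w ** us) + matrix_scale z (w ** u)"
    by (simp add: z matrix_algebra)
  have 2: "x s ** x m + ws' ** u = (x s ** x m + ws ** u) + matrix_scale z (w ** u)"
    by (simp add: z matrix_algebra)
  have "matrix_scale z (w ** u) \<in> mspace.span (x ` {2..m-1})"
    using c3 by (simp add: cond3_def mspace.span_scale)
  then show "cond5_eq m x u w s us' ws'"
    using e unfolding cond5_eq_def 1 2 by (simp add: mspace.span_add)
qed

lemma cond5I:
  assumes "u \<noteq> 0" "w \<noteq> 0" "cond3 m x u w"
    and "\<And>s. s \<in> {2..m-1} \<Longrightarrow> \<exists>us ws. cond5_eq m x u w s us ws"
  shows "cond5 m x u w"
  unfolding cond5_def using assms(4) cond5_solutions[OF assms(1-3)] by metis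

lemma cond1_last:
  assumes "cond1 m x u w" "m \<ge> 1"
  shows "u ** matrix_power (x m) j ** w = 0"
  using assms mspace.span_base[of "x m" "x ` {1..m}"] by (auto simp: cond1_def)

lemma cond6I:
  assumes m: "m \<ge> 1" and c1: "cond1 m x u w" and c4: "cond4 m x u w" and c5: "cond5 m x u w"
  shows "cond6 m x u w"
  unfolding cond6_def
proof (intro allI impI ballI)
  fix j :: nat and s assume s: "s \<in> {2..m-1}"
  obtain us ws where "cond5_eq m x u w s us ws" using c5 s unfolding cond5_def by blast
  then have e: "x s ** x m + ws ** u = x m ** x s + w ** us" by (simp add: cond5_eq_def)
  show "x s ** matrix_power (x m) j ** w = 0 \<and> u ** matrix_power (x m) j ** x s = 0"
    using commutator_kills_cyclic_space(1)[OF e _ cond1_last[OF c1 m]]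
      commutator_kills_cyclic_space_left[OF e _ cond1_last[OF c1 m]] c4 s
    by (simp add: cond4_def)
qed

context abundant_frame
begin

text \<open>
  With respect to an adapted basis, \<open>D\<close> is the span of \<open>x\<^sub>1, \<dots>, x\<^sub>m\<^sub>-\<^sub>1\<close>, and the span of
  \<open>x\<^sub>2, \<dots>, x\<^sub>m\<^sub>-\<^sub>1\<close> consists of the elements of \<open>D\<close> that annihilate \<open>w\<^sub>m\<close>.
\<close>

lemma adapted_conditions:
  assumes m: "m = CARD('a option)" and \<alpha>1: "\<alpha> 1 = \<alpha>1" and \<alpha>m_eq: "\<alpha> m = \<alpha>m"
    and V: "V = vec.span (\<alpha> ` {1..m-1})" and V0: "V0 = vec.span (\<alpha> ` {2..m-1})"
  defines "x \<equiv> \<lambda>s. X (\<alpha> s)"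
  shows "cond2 m x" "cond3 m x (u \<alpha>m) (w \<alpha>m)" "cond4 m x (u \<alpha>m) (w \<alpha>m)" "cond5 m x (u \<alpha>m) (w \<alpha>m)"
proof -
  have im: "x ` S = X ` \<alpha> ` S" for S by (auto simp: x_def)
  have D: "mspace.span (x ` {1..m-1}) = D" unfolding im X.span_image D_def V ..
  have D0: "mspace.span (x ` {2..m-1}) = {z \<in> D. z ** w \<alpha>m = 0}"
    unfolding im X.span_image V0[symmetric] by (auto simp: D_def V0_def)
  have xm: "x m = X \<alpha>m" by (simp add: x_def \<alpha>m_eq)
  have uw: "u \<alpha>m ** w \<alpha>m = 0" using orthogonal[of \<alpha>m 0] by simp
  have c4: "z ** w \<alpha>m = 0 \<and> u \<alpha>m ** z = 0" if "z \<in> mspace.span (x ` {2..m-1})" for z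
  proof -
    have z: "z \<in> D" "z ** w \<alpha>m = 0" using that unfolding D0 by auto
    obtain l where "z ** w \<alpha>m = matrix_scale l (w \<alpha>m)" "u \<alpha>m ** z = matrix_scale l (u \<alpha>m)"
      using D_lift[OF z(1)] by metis
    then show ?thesis using z(2) \<alpha>m by auto
  qed
  have xs: "x s \<in> mspace.span (x ` {2..m-1})" if "s \<in> {2..m-1}" for s
    using that by (intro mspace.span_base) auto
  show "cond2 m x"
    unfolding cond2_def D
  proof (intro conjI ballI)
    show "mspace.dim D = m - 1" using abundant_dims(2)[OF abundant] m by simp
  next
    fix y z assume y: "y \<in> D" and z: "z \<in> D"
    obtain l w' u' where "\<And>x. x \<in> D \<Longrightarrow> y ** x = x ** y \<and> y ** x \<in> D"
      using D_lift[OF y] by metis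
    then show "y ** z = z ** y" "y ** z \<in> D" using z by blast+
  qed
  have "w \<alpha>m ** u \<alpha>m ** w \<alpha>m = 0" using uw by (simp flip: matrix_mul_assoc)
  then show c3: "cond3 m x (u \<alpha>m) (w \<alpha>m)"
    unfolding cond3_def D0 using outer_products(2) by simp
  show "cond4 m x (u \<alpha>m) (w \<alpha>m)" unfolding cond4_def using c4 xs by blast
  show "cond5 m x (u \<alpha>m) (w \<alpha>m)"
  proof (rule cond5I[OF \<alpha>m(2,1) c3])
    fix s assume s: "s \<in> {2..m-1}"
    have x0: "x s ** w \<alpha>m = 0" using c4 xs[OF s] by blast
    have "x s \<in> D" using xs[OF s] unfolding D0 by simp
    then obtain l w' u' where l: "x s ** w \<alpha>m = matrix_scale l (w \<alpha>m)"
      and e: "x s ** x m + w' ** u \<alpha>m = x m ** x s + w \<alpha>m ** u'"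
      and mem: "l = 0 \<Longrightarrow> x s ** x m + w' ** u \<alpha>m \<in> D"
      unfolding xm using D_lift by metis
    have "l = 0" using l x0 \<alpha>m by simp
    have orth: "u \<alpha>m ** matrix_power (x m) j ** w \<alpha>m = 0" for j
      unfolding xm by (rule orthogonal)
    (* D_lift only places the two sides of (5) in D; they annihilate w \<alpha>m by the case j = 1 of (6). *)
    have "x s ** x m ** w \<alpha>m = 0"
      using commutator_kills_cyclic_space(1)[OF e x0 orth, of 1] by simp
    then have "(x s ** x m + w' ** u \<alpha>m) ** w \<alpha>m = 0"
      using uw by (simp add: matrix_mult_add_left flip: matrix_mul_assoc)
    then have "x s ** x m + w' ** u \<alpha>m \<in> mspace.span (x ` {2..m-1})"
      unfolding D0 using mem[OF \<open>l = 0\<close>] by simp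
    then show "\<exists>us ws. cond5_eq m x (u \<alpha>m) (w \<alpha>m) s us ws"
      unfolding cond5_eq_def using e by auto
  qed
qed

end

section \<open>Tensors in normal form\<close>

definition pairing :: "complex^'m \<Rightarrow> complex^'m \<Rightarrow> complex" where
  "pairing \<gamma> v = (\<Sum>i\<in>UNIV. \<gamma> $ i * v $ i)"

text \<open>
  What the normal form says about the slices of \<open>T\<close> as functions on \<open>A\<^sup>*\<close>.  The conditions (1)-(5) are
  evaluated in this form only, so the matrices \<open>K\<^sub>s\<close> and the bases of \<open>B\<^sup>*\<close> and \<open>C\<close> are left behind.
\<close>

locale normal_frame = frame +
  fixes m :: nat and a :: "nat \<Rightarrow> complex^('a option)" and x :: "nat \<Rightarrow> complex^'a^'a"
    and u :: "complex^'a^1" and w :: "complex^1^'a"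
  assumes m: "m = CARD('a option)" and a: "basis_family {1..m} a"
    and x1: "x 1 = mat 1" and u: "u \<noteq> 0" and w: "w \<noteq> 0"
    and slice_pairing: "slice T \<gamma> = block (\<Sum>s\<in>{1..m}. matrix_scale (pairing \<gamma> (a s)) (x s))
      (matrix_scale (pairing \<gamma> (a m)) w) (matrix_scale (pairing \<gamma> (a m)) u) 0"
begin

lemma m_ge: "m \<ge> 2"
proof -
  have "CARD('a) > 0" by simp
  then show ?thesis using m by simp
qed

lemma cardI: "card {1..m} = CARD('a option)"
  by (simp add: m)

lemma pairing_prescribed:
  obtains \<gamma> where "\<And>s. s \<in> {1..m} \<Longrightarrow> pairing \<gamma> (a s) = d s"
proof -
  obtain \<alpha> where \<alpha>: "\<And>r s. r \<in> {1..m} \<Longrightarrow> s \<in> {1..m} \<Longrightarrow>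
      (\<Sum>i\<in>UNIV. \<alpha> r $ i * a s $ i) = (if r = s then 1 else 0)"
    using dual_basis[OF finite_atLeastAtMost cardI a] by blast
  define \<gamma> where "\<gamma> = (\<Sum>r\<in>{1..m}. d r *s \<alpha> r)"
  have "pairing \<gamma> (a s) = d s" if s: "s \<in> {1..m}" for s
  proof -
    have "pairing \<gamma> (a s) = (\<Sum>i\<in>UNIV. \<Sum>r\<in>{1..m}. d r * (\<alpha> r $ i * a s $ i))"
      by (simp add: pairing_def \<gamma>_def sum_distrib_right mult.assoc)
    also have "\<dots> = (\<Sum>r\<in>{1..m}. d r * (\<Sum>i\<in>UNIV. \<alpha> r $ i * a s $ i))"
      by (subst sum.swap) (simp add: sum_distrib_left)
    also have "\<dots> = (\<Sum>r\<in>{1..m}. if r = s then d s else 0)"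
      by (rule sum.cong) (use \<alpha> s in auto)
    finally show ?thesis using s by simp
  qed
  then show ?thesis using that by blast
qed

lemma pairing_eq_0:
  assumes "\<And>s. s \<in> {1..m} \<Longrightarrow> pairing \<gamma> (a s) = 0"
  shows "\<gamma> = 0"
proof -
  obtain \<alpha> where \<alpha>: "\<And>i j. (\<Sum>s\<in>{1..m}. a s $ i * \<alpha> s $ j) = (if i = j then 1 else 0)"
    using dual_basis[OF finite_atLeastAtMost cardI a] by blast
  have "\<gamma> = (\<Sum>s\<in>{1..m}. pairing \<gamma> (a s) *s \<alpha> s)"
    unfolding pairing_def by (rule dual_basis_expansion[OF \<alpha>])
  then show ?thesis using assms by simp
qed

lemma sum_split: "(\<Sum>s\<in>{1..m}. f s) = f m + (\<Sum>s\<in>{1..m-1}. f s)" for f :: "nat \<Rightarrow> complex^'a^'a"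
proof -
  have "{1..m} = insert m {1..m-1}" using m_ge by auto
  then show ?thesis using m_ge by simp
qed

lemma sum_split_first: "(\<Sum>s\<in>{1..m-1}. f s) = f 1 + (\<Sum>s\<in>{2..m-1}. f s)" for f :: "nat \<Rightarrow> complex^'a^'a"
proof -
  have "{1..m-1} = insert 1 {2..m-1}" using m_ge by auto
  then show ?thesis by simp
qed

lemma slice_split: "slice T \<gamma> = block (matrix_scale (pairing \<gamma> (a m)) (x m) +
      (\<Sum>s\<in>{1..m-1}. matrix_scale (pairing \<gamma> (a s)) (x s)))
      (matrix_scale (pairing \<gamma> (a m)) w) (matrix_scale (pairing \<gamma> (a m)) u) 0"
  unfolding slice_pairing sum_split ..

lemma slice_prescribed:
  obtains \<gamma> where "slice T \<gamma> = block (matrix_scale c (x m) + (\<Sum>s\<in>{1..m-1}. matrix_scale (d s) (x s)))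
      (matrix_scale c w) (matrix_scale c u) 0"
proof -
  obtain \<gamma> where \<gamma>: "\<And>s. s \<in> {1..m} \<Longrightarrow> pairing \<gamma> (a s) = (if s = m then c else d s)"
    using pairing_prescribed[of "\<lambda>s. if s = m then c else d s"] by blast
  have "(\<Sum>s\<in>{1..m-1}. matrix_scale (pairing \<gamma> (a s)) (x s)) = (\<Sum>s\<in>{1..m-1}. matrix_scale (d s) (x s))"
    by (rule sum.cong) (use m_ge in \<open>auto simp: \<gamma>\<close>)
  moreover have "pairing \<gamma> (a m) = c" using m_ge by (simp add: \<gamma>)
  ultimately have "slice T \<gamma> = block (matrix_scale c (x m) + (\<Sum>s\<in>{1..m-1}. matrix_scale (d s) (x s)))
      (matrix_scale c w) (matrix_scale c u) 0" unfolding slice_split by simp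
  then show ?thesis using that by blast
qed

lemma span_block_in_range:
  assumes "y \<in> mspace.span (x ` {1..m-1})"
  shows "block y 0 0 0 \<in> range (slice T)"
proof -
  obtain d where y: "y = (\<Sum>s\<in>{1..m-1}. matrix_scale (d s) (x s))"
    using assms by (auto simp: mspace_span_image_finite)
  obtain \<gamma> where "slice T \<gamma> = block (matrix_scale 0 (x m) + (\<Sum>s\<in>{1..m-1}. matrix_scale (d s) (x s)))
      (matrix_scale 0 w) (matrix_scale 0 u) 0" by (rule slice_prescribed)
  then have "block y 0 0 0 = slice T \<gamma>" by (simp add: y)
  then show ?thesis by simp
qed

lemma slice_first: obtains \<gamma>1 where "slice T \<gamma>1 = block (mat 1) 0 0 0"
proof -
  have "mat 1 \<in> mspace.span (x ` {1..m-1})"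
    using m_ge x1 by (metis (no_types, lifting) atLeastAtMost_iff diff_le_mono imageI le_refl
        mspace.span_base one_add_one add_diff_cancel_right')
  then have "block (mat 1) 0 0 0 \<in> range (slice T)" by (rule span_block_in_range)
  then show ?thesis using that by (metis imageE)
qed

lemma slice_last: obtains \<gamma> where "slice T \<gamma> = block (x m) w u 0"
  using slice_prescribed[of 1 "\<lambda>_. 0"] by auto

text \<open>
  Let \<open>X\<close> have coefficient \<open>d m\<close> at \<open>x\<^sub>m\<close>.  If \<open>d m \<noteq> 0\<close>, then \<open>X\<close> is the upper left block of a slice with
  corner parts \<open>d m w\<close> and \<open>d m u\<close>, to which \<open>not_generic_imp_orthogonal\<close> applies.  If \<open>d m = 0\<close>, then
  \<open>w\<close> is an eigenvector of \<open>X\<close> by condition (4), so that the claim reduces to \<open>u w = 0\<close>.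
\<close>

lemma cond1I:
  assumes ng: "\<not> one_A_generic T" and c4: "cond4 m x u w"
  shows "cond1 m x u w"
proof -
  obtain \<gamma>1 where 1: "slice T \<gamma>1 = block (mat 1) 0 0 0" by (rule slice_first)
  have uw: "u ** w = 0"
  proof -
    obtain \<gamma> where "slice T \<gamma> = block (x m) w u 0" by (rule slice_last)
    from not_generic_imp_orthogonal(2)[OF ng 1 this, of 0] show ?thesis by simp
  qed
  have "u ** matrix_power X j ** w = 0" if X: "X \<in> mspace.span (x ` {1..m})" for X j
  proof -
    obtain d where Xd: "X = (\<Sum>s\<in>{1..m}. matrix_scale (d s) (x s))"
      using X by (auto simp: mspace_span_image_finite)
    show ?thesis
    proof (cases "d m = 0")
      case False
      obtain \<gamma> where "slice T \<gamma> = block (matrix_scale (d m) (x m) + (\<Sum>s\<in>{1..m-1}. matrix_scale (d s) (x s)))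
          (matrix_scale (d m) w) (matrix_scale (d m) u) 0" by (rule slice_prescribed)
      then have "slice T \<gamma> = block X (matrix_scale (d m) w) (matrix_scale (d m) u) 0"
        unfolding Xd sum_split .
      from not_generic_imp_orthogonal(2)[OF ng 1 this, of j] False
      show ?thesis by (simp add: matrix_algebra)
    next
      case True
      have "X ** w = matrix_scale (d 1) w + (\<Sum>s\<in>{2..m-1}. matrix_scale (d s) (x s)) ** w"
        unfolding Xd sum_split sum_split_first using True x1 by (simp add: matrix_algebra)
      also have "(\<Sum>s\<in>{2..m-1}. matrix_scale (d s) (x s)) ** w
          = (\<Sum>s\<in>{2..m-1}. matrix_scale (d s) (x s) ** w)"
        by (rule matrix_mult_sum_left)
      also have "\<dots> = 0"
        using c4 by (intro sum.neutral) (auto simp: matrix_algebra cond4_def)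
      finally have Xw: "X ** w = matrix_scale (d 1) w" by simp
      have "matrix_power X j ** w = matrix_scale (d 1 ^ j) w"
        by (induction j) (simp_all add: Xw matrix_algebra mult.commute flip: matrix_mul_assoc)
      then show ?thesis using uw by (simp add: matrix_algebra flip: matrix_mul_assoc)
    qed
  qed
  then show ?thesis unfolding cond1_def using uw by blast
qed

lemma cond1_imp_not_generic:
  assumes "cond1 m x u w"
  shows "\<not> one_A_generic T"
  unfolding one_A_generic_slices
proof
  fix \<gamma>
  let ?X = "\<Sum>s\<in>{1..m}. matrix_scale (pairing \<gamma> (a s)) (x s)"
  have "?X \<in> mspace.span (x ` {1..m})"
    by (intro mspace.span_sum mspace.span_scale mspace.span_base) auto
  then have "u ** matrix_power ?X j ** w = 0" for j using assms by (auto simp: cond1_def)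
  then show "\<exists>V::complex^1^('a option). V \<noteq> 0 \<and> slice T \<gamma> ** V = 0"
    unfolding slice_pairing by (intro block_singular) (simp add: matrix_algebra)
qed

text \<open>
  The slices depend injectively on \<open>A\<^sup>*\<close> because \<open>w \<noteq> 0\<close> and \<open>x\<^sub>1, \<dots>, x\<^sub>m\<^sub>-\<^sub>1\<close> are independent.  A matrix
  annihilated by \<open>diag(Id, 0)\<close> from the left or from the right has only its last row, respectively
  column, and then \<open>K\<^sub>m\<close> kills the rest since \<open>w \<noteq> 0\<close> and \<open>u \<noteq> 0\<close>.
\<close>

lemma conciseI:
  assumes c2: "cond2 m x"
  shows "concise T"
  unfolding concise_slices
proof (intro conjI allI impI)
  fix \<gamma> assume "slice T \<gamma> = 0"
  then have "matrix_scale (pairing \<gamma> (a m)) w = 0"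
    and s: "matrix_scale (pairing \<gamma> (a m)) (x m)
      + (\<Sum>s\<in>{1..m-1}. matrix_scale (pairing \<gamma> (a s)) (x s)) = 0"
    unfolding slice_split block_0[symmetric] by (simp_all add: block_eq_iff)
  then have pm: "pairing \<gamma> (a m) = 0" using w by simp
  have d: "mspace.dim (x ` {1..m-1}) = m - 1" using c2 by (simp add: cond2_def)
  have "mspace.dim (x ` {1..m-1}) \<le> card (x ` {1..m-1})"
    by (rule mspace.dim_le_card) (auto intro: mspace.span_base)
  then have card: "card (x ` {1..m-1}) = m - 1" using card_image_le[of "{1..m-1}" x] d by simp
  then have inj: "inj_on x {1..m-1}" by (intro eq_card_imp_inj_on) auto
  have ind: "mspace.independent (x ` {1..m-1})"
    by (rule mfin.card_le_dim_spanning[of _ "mspace.span (x ` {1..m-1})"])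
      (use d card in \<open>auto intro: mspace.span_base\<close>)
  define g where "g y = pairing \<gamma> (a (inv_into {1..m-1} x y))" for y
  have gx: "g (x s) = pairing \<gamma> (a s)" if "s \<in> {1..m-1}" for s
    unfolding g_def using inv_into_f_f[OF inj that] by simp
  have "(\<Sum>y\<in>x ` {1..m-1}. matrix_scale (g y) y) = (\<Sum>s\<in>{1..m-1}. matrix_scale (pairing \<gamma> (a s)) (x s))"
    unfolding sum.reindex[OF inj] o_def by (rule sum.cong) (simp_all only: gx)
  then have "(\<Sum>y\<in>x ` {1..m-1}. matrix_scale (g y) y) = 0" using s pm by simp
  then have g0: "g y = 0" if "y \<in> x ` {1..m-1}" for y
    using mspace.independentD[OF ind] that by blast
  then have p: "pairing \<gamma> (a s) = 0" if "s \<in> {1..m-1}" for s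
    using gx[OF that] g0[OF imageI[OF that]] by simp
  show "\<gamma> = 0"
  proof (rule pairing_eq_0)
    fix s assume "s \<in> {1..m}"
    then show "pairing \<gamma> (a s) = 0" using p[of s] pm by (cases "s = m") auto
  qed
next
  fix Y :: "complex^('a option)^('a option)" assume Y: "\<forall>\<gamma>. slice T \<gamma> ** Y = 0"
  obtain y y' y'' z where yy: "Y = block y y' y'' z" by (rule block_cases)
  obtain \<gamma>1 where 1: "slice T \<gamma>1 = block (mat 1) 0 0 0" by (rule slice_first)
  obtain \<gamma>2 where 2: "slice T \<gamma>2 = block (x m) w u 0" by (rule slice_last)
  have y0: "y = 0" "y' = 0"
    using Y[rule_format, of \<gamma>1] unfolding 1 yy block_0[symmetric]
    by (simp_all add: block_mult block_eq_iff)
  have "w ** y'' = 0" "matrix_scale z w = 0"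
    using Y[rule_format, of \<gamma>2] unfolding 2 yy y0 block_0[symmetric]
    by (simp_all add: block_mult block_eq_iff)
  then show "Y = 0" using w y0 by (simp add: column_mult_row_eq_0 yy block_0)
next
  fix Z :: "complex^('a option)^('a option)" assume Z: "\<forall>\<gamma>. Z ** slice T \<gamma> = 0"
  obtain y y' y'' z where yy: "Z = block y y' y'' z" by (rule block_cases)
  obtain \<gamma>1 where 1: "slice T \<gamma>1 = block (mat 1) 0 0 0" by (rule slice_first)
  obtain \<gamma>2 where 2: "slice T \<gamma>2 = block (x m) w u 0" by (rule slice_last)
  have y0: "y = 0" "y'' = 0"
    using Z[rule_format, of \<gamma>1] unfolding 1 yy block_0[symmetric]
    by (simp_all add: block_mult block_eq_iff)
  have "y' ** u = 0" "matrix_scale z u = 0"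
    using Z[rule_format, of \<gamma>2] unfolding 2 yy y0 block_0[symmetric]
    by (simp_all add: block_mult block_eq_iff)
  then show "Z = 0" using u y0 by (simp add: column_mult_row_eq_0 yy block_0)
qed

text \<open>
  The elements \<open>Id, x\<^sub>2, \<dots>, x\<^sub>m\<^sub>-\<^sub>1\<close> are corners of elements of the triple intersection: \<open>Id\<close> comes from
  \<open>T\<close> itself, and \<open>x\<^sub>s\<close> from \<open>Z\<close> with rows \<open>(x\<^sub>s, w\<^sub>s)\<close>, \<open>(0, 0)\<close> and \<open>Y\<close> with rows \<open>(x\<^sub>s, 0)\<close>,
  \<open>(u\<^sub>s, 0)\<close>, where (2), (4) and (5) say that \<open>Z K = K Y \<in> T(A\<^sup>*)\<close>.  By (3) there is also a nonzero
  element with corner \<open>0\<close>, with \<open>w\<close> and \<open>u\<close> as the only nonzero blocks of \<open>Z\<close> and \<open>Y\<close>.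
\<close>

lemma sharp_if_conditions:
  assumes c2: "cond2 m x" and c3: "cond3 m x u w" and c4: "cond4 m x u w" and c5: "cond5 m x u w"
  shows "sharp_111 T"
proof -
  obtain \<gamma>1 where 1: "slice T \<gamma>1 = block (mat 1) 0 0 0" by (rule slice_first)
  obtain \<gamma>2 where 2: "slice T \<gamma>2 = block (x m) w u 0" by (rule slice_last)
  interpret b: block_frame T P P' Q Q' \<gamma>1
    using 1 slice_pairing conciseI[OF c2] by unfold_locales blast+
  let ?S = "mspace.span (x ` {1..m-1})"
  have mono: "mspace.span (x ` {2..m-1}) \<subseteq> ?S" by (intro mspace.span_mono image_mono) auto
  have "x s \<in> b.corner ` triple_intersection T" if s: "s \<in> {1..m-1}" for s
  proof (cases "s = 1")
    case True
    have "T \<in> triple_intersection T"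
      unfolding triple_intersection_slices by (intro exI[of _ "mat 1"]) simp
    moreover have "b.corner T = x s" using True x1 by (simp add: b.corner_def 1)
    ultimately show ?thesis by (metis imageI)
  next
    case False
    then have s2: "s \<in> {2..m-1}" using s by auto
    obtain us ws where e: "x s ** x m + ws ** u = x m ** x s + w ** us"
      and mem: "x m ** x s + w ** us \<in> mspace.span (x ` {2..m-1})"
      using c5 s2 unfolding cond5_def cond5_eq_def by blast
    have ann: "u ** x s = 0" "x s ** w = 0" using c4 s2 by (auto simp: cond4_def)
    have xsS: "x s \<in> ?S" using s by (intro mspace.span_base) auto
    have A: "block (x s) ws 0 0 ** slice T \<gamma> = slice T \<gamma> ** block (x s) 0 us 0 \<and>
       block (x s) ws 0 0 ** slice T \<gamma> \<in> range (slice T)" for \<gamma>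
    proof -
      define c where "c = pairing \<gamma> (a m)"
      define y where "y = (\<Sum>s\<in>{1..m-1}. matrix_scale (pairing \<gamma> (a s)) (x s))"
      have yS: "y \<in> ?S" unfolding y_def
        by (intro mspace.span_sum mspace.span_scale mspace.span_base) auto
      have sl: "slice T \<gamma> = block (matrix_scale c (x m) + y) (matrix_scale c w) (matrix_scale c u) 0"
        unfolding slice_split c_def y_def ..
      have comm: "x s ** y = y ** x s" and yx: "y ** x s \<in> ?S"
        using c2 xsS yS unfolding cond2_def by blast+
      have L: "block (x s) ws 0 0 ** slice T \<gamma>
          = block (matrix_scale c (x s ** x m + ws ** u) + x s ** y) 0 0 0"
        unfolding sl block_mult by (simp add: matrix_algebra ann mspace.scale_right_distrib add_ac)
      have R: "slice T \<gamma> ** block (x s) 0 us 0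
          = block (matrix_scale c (x m ** x s + w ** us) + y ** x s) 0 0 0"
        unfolding sl block_mult by (simp add: matrix_algebra ann mspace.scale_right_distrib add_ac)
      have "matrix_scale c (x m ** x s + w ** us) + y ** x s \<in> ?S"
        by (rule mspace.span_add[OF mspace.span_scale[OF subsetD[OF mono mem]] yx])
      then show ?thesis unfolding L R e comm using span_block_in_range by blast
    qed
    obtain t where t: "t \<in> triple_intersection T" "\<And>\<alpha>. slice t \<alpha> = block (x s) ws 0 0 ** slice T \<alpha>"
      using triple_intersection_lift[of "block (x s) ws 0 0" "block (x s) 0 us 0"] A by blast
    have "b.corner t = x s" by (simp add: b.corner_def t(2) 1 block_mult)
    then show ?thesis using t(1) by (metis imageI)
  qed
  then have "?S \<subseteq> b.corner ` triple_intersection T"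
    by (intro mspace.span_minimal b.subspace_corner_image) auto
  then have "mspace.dim ?S \<le> mspace.dim (b.corner ` triple_intersection T)"
    by (rule mfin.dim_subset)
  moreover have "mspace.dim ?S = m - 1" using c2 by (simp add: cond2_def)
  ultimately have ge: "CARD('a) \<le> mspace.dim (b.corner ` triple_intersection T)" using m by simp
  have A: "block 0 w 0 0 ** slice T \<gamma> = slice T \<gamma> ** block 0 0 u 0 \<and>
       block 0 w 0 0 ** slice T \<gamma> \<in> range (slice T)" for \<gamma>
  proof -
    have L: "block 0 w 0 0 ** slice T \<gamma> = block (matrix_scale (pairing \<gamma> (a m)) (w ** u)) 0 0 0"
      unfolding slice_pairing block_mult by (simp add: matrix_algebra)
    have R: "slice T \<gamma> ** block 0 0 u 0 = block (matrix_scale (pairing \<gamma> (a m)) (w ** u)) 0 0 0"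
      unfolding slice_pairing block_mult by (simp add: matrix_algebra)
    have "matrix_scale (pairing \<gamma> (a m)) (w ** u) \<in> ?S"
      using c3 mono by (intro mspace.span_scale) (auto simp: cond3_def)
    then show ?thesis unfolding L R using span_block_in_range by blast
  qed
  obtain t where t: "t \<in> triple_intersection T" "\<And>\<alpha>. slice t \<alpha> = block 0 w 0 0 ** slice T \<alpha>"
    using triple_intersection_lift[of "block 0 w 0 0" "block 0 0 u 0"] A by blast
  have "b.corner t = 0" by (simp add: b.corner_def t(2) 1 block_mult)
  moreover have "t \<noteq> 0"
  proof
    assume "t = 0"
    then have "slice t \<gamma>2 = 0" by (simp add: slice_def contract_A_0)
    then show False
      using u w unfolding t(2) 2 block_0[symmetric]
      by (simp add: block_mult block_eq_iff column_mult_row_eq_0)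
  qed
  ultimately show ?thesis using b.sharpI[OF ge] t(1) by blast
qed

end

lemma normal_form_frame:
  fixes T :: "complex^('n::finite option)^('n option)^('n option)" and x :: "nat \<Rightarrow> complex^'n^'n"
  assumes m: "m = CARD('n option)" and nf: "normal_form m T a K \<beta> c x u w"
  shows "\<exists>P' Q'. normal_frame T (\<chi> i j. \<beta> j $ i) P' (\<chi> i j. c j $ i) Q' m a x u w"
proof -
  have a: "basis_family {1..m} a" and \<beta>: "basis_family UNIV \<beta>" and c: "basis_family UNIV c"
    and T: "T = (\<Sum>s = 1..m. tensor_A (a s) (K s))" and x1: "x 1 = mat 1" and u: "u \<noteq> 0" and w: "w \<noteq> 0"
    and K1: "matrix_wrt \<beta> c (K 1) (block (mat 1) 0 0 0)"
    and Ks: "\<And>s. s \<in> {2..m-1} \<Longrightarrow> matrix_wrt \<beta> c (K s) (block (x s) 0 0 0)"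
    and Km: "matrix_wrt \<beta> c (K m) (block (x m) w u 0)"
    using nf unfolding normal_form_def by auto
  obtain P P' where PP: "P = (\<chi> i j. \<beta> j $ i)" "P ** P' = mat 1" "P' ** P = mat 1"
    using basis_matrix[OF \<beta>] .
  obtain Q Q' where QQ: "Q = (\<chi> i j. c j $ i)" "Q ** Q' = mat 1" "Q' ** Q = mat 1"
    using basis_matrix[OF c] .
  interpret frame T P P' Q Q' by unfold_locales (use PP QQ in auto)
  have conj: "Q' ** K s ** P = M" if "matrix_wrt \<beta> c (K s) M" for s M
    using that QQ(3) unfolding matrix_wrt_iff PP(1)[symmetric] QQ(1)[symmetric]
    by (metis matrix_mul_assoc matrix_mul_lid)
  have blocks: "Q' ** K s ** P = block (x s) (if s = m then w else 0) (if s = m then u else 0) 0"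
    if "s \<in> {1..m}" for s
  proof -
    have "m \<noteq> 1" using m by simp
    then show ?thesis
      using that conj[OF K1] conj[OF Ks, of s] conj[OF Km] x1 by (cases "s = m"; cases "s = 1") auto
  qed
  have "slice T \<gamma> = block (\<Sum>s\<in>{1..m}. matrix_scale (pairing \<gamma> (a s)) (x s))
      (matrix_scale (pairing \<gamma> (a m)) w) (matrix_scale (pairing \<gamma> (a m)) u) 0" for \<gamma>
  proof -
    have "slice T \<gamma> = (\<Sum>s\<in>{1..m}. matrix_scale (pairing \<gamma> (a s)) (Q' ** K s ** P))"
      unfolding slice_def T contract_A_sum_tensor_A pairing_def
      by (simp add: matrix_mult_sum_right matrix_mult_sum_left matrix_algebra)
    also have "\<dots> = (\<Sum>s\<in>{1..m}. block (matrix_scale (pairing \<gamma> (a s)) (x s))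
       (if s = m then matrix_scale (pairing \<gamma> (a m)) w else 0)
       (if s = m then matrix_scale (pairing \<gamma> (a m)) u else 0) 0)"
      by (rule sum.cong) (simp_all add: blocks block_scale)
    also have "\<dots> = block (\<Sum>s\<in>{1..m}. matrix_scale (pairing \<gamma> (a s)) (x s))
      (matrix_scale (pairing \<gamma> (a m)) w) (matrix_scale (pairing \<gamma> (a m)) u) 0"
      unfolding block_sum using m by simp
    finally show ?thesis .
  qed
  then have "normal_frame T P P' Q Q' m a x u w"
    by unfold_locales (use m a x1 u w in auto)
  then show ?thesis unfolding PP(1) QQ(1) by blast
qed

section \<open>Existence, sufficiency and normalization\<close>

text \<open>
  The dimension of a complement of a line is the cardinality of \<open>'n\<close>, so a basis of it can be indexed
  by the non-\<open>None\<close> elements.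
\<close>

lemma direct_decomposition_basis:
  fixes b0 :: "complex^('n::finite option)"
  assumes dd: "direct_decomposition U (vec.span {b0})" and b0: "b0 \<noteq> 0"
  obtains b :: "'n option \<Rightarrow> complex^('n option)"
  where "basis_family UNIV b" "b None = b0" "\<And>i. b (Some i) \<in> U"
proof -
  have U: "vec.subspace U" and int: "U \<inter> vec.span {b0} = {0}"
    and sum: "{x + y |x y. x \<in> U \<and> y \<in> vec.span {b0}} = UNIV"
    using dd by (auto simp: direct_decomposition_def)
  obtain B where B: "B \<subseteq> U" "vec.independent B" "U \<subseteq> vec.span B" "card B = vec.dim U"
    using vec.basis_exists[of U] .
  have spanB: "vec.span B = U" using vec.span_subspace[OF B(1,3) U] .
  have "b0 \<notin> U" using int b0 vec.span_base[of b0 "{b0}"] by auto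
  then have ind: "vec.independent (insert b0 B)" using B(2) spanB by (simp add: vec.independent_insertI)
  have "v \<in> vec.span (insert b0 B)" for v
  proof -
    obtain x y where "v = x + y" "x \<in> U" "y \<in> vec.span {b0}" using sum by blast
    then show ?thesis
      using spanB vec.span_mono[of B "insert b0 B"] vec.span_mono[of "{b0}" "insert b0 B"]
      by (auto intro!: vec.span_add)
  qed
  then have span: "vec.span (insert b0 B) = UNIV" by blast
  have fin: "finite B" using vec.finiteI_independent[OF B(2)] .
  have "b0 \<notin> B" using \<open>b0 \<notin> U\<close> B(1) by blast
  then have "card B + 1 = card (insert b0 B)" using fin by simp
  also have "\<dots> = vec.dim (UNIV :: (complex^('n option)) set)"
    using vec.dim_span_eq_card_independent[OF ind] span by simp
  also have "\<dots> = CARD('n) + 1" by (simp add: card_cart_basis vec.dimension_def)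
  finally have cardB: "card (UNIV :: 'n set) = card B" by simp
  obtain h where h: "bij_betw h (UNIV :: 'n set) B"
    using finite_same_card_bij[OF finite fin cardB] by blast
  define b where "b j = (case j of None \<Rightarrow> b0 | Some i \<Rightarrow> h i)" for j
  have "range b = insert b0 B"
    using h by (simp add: UNIV_option_conv image_image b_def bij_betw_def)
  then have "basis_family UNIV b" by (intro basis_family_if_spanning) (auto simp: span)
  moreover have "b (Some i) \<in> U" for i
    using h B(1) by (auto simp: b_def bij_betw_def)
  ultimately show ?thesis using that[of b] by (simp add: b_def)
qed

text \<open>
  Take any basis of the complement \<open>B\<close> of the kernel and its image under \<open>L\<close>.  The image vectors and
  \<open>c0\<close> span, hence form a basis.
\<close>

lemma corank_one_bases:
  fixes L :: "complex^('n::finite option)^('n option)"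
  assumes ker: "{v. L *v v = 0} = vec.span {\<beta>0}" and \<beta>0: "\<beta>0 \<noteq> 0"
    and B: "direct_decomposition B {v. L *v v = 0}"
    and C: "direct_decomposition (range ((*v) L)) (vec.span {c0})"
  obtains \<beta> c :: "'n option \<Rightarrow> complex^('n option)"
  where "basis_family UNIV \<beta>" "basis_family UNIV c"
    "\<beta> None = \<beta>0" "\<And>i. \<beta> (Some i) \<in> B" "c None = c0" "\<And>i. c (Some i) \<in> range ((*v) L)"
    "matrix_wrt \<beta> c L (block (mat 1 :: complex^'n^'n) 0 0 0)"
proof -
  obtain \<beta> :: "'n option \<Rightarrow> complex^('n option)" where \<beta>: "basis_family UNIV \<beta>" "\<beta> None = \<beta>0" "\<And>i. \<beta> (Some i) \<in> B"
    using direct_decomposition_basis[OF B[unfolded ker] \<beta>0] by metis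
  define c :: "'n option \<Rightarrow> complex^('n option)"
    where "c j = (case j of None \<Rightarrow> c0 | Some i \<Rightarrow> L *v \<beta> (Some i))" for j
  have L0: "L *v \<beta>0 = 0" using ker vec.span_base[of \<beta>0 "{\<beta>0}"] by blast
  have range: "L *v v \<in> vec.span (range c)" for v
  proof -
    have "v \<in> vec.span (range \<beta>)" using \<beta>(1) by (simp add: basis_family_def)
    then have "L *v v \<in> vec.span ((*v) L ` range \<beta>)" by (simp add: matrix_vector_mul_linear_gen vec.span_image)
    also have "\<dots> \<subseteq> vec.span (range c)"
    proof (rule vec.span_minimal[OF _ vec.subspace_span], safe)
      fix j
      show "L *v \<beta> j \<in> vec.span (range c)"
      proof (cases j)
        case None
        then show ?thesis using L0 \<beta>(2) vec.span_zero by simp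
      next
        case (Some i)
        then have "L *v \<beta> j = c (Some i)" by (simp add: c_def)
        then show ?thesis by (simp add: vec.span_base)
      qed
    qed
    finally show ?thesis .
  qed
  have "v \<in> vec.span (range c)" for v
  proof -
    obtain y z where v: "v = L *v y + z" and z: "z \<in> vec.span {c0}"
      using C unfolding direct_decomposition_def by blast
    have "c0 \<in> range c" by (rule range_eqI[of _ _ None]) (simp add: c_def)
    then have "z \<in> vec.span (range c)" using z vec.span_mono[of "{c0}" "range c"] by blast
    then show ?thesis unfolding v using range by (intro vec.span_add)
  qed
  then have "basis_family UNIV c" by (intro basis_family_if_spanning) auto
  moreover have "matrix_wrt \<beta> c L (block (mat 1 :: complex^'n^'n) 0 0 0)"
    unfolding matrix_wrt_def
  proof
    fix j :: "'n option"
    show "L *v \<beta> j = (\<Sum>k\<in>UNIV. block (mat 1 :: complex^'n^'n) 0 0 0 $ k $ j *s c k)"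
    proof (cases j)
      case None
      then show ?thesis using L0 \<beta>(2) by (simp add: sum_option)
    next
      case (Some i)
      have "(\<Sum>k\<in>UNIV. block (mat 1 :: complex^'n^'n) 0 0 0 $ k $ j *s c k) = (\<Sum>k\<in>UNIV. if k = i then c (Some i) else 0)"
        unfolding sum_option Some by (simp add: mat_def if_distrib[of "\<lambda>z. z *s _"] cong: if_cong)
      then show ?thesis by (simp add: Some c_def)
    qed
  qed
  ultimately show ?thesis using that[of \<beta> c] \<beta> by (auto simp: c_def)
qed

text \<open>
  The bases of \<open>B\<^sup>*\<close> and \<open>C\<close> come from \<open>corank_one_bases\<close>; the basis of \<open>A\<close> is dual to
  an adapted basis of \<open>A\<^sup>*\<close>.
\<close>

lemma normal_form_exists:
  fixes T :: "complex^('n::finite option)^('n option)^('n option)"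
  assumes m: "m = CARD('n option)" and a: "basis_family {1..m} a"
    and T: "T = (\<Sum>s = 1..m. tensor_A (a s) (K s))" and conc: "concise T" and ab: "abundant_111 T"
    and ng: "\<not> one_A_generic T" and rank: "rank (K 1) = m - 1"
    and ker: "{v. K 1 *v v = 0} = vec.span {\<beta>0}"
    and B: "direct_decomposition B {v. K 1 *v v = 0}"
    and C: "direct_decomposition (range ((*v) (K 1))) (vec.span {c0})"
  shows "\<exists>a' K' \<beta> c (x :: nat \<Rightarrow> complex^'n^'n) u w.
           normal_form m T a' K' \<beta> c x u w \<and> K' 1 = K 1 \<and>
           (\<forall>i. \<beta> (Some i) \<in> B) \<and> \<beta> None = \<beta>0 \<and>
           (\<forall>i. c (Some i) \<in> range ((*v) (K 1))) \<and> c None = c0 \<and>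
           cond1 m x u w \<and> cond2 m x \<and> cond3 m x u w \<and> cond4 m x u w \<and>
           cond5 m x u w \<and> cond6 m x u w"
    and "sharp_111 T"
proof -
  have m2: "m \<ge> 2"
  proof -
    have "CARD('n) > 0" by simp
    then show ?thesis using m by simp
  qed
  have cardI: "card {1..m} = CARD('n option)" by (simp add: m)
  have "rank (K 1) \<noteq> CARD('n option)" using rank m by simp
  then obtain v where "v \<noteq> 0" "K 1 *v v = 0" unfolding rank_neq_iff_kernel by blast
  then have "\<beta>0 \<noteq> 0" using ker by (metis (mono_tags) mem_Collect_eq singletonD vec.span_empty vec.span_insert_0)
  then obtain \<beta> c :: "'n option \<Rightarrow> complex^('n option)" where \<beta>: "basis_family UNIV \<beta>" and c: "basis_family UNIV c"
    and bases: "\<beta> None = \<beta>0" "\<And>i. \<beta> (Some i) \<in> B" "c None = c0" "\<And>i. c (Some i) \<in> range ((*v) (K 1))"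
    and K1: "matrix_wrt \<beta> c (K 1) (block (mat 1 :: complex^'n^'n) 0 0 0)"
    using corank_one_bases[OF ker _ B C] by metis
  obtain P P' where PP: "P = (\<chi> i j. \<beta> j $ i)" "P ** P' = mat 1" "P' ** P = mat 1"
    using basis_matrix[OF \<beta>] .
  obtain Q Q' where QQ: "Q = (\<chi> i j. c j $ i)" "Q ** Q' = mat 1" "Q' ** Q = mat 1"
    using basis_matrix[OF c] .
  interpret f: frame T P P' Q Q' by unfold_locales (use PP QQ in auto)
  have wrt: "matrix_wrt \<beta> c (contract_A T \<gamma>) (f.slice T \<gamma>)" for \<gamma>
  proof -
    have "contract_A T \<gamma> ** P = Q ** f.slice T \<gamma> ** (P' ** P)"
      by (subst f.contract_A_slice) (simp only: matrix_mul_assoc)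
    then show ?thesis by (simp add: matrix_wrt_iff PP(1)[symmetric] QQ(1)[symmetric] PP(3))
  qed
  obtain \<alpha>0 where \<alpha>0: "\<And>r s. r \<in> {1..m} \<Longrightarrow> s \<in> {1..m} \<Longrightarrow>
      (\<Sum>i\<in>UNIV. \<alpha>0 r $ i * a s $ i) = (if r = s then 1 else 0)"
    using dual_basis[OF finite_atLeastAtMost cardI a] by blast
  define \<alpha>1 where "\<alpha>1 = \<alpha>0 1"
  have cA1: "contract_A T \<alpha>1 = K 1"
  proof -
    have "contract_A T \<alpha>1 = (\<Sum>s\<in>{1..m}. if s = 1 then K 1 else 0)"
      unfolding T contract_A_sum_tensor_A \<alpha>1_def
      by (rule sum.cong) (use \<alpha>0[of 1] m2 in auto)
    then show ?thesis using m2 by simp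
  qed
  have s1: "f.slice T \<alpha>1 = block (mat 1) 0 0 0"
  proof -
    have "K 1 ** P = Q ** block (mat 1) 0 0 0"
      using K1 by (simp add: matrix_wrt_iff PP(1) QQ(1))
    then have "Q' ** (K 1 ** P) = (Q' ** Q) ** block (mat 1) 0 0 0" by (simp add: matrix_mul_assoc)
    then show ?thesis by (simp add: f.slice_def cA1 QQ(3) matrix_mul_assoc)
  qed
  note orth = f.not_generic_imp_orthogonal[OF ng s1]
  interpret b: block_frame T P P' Q Q' \<alpha>1
  proof
    show "\<exists>X w u. f.slice T \<gamma> = block X w u 0" for \<gamma>
      using orth(1) by (metis block_cases)
  qed (use s1 conc in auto)
  obtain \<alpha>m where \<alpha>m: "b.w \<alpha>m \<noteq> 0" "b.u \<alpha>m \<noteq> 0" using b.exists_nonzero_corner by blast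
  interpret ab: abundant_frame T P P' Q Q' \<alpha>1 \<alpha>m
    using ab \<alpha>m orth(2)[OF b.slice_block] by unfold_locales auto
  obtain \<alpha> where \<alpha>: "basis_family {1..m} \<alpha>" "\<alpha> 1 = \<alpha>1" "\<alpha> m = \<alpha>m"
    "b.V = vec.span (\<alpha> ` {1..m-1})" "ab.V0 = vec.span (\<alpha> ` {2..m-1})"
    using ab.adapted_basis[OF m] .
  obtain a' where a': "basis_family {1..m} a'"
    "\<And>i j. (\<Sum>s\<in>{1..m}. \<alpha> s $ i * a' s $ j) = (if i = j then 1 else 0)"
    using dual_basis[OF finite_atLeastAtMost cardI \<alpha>(1)] by blast
  have a'\<alpha>: "(\<Sum>s\<in>{1..m}. a' s $ i * \<alpha> s $ j) = (if i = j then 1 else 0)" for i j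
    unfolding mult.commute[of "a' _ $ i"] using a'(2)[of j i] by auto
  define x where "x s = b.X (\<alpha> s)" for s
  define K' where "K' s = contract_A T (\<alpha> s)" for s
  note conds = ab.adapted_conditions[OF m \<alpha>(2-5), folded x_def]
  have x1: "x 1 = mat 1" unfolding x_def \<alpha>(2) by simp
  have nf: "normal_form m T a' K' \<beta> c x (b.u \<alpha>m) (b.w \<alpha>m)"
    unfolding normal_form_def
  proof (intro conjI ballI)
    show "T = (\<Sum>s = 1..m. tensor_A (a' s) (K' s))"
      unfolding K'_def by (rule tensor_expansion[OF a'\<alpha>])
    show "matrix_wrt \<beta> c (K' 1) (block (mat 1) 0 0 0)"
      unfolding K'_def \<alpha>(2) cA1 by (rule K1)
    show "matrix_wrt \<beta> c (K' s) (block (x s) 0 0 0)" if s: "s \<in> {2..m-1}" for s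
    proof -
      have "\<alpha> s \<in> b.V" unfolding \<alpha>(4) using s by (intro vec.span_base) auto
      then have "f.slice T (\<alpha> s) = block (x s) 0 0 0" by (simp add: b.slice_block x_def b.V_def)
      then show ?thesis using wrt[of "\<alpha> s"] by (simp add: K'_def)
    qed
    show "matrix_wrt \<beta> c (K' m) (block (x m) (b.w \<alpha>m) (b.u \<alpha>m) 0)"
      using wrt[of \<alpha>m] by (simp add: K'_def x_def \<alpha>(3) b.slice_block)
  qed (use a'(1) \<beta> c x1 \<alpha>m in auto)
  obtain R R' S S' where "normal_frame T R R' S S' m a' x (b.u \<alpha>m) (b.w \<alpha>m)"
    using normal_form_frame[OF m nf] by blast
  then interpret n: normal_frame T R R' S S' m a' x "b.u \<alpha>m" "b.w \<alpha>m" .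
  have c1: "cond1 m x (b.u \<alpha>m) (b.w \<alpha>m)" by (rule n.cond1I[OF ng conds(3)])
  have c6: "cond6 m x (b.u \<alpha>m) (b.w \<alpha>m)" using cond6I[OF _ c1 conds(3,4)] m2 by simp
  have "K' 1 = K 1" unfolding K'_def \<alpha>(2) by (rule cA1)
  then show "\<exists>a' K' \<beta> c (x :: nat \<Rightarrow> complex^'n^'n) u w.
           normal_form m T a' K' \<beta> c x u w \<and> K' 1 = K 1 \<and>
           (\<forall>i. \<beta> (Some i) \<in> B) \<and> \<beta> None = \<beta>0 \<and>
           (\<forall>i. c (Some i) \<in> range ((*v) (K 1))) \<and> c None = c0 \<and>
           cond1 m x u w \<and> cond2 m x \<and> cond3 m x u w \<and> cond4 m x u w \<and>
           cond5 m x u w \<and> cond6 m x u w"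
    using nf bases c1 conds c6 by blast
  show "sharp_111 T" by (rule b.abundant_imp_sharp[OF ab])
qed

lemma conditions_sufficient:
  fixes T :: "complex^('n::finite option)^('n option)^('n option)" and x :: "nat \<Rightarrow> complex^'n^'n"
  assumes m: "m = CARD('n option)" and nf: "normal_form m T a K \<beta> c x u w"
    and c: "cond1 m x u w" "cond2 m x" "cond3 m x u w" "cond4 m x u w" "cond5 m x u w"
  shows "sharp_111 T" "concise T" "\<not> one_A_generic T" "cond6 m x u w"
proof -
  obtain R R' S S' where "normal_frame T R R' S S' m a x u w"
    using normal_form_frame[OF m nf] by blast
  then interpret n: normal_frame T R R' S S' m a x u w .
  show "sharp_111 T" by (rule n.sharp_if_conditions[OF c(2-5)])
  show "concise T" by (rule n.conciseI[OF c(2)])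
  show "\<not> one_A_generic T" by (rule n.cond1_imp_not_generic[OF c(1)])
  show "cond6 m x u w" using cond6I[OF _ c(1,4,5)] n.m_ge by simp
qed

text \<open>
  The change of bases adds to the vectors of \<open>{B\<^sup>*}'\<close> multiples of the last basis vector of \<open>B\<^sup>*\<close>, and
  to the last basis vector of \<open>C\<close> an element of \<open>C'\<close>.  It replaces the upper left block \<open>X\<close> of a slice
  by \<open>X + q u + w p\<close> and so affects \<open>x\<^sub>m\<close> alone.  Conditions (2)-(4) involve only the other blocks, (1)
  holds because \<open>T\<close> is still not \<open>1\<^sub>A\<close>-generic, and (5) holds with \<open>us - p x\<^sub>s\<close> and \<open>ws - x\<^sub>s q\<close> in place
  of \<open>us\<close> and \<open>ws\<close>.
\<close>

lemma normalization:
  fixes T :: "complex^('n::finite option)^('n option)^('n option)" and x :: "nat \<Rightarrow> complex^'n^'n"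
    and u_star :: "complex^1^'n" and w_star :: "complex^'n^1"
  assumes m: "m = CARD('n option)" and nf: "normal_form m T a K \<beta> c x u w"
    and c: "cond1 m x u w" "cond2 m x" "cond3 m x u w" "cond4 m x u w" "cond5 m x u w"
    and us: "u ** u_star = mat 1" and ws: "w_star ** w = mat 1"
  shows "\<exists>\<beta>' c' y x'. x' = x(m := y) \<and>
           normal_form m T a K \<beta>' c' x' u w \<and>
           cond1 m x' u w \<and> cond2 m x' \<and> cond3 m x' u w \<and> cond4 m x' u w \<and>
           cond5 m x' u w \<and> cond6 m x' u w \<and>
           y ** u_star = 0 \<and> w_star ** y = 0 \<and>
           (\<forall>s\<in>{2..m-1}. cond5_eq m x' u w s (w_star ** x s ** y) (y ** x s ** u_star))"
proof -
  define P where "P = (\<chi> i j. \<beta> j $ i)"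
  define Q where "Q = (\<chi> i j. c j $ i)"
  obtain P' Q' where fr: "normal_frame T P P' Q Q' m a x u w"
    unfolding P_def Q_def using normal_form_frame[OF m nf] by blast
  interpret n: normal_frame T P P' Q Q' m a x u w by (rule fr)
  have u0: "u \<noteq> 0" and w0: "w \<noteq> 0" by (rule n.u, rule n.w)
  (* These choices solve y u_star = 0 and w_star y = 0, which together determine (p, q) up to
     adding a multiple of (u, -w). *)
  define p where "p = - (w_star ** x m)"
  define q where "q = - (x m ** u_star) + w ** (w_star ** x m ** u_star)"
  define y where "y = x m + q ** u + w ** p"
  define x' where "x' = x(m := y)"
  have wuu: "w ** A ** u ** u_star = w ** A" for A :: "complex^1^1"
    by (simp add: us flip: matrix_mul_assoc)
  have quu: "q ** u ** u_star = q" by (simp add: us flip: matrix_mul_assoc)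
  have wwp: "w_star ** (w ** p) = p" by (simp add: ws matrix_mul_assoc)
  have wwA: "w_star ** (w ** A) = A" for A :: "complex^1^1" by (simp add: ws matrix_mul_assoc)
  have yu: "y ** u_star = 0"
  proof -
    have "y ** u_star = x m ** u_star + q + w ** p ** u_star"
      unfolding y_def by (simp add: matrix_mult_add_left quu)
    then show ?thesis by (simp add: q_def p_def matrix_algebra)
  qed
  have wy: "w_star ** y = 0"
  proof -
    have "w_star ** q = - (w_star ** x m ** u_star) + w_star ** x m ** u_star"
      unfolding q_def matrix_add_ldistrib wwA by (simp add: matrix_algebra)
    then have "w_star ** q = 0" by simp
    moreover have "w_star ** y = w_star ** x m + (w_star ** q) ** u + p"
      unfolding y_def matrix_add_ldistrib wwp by (simp add: matrix_mul_assoc)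
    ultimately show ?thesis by (simp add: p_def)
  qed
  have m2: "m \<ge> 2" by (rule n.m_ge)
  have x's: "x' s = x s" if "s \<in> {1..m-1}" for s using that m2 by (auto simp: x'_def)
  have x's2: "x' s = x s" if "s \<in> {2..m-1}" for s using that x's by auto
  have im1: "x' ` {1..m-1} = x ` {1..m-1}" by (rule image_cong) (simp_all only: x's)
  have im2: "x' ` {2..m-1} = x ` {2..m-1}" by (rule image_cong) (simp_all only: x's2)
  have x'm: "x' m = y" by (simp add: x'_def)
  define P2 where "P2 = P ** block (mat 1) 0 p 1"
  define Q2 where "Q2 = Q ** block (mat 1) (- q) 0 1"
  have P2: "P2 ** (block (mat 1) 0 (- p) 1 ** P') = mat 1"
  proof -
    have "P2 ** (block (mat 1) 0 (- p) 1 ** P') = P ** (block (mat 1) 0 p 1 ** block (mat 1) 0 (- p) 1) ** P'"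
      unfolding P2_def by (simp only: matrix_mul_assoc)
    also have "block (mat 1) 0 p 1 ** block (mat 1) 0 (- p) 1 = mat 1"
      by (simp add: block_mult flip: block_mat_1)
    finally show ?thesis by (simp add: n.P)
  qed
  have QE: "block (mat 1) (- q) 0 1 ** block (mat 1) q 0 1 = mat 1"
    by (simp add: block_mult flip: block_mat_1)
  have Q2: "Q2 ** (block (mat 1) q 0 1 ** Q') = mat 1"
  proof -
    have "Q2 ** (block (mat 1) q 0 1 ** Q') = Q ** (block (mat 1) (- q) 0 1 ** block (mat 1) q 0 1) ** Q'"
      unfolding Q2_def by (simp only: matrix_mul_assoc)
    then show ?thesis by (simp add: QE n.Q)
  qed
  define \<beta>' where "\<beta>' j = column j P2" for j
  define c' where "c' j = column j Q2" for j
  have \<beta>': "basis_family UNIV \<beta>'" and c': "basis_family UNIV c'"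
    unfolding \<beta>'_def c'_def using basis_family_columns P2 Q2 by blast+
  have mats: "(\<chi> i j. \<beta>' j $ i) = P2" "(\<chi> i j. c' j $ i) = Q2"
    by (simp_all add: \<beta>'_def c'_def column_def vec_eq_iff)
  have wrt: "matrix_wrt \<beta>' c' L (block (X + q ** u' + w' ** p) w' u' 0)"
    if "matrix_wrt \<beta> c L (block X w' u' 0)" for L X w' u'
  proof -
    have LP: "L ** P = Q ** block X w' u' 0" using that by (simp add: matrix_wrt_iff P_def Q_def)
    have "L ** P2 = (L ** P) ** block (mat 1) 0 p 1" by (simp add: P2_def matrix_mul_assoc)
    also have "\<dots> = Q ** (block (mat 1) (- q) 0 1 ** block (mat 1) q 0 1) ** block X w' u' 0
        ** block (mat 1) 0 p 1"
      unfolding LP QE by (simp add: matrix_mul_assoc)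
    also have "\<dots> = Q2 ** (block (mat 1) q 0 1 ** block X w' u' 0 ** block (mat 1) 0 p 1)"
      unfolding Q2_def by (simp only: matrix_mul_assoc)
    also have "block (mat 1) q 0 1 ** block X w' u' 0 ** block (mat 1) 0 p 1
        = block (X + q ** u' + w' ** p) w' u' 0"
      by (simp add: block_mult)
    finally show ?thesis unfolding matrix_wrt_iff mats .
  qed
  have nf': "normal_form m T a K \<beta>' c' x' u w"
  proof -
    have old: "basis_family {1..m} a" "T = (\<Sum>s = 1..m. tensor_A (a s) (K s))"
      "matrix_wrt \<beta> c (K 1) (block (mat 1) 0 0 0)"
      "\<And>s. s \<in> {2..m-1} \<Longrightarrow> matrix_wrt \<beta> c (K s) (block (x s) 0 0 0)"
      "matrix_wrt \<beta> c (K m) (block (x m) w u 0)"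
      using nf unfolding normal_form_def by auto
    have 1: "x' 1 = mat 1" using x's[of 1] m2 n.x1 by simp
    show ?thesis unfolding normal_form_def
    proof (intro conjI ballI)
      show "matrix_wrt \<beta>' c' (K 1) (block (mat 1) 0 0 0)" using wrt[OF old(3)] by simp
      show "matrix_wrt \<beta>' c' (K s) (block (x' s) 0 0 0)" if "s \<in> {2..m-1}" for s
        using wrt[OF old(4)[OF that]] x's2[OF that] by simp
      show "matrix_wrt \<beta>' c' (K m) (block (x' m) w u 0)"
        using wrt[OF old(5)] by (simp add: x'm y_def)
    qed (use old(1,2) \<beta>' c' 1 u0 w0 in auto)
  qed
  have c2': "cond2 m x'" using c(2) unfolding cond2_def im1 .
  have c3': "cond3 m x' u w" using c(3) unfolding cond3_def im2 .
  have c4': "cond4 m x' u w" using c(4) x's2 unfolding cond4_def by simp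
  have c1': "cond1 m x' u w"
  proof -
    obtain R R' S S' where "normal_frame T R R' S S' m a x' u w"
      using normal_form_frame[OF m nf'] by blast
    then interpret n': normal_frame T R R' S S' m a x' u w .
    show ?thesis by (rule n'.cond1I[OF n.cond1_imp_not_generic[OF c(1)] c4'])
  qed
  have eq: "\<exists>us ws. cond5_eq m x' u w s us ws" if s: "s \<in> {2..m-1}" for s
  proof -
    obtain us ws where e: "x s ** x m + ws ** u = x m ** x s + w ** us"
      and mem: "x m ** x s + w ** us \<in> mspace.span (x ` {2..m-1})"
      using c(5) s unfolding cond5_def cond5_eq_def by blast
    have ann: "u ** x s = 0" "x s ** w = 0" using c(4) s by (auto simp: cond4_def)
    have ann2: "A ** u ** x s = 0" for A :: "complex^1^'n"
      using ann by (simp flip: matrix_mul_assoc)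
    have L: "x s ** y + (ws - x s ** q) ** u = x s ** x m + ws ** u"
      unfolding y_def by (simp add: matrix_algebra ann)
    have R: "y ** x s + w ** (us - p ** x s) = x m ** x s + w ** us"
      unfolding y_def by (simp add: matrix_algebra ann2)
    have "cond5_eq m x' u w s (us - p ** x s) (ws - x s ** q)"
      unfolding cond5_eq_def im2 x's2[OF s] x'm L R using e mem by simp
    then show ?thesis by blast
  qed
  have c5': "cond5 m x' u w" by (rule cond5I[OF u0 w0 c3' eq])
  have c6': "cond6 m x' u w" using cond6I[OF _ c1' c4' c5'] m2 by simp
  have "cond5_eq m x' u w s (w_star ** x s ** y) (y ** x s ** u_star)" if s: "s \<in> {2..m-1}" for s
  proof -
    obtain us' ws' where e5: "cond5_eq m x' u w s us' ws'" using eq[OF s] by blast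
    then have e: "x s ** y + ws' ** u = y ** x s + w ** us'"
      by (simp add: cond5_eq_def x's2[OF s] x'm)
    (* Multiplying the relation by w_star on the left and by u_star on the right expresses us' and
       ws' by the claimed solution, up to the same multiple k of u and w. *)
    define k where "k = (w_star ** ws') $ 1 $ 1"
    have "w_star ** (x s ** y + ws' ** u) = w_star ** (y ** x s + w ** us')" using e by simp
    then have "w_star ** x s ** y + (w_star ** ws') ** u = (w_star ** y) ** x s + (w_star ** w) ** us'"
      by (simp add: matrix_algebra)
    then have 1: "w_star ** x s ** y + matrix_scale k u = us'"
      by (simp add: wy ws one_by_one_mult[of _ u] k_def)
    have "(x s ** y + ws' ** u) ** u_star = (y ** x s + w ** us') ** u_star" using e by simp
    then have "x s ** (y ** u_star) + ws' ** (u ** u_star) = y ** x s ** u_star + w ** (us' ** u_star)"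
      by (simp add: matrix_algebra)
    then have 2: "ws' = y ** x s ** u_star + matrix_scale ((us' ** u_star) $ 1 $ 1) w"
      by (simp add: yu us mult_one_by_one[of w])
    have "w_star ** ws' = (w_star ** y) ** x s ** u_star + matrix_scale ((us' ** u_star) $ 1 $ 1) (w_star ** w)"
      by (subst 2) (simp add: matrix_algebra)
    then have "k = (us' ** u_star) $ 1 $ 1" by (simp add: k_def wy ws mat_def)
    then have 2: "ws' = y ** x s ** u_star + matrix_scale k w" using 2 by simp
    have "w_star ** x s ** y = us' + matrix_scale (- k) u \<and> y ** x s ** u_star = ws' + matrix_scale (- k) w"
      using 1 2 by (metis add_diff_cancel_right' mspace.scale_minus_left diff_conv_add_uminus)
    then show ?thesis unfolding cond5_solutions[OF u0 w0 c3' e5] by blast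
  qed
  then show ?thesis using x'_def nf' c1' c2' c3' c4' c5' c6' yu wy by blast
qed

theorem proposition3p3:
  fixes m :: nat
  assumes m: "m = CARD('n::finite option)"
  shows
    "(\<forall>(T :: complex^('n option)^('n option)^('n option))
       (a :: nat \<Rightarrow> complex^('n option)) (K :: nat \<Rightarrow> complex^('n option)^('n option))
       (B' :: (complex^('n option)) set) (\<beta>\<^sub>m :: complex^('n option)) (c\<^sub>m :: complex^('n option)).
        basis_family {1..m} a \<and> T = (\<Sum>s = 1..m. tensor_A (a s) (K s)) \<and>
        concise T \<and> abundant_111 T \<and> \<not> one_A_generic T \<and> rank (K 1) = m - 1 \<and>
        {v. K 1 *v v = 0} = vec.span {\<beta>\<^sub>m} \<and>
        direct_decomposition B' {v. K 1 *v v = 0} \<and>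
        direct_decomposition (range ((*v) (K 1))) (vec.span {c\<^sub>m}) \<longrightarrow>
        (\<exists>a' K' \<beta> c (x :: nat \<Rightarrow> complex^'n^'n) u w.
           normal_form m T a' K' \<beta> c x u w \<and> K' 1 = K 1 \<and>
           (\<forall>i. \<beta> (Some i) \<in> B') \<and> \<beta> None = \<beta>\<^sub>m \<and>
           (\<forall>i. c (Some i) \<in> range ((*v) (K 1))) \<and> c None = c\<^sub>m \<and>
           cond1 m x u w \<and> cond2 m x \<and> cond3 m x u w \<and> cond4 m x u w \<and>
           cond5 m x u w \<and> cond6 m x u w) \<and>
        sharp_111 T)
   \<and> (\<forall>(T :: complex^('n option)^('n option)^('n option)) a K \<beta> c (x :: nat \<Rightarrow> complex^'n^'n) u w.
        normal_form m T a K \<beta> c x u w \<and>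
        cond1 m x u w \<and> cond2 m x \<and> cond3 m x u w \<and> cond4 m x u w \<and> cond5 m x u w \<longrightarrow>
        sharp_111 T \<and> concise T \<and> \<not> one_A_generic T \<and> cond6 m x u w)
   \<and> (\<forall>(T :: complex^('n option)^('n option)^('n option)) a K \<beta> c (x :: nat \<Rightarrow> complex^'n^'n) u w
       (u_star :: complex^1^'n) (w_star :: complex^'n^1).
        normal_form m T a K \<beta> c x u w \<and>
        cond1 m x u w \<and> cond2 m x \<and> cond3 m x u w \<and> cond4 m x u w \<and> cond5 m x u w \<and>
        u ** u_star = mat 1 \<and> w_star ** w = mat 1 \<longrightarrow>
        (\<exists>\<beta>' c' y x'. x' = x(m := y) \<and>
           normal_form m T a K \<beta>' c' x' u w \<and>
           cond1 m x' u w \<and> cond2 m x' \<and> cond3 m x' u w \<and> cond4 m x' u w \<and>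
           cond5 m x' u w \<and> cond6 m x' u w \<and>
           y ** u_star = 0 \<and> w_star ** y = 0 \<and>
           (\<forall>s\<in>{2..m-1}. cond5_eq m x' u w s (w_star ** x s ** y) (y ** x s ** u_star))))"
  apply (intro conjI allI impI; elim conjE)
        apply (rule normal_form_exists(1)[OF m]; assumption)
       apply (rule normal_form_exists(2)[OF m]; assumption)
      apply (rule conditions_sufficient(1)[OF m]; assumption)
     apply (rule conditions_sufficient(2)[OF m]; assumption)
    apply (rule conditions_sufficient(3)[OF m]; assumption)
   apply (rule conditions_sufficient(4)[OF m]; assumption)
  apply (rule normalization[OF m]; assumption)
  done

end
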